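(* Let $G_\alpha(t)$, $t\in[0,1]$, be the continuous centered Gaussian process with covariance function \[ \operatorname{Cov}\bigl(G_\alpha(s),G_\alpha(t)\bigr)=\frac{2}{2\alpha-1}\,s^\alpha\bigl(t^{1-\alpha}-t^\alpha\bigr),\qquad 0\le s\le t\le 1 \] (equivalently, $G_\alpha(t)=(\alpha-1/2)^{-1/2}t^{1-\alpha}\mathrm{Br}(t^{2\alpha-1})$ for a standard Brownian bridge $\mathrm{Br}$, with $G_\alpha(0)=0$). Then, as $n\to\infty$, conditionally on the event $BINGO(n,n)$ (i.e. $\Delta_{2n}=0$), \[ n^{-1/2}\Delta_{\lfloor 2nt\rfloor}\ \xrightarrow{d}\ G_\alpha(t),\qquad t\in[0,1], \] in the space $D[0,1]$ with the Skorohod topology.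
   Context: Fix $\alpha>1$. Let $(X_k,Y_k)_{k\ge2}$ be the Markov chain on $\mathbb N\times\mathbb N$ with $(X_2,Y_2)=(1,1)$ and, from state $(i,j)$, moving to $(i+1,j)$ with probability $i^\alpha/(i^\alpha+j^\alpha)$ and to $(i,j+1)$ with probability $j^\alpha/(i^\alpha+j^\alpha)$ (so $X_k+Y_k=k$; this is a two-urn model where each new ball goes to an urn with probability proportional to the $\alpha$-th power of its current content). $BINGO(i,j)$ is the event that the chain visits $(i,j)$, i.e. $(X_{i+j},Y_{i+j})=(i,j)$. Set $\Delta_k=X_k-Y_k$ for $k\ge2$ and $\Delta_0=\Delta_1=0$. *)

theory Defs
  imports "HOL-Probability.Probability"
begin

fun urn_path :: "real \<Rightarrow> nat \<Rightarrow> nat \<times> nat \<Rightarrow> (nat \<times> nat) list pmf" where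
  "urn_path a 0 s = return_pmf [s]"
| "urn_path a (Suc m) (i, j) =
     bind_pmf (bernoulli_pmf (real i powr a / (real i powr a + real j powr a)))
       (\<lambda>b. map_pmf (\<lambda>rest. (i, j) # rest)
              (urn_path a m (if b then (i + 1, j) else (i, j + 1))))"

text \<open>The chain (X_k,Y_k), k = 2..2n, started at (X_2,Y_2)=(1,1): a list whose entry
  number k-2 is (X_k,Y_k).\<close>
definition urn_chain :: "real \<Rightarrow> nat \<Rightarrow> (nat \<times> nat) list pmf" where
  "urn_chain a n = urn_path a (2 * n - 2) (1, 1)"

text \<open>BINGO(n,n): the chain visits (n,n), i.e. (X_{2n},Y_{2n}) = (n,n).\<close>
definition bingo_nn :: "nat \<Rightarrow> (nat \<times> nat) list set" where
  "bingo_nn n = {xs. last xs = (n, n)}"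

definition Delta :: "(nat \<times> nat) list \<Rightarrow> nat \<Rightarrow> int" where
  "Delta xs k = (if k < 2 then 0 else int (fst (xs ! (k - 2))) - int (snd (xs ! (k - 2))))"

definition scaled_Delta :: "nat \<Rightarrow> (nat \<times> nat) list \<Rightarrow> real \<Rightarrow> real" where
  "scaled_Delta n xs t = real_of_int (Delta xs (nat \<lfloor>2 * real n * t\<rfloor>)) / sqrt (real n)"

definition cadlag :: "(real \<Rightarrow> real) \<Rightarrow> bool" where
  "cadlag x \<longleftrightarrow> (\<forall>t\<in>{0..<1}. (x \<longlongrightarrow> x t) (at_right t)) \<and>
                 (\<forall>t\<in>{0<..1}. \<exists>l. (x \<longlongrightarrow> l) (at_left t))"

definition skorohod_time_changes :: "(real \<Rightarrow> real) set" where
  "skorohod_time_changes = {l. strict_mono_on {0..1} l \<and> continuous_on {0..1} l \<and> l 0 = 0 \<and> l 1 = 1}"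

definition skorohod_dist :: "(real \<Rightarrow> real) \<Rightarrow> (real \<Rightarrow> real) \<Rightarrow> real" where
  "skorohod_dist x y = Inf ((\<lambda>l. max (SUP t\<in>{0..1}. \<bar>l t - t\<bar>) (SUP t\<in>{0..1}. \<bar>x t - y (l t)\<bar>))
                              ` skorohod_time_changes)"

definition skorohod_bcont :: "((real \<Rightarrow> real) \<Rightarrow> real) \<Rightarrow> bool" where
  "skorohod_bcont f \<longleftrightarrow> (\<exists>B. \<forall>x. cadlag x \<longrightarrow> \<bar>f x\<bar> \<le> B) \<and>
     (\<forall>x. cadlag x \<longrightarrow> (\<forall>e>0. \<exists>d>0. \<forall>y. cadlag y \<longrightarrow> skorohod_dist x y < d \<longrightarrow> \<bar>f y - f x\<bar> < e))"

definition G_cov :: "real \<Rightarrow> real \<Rightarrow> real \<Rightarrow> real" where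
  "G_cov a s t = 2 / (2 * a - 1) * (min s t) powr a * ((max s t) powr (1 - a) - (max s t) powr a)"

definition centered_normal :: "real \<Rightarrow> real measure" where
  "centered_normal v = (if v = 0 then return borel 0 else density lborel (normal_density 0 (sqrt v)))"

definition cont_gaussian_process ::
    "'w measure \<Rightarrow> ('w \<Rightarrow> real \<Rightarrow> real) \<Rightarrow> (real \<Rightarrow> real \<Rightarrow> real) \<Rightarrow> bool" where
  "cont_gaussian_process M X K \<longleftrightarrow> prob_space M \<and>
     (\<forall>t. (\<lambda>w. X w t) \<in> borel_measurable M) \<and>
     (\<forall>w\<in>space M. continuous_on {0..1} (X w)) \<and>
     (\<forall>ts cs. length cs = length ts \<longrightarrow> set ts \<subseteq> {0..1} \<longrightarrow>
        distr M borel (\<lambda>w. \<Sum>i<length ts. cs ! i * X w (ts ! i)) =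
        centered_normal (\<Sum>i<length ts. \<Sum>j<length ts. cs ! i * cs ! j * K (ts ! i) (ts ! j)))"

end

theory Submission
  imports Defs
begin

text \<open>Conditioned on visiting \<^term>\<open>(n, n)\<close>, the urn read backwards is the chain that steps
  from (i, j) down to (i - 1, j) with probability proportional to the a-th power of i, conditioned to
  end at (1, 1): the weights of the forward and backward steps differ by a factor that telescopes
  along paths. The probability of ending at (1, 1) rather than on an axis is nearly the same from all
  states with large and nearly equal contents and tends to a positive limit, so the conditioning is
  asymptotically independent of what the backward chain does at macroscopic times.

  The backward imbalance D at level k has drift close to - a D / k, so that D divided by the a-th power
  of k is almost a martingale. Characteristic functions of its increments over dyadic blocks give
  independent Gaussian limits, hence the limit process is a constant times the a-th power of t times a
  Brownian motion run at time \<^term>\<open>t powr (1 - 2 * a) - 1\<close>. Since the drift always points towards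
  zero, the square of D plus k is a supermartingale, which controls the times near 0, and an
  exponential supermartingale bounds the modulus of continuity away from 0. The limit process is
  obtained on the dyadic rationals by Kolmogorov extension and inherits the modulus of continuity from the chain.\<close>

section \<open>Paths of finitely branching Markov chains\<close>

text \<open>Reversal moves the conditioning from the top, where it would bias every step, to the
  bottom, where \<open>hit\<close> has already become nearly constant. The factor a in the drift
  comes from ((1+u)^a - (1-u)^a) / ((1+u)^a + (1-u)^a) = a u + O(u^2) with u = D/k; dividing D by
  k^a cancels it. The variance of D k^(-a) then accumulates like a multiple of k^(1-2a), which is
  infinite at time 0. This singularity shapes the proof: Gaussian blocks start at the first positive
  grid point, and near 0 only second moment bounds are used. One step has an error of order n^(-3/2)
  in the characteristic function, so 2n steps cost n^(-1/2).

  The bound \<open>hit a (n, n)\<close> >= 1/2 carries tightness to the conditioned law at the price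
  of a factor 2. As the limit paths are continuous, tightness can be measured in uniform distance;
  but a Skorohod continuous functional need be neither uniformly continuous nor a priori measurable
  along the limit. Inf-convolution settles both points, giving a lower bound for f and an upper one
  through -f.\<close>

fun chain_path :: "('s \<Rightarrow> 's pmf) \<Rightarrow> nat \<Rightarrow> 's \<Rightarrow> 's list pmf" where
  "chain_path K 0 s = return_pmf [s]"
| "chain_path K (Suc m) s = bind_pmf (K s) (\<lambda>s'. map_pmf (Cons s) (chain_path K m s'))"

fun chain_state :: "('s \<Rightarrow> 's pmf) \<Rightarrow> nat \<Rightarrow> 's \<Rightarrow> 's pmf" where
  "chain_state K 0 s = return_pmf s"
| "chain_state K (Suc m) s = bind_pmf (K s) (chain_state K m)"

lemma chain_path_hd_length:
  "xs \<in> set_pmf (chain_path K m s) \<Longrightarrow> hd xs = s \<and> length xs = Suc m"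
  by (induction m arbitrary: s xs) auto

lemma chain_path_nth_0: "xs \<in> set_pmf (chain_path K m s) \<Longrightarrow> xs ! 0 = s"
  using chain_path_hd_length[of xs K m s] by (cases xs) auto

lemma chain_path_step:
  "xs \<in> set_pmf (chain_path K m s) \<Longrightarrow> k < m \<Longrightarrow> xs ! Suc k \<in> set_pmf (K (xs ! k))"
proof (induction m arbitrary: s xs k)
  case (Suc m)
  then obtain s' ys where *: "s' \<in> set_pmf (K s)" "ys \<in> set_pmf (chain_path K m s')" "xs = s # ys"
    by auto
  show ?case
  proof (cases k)
    case 0
    then show ?thesis using * chain_path_nth_0[OF *(2)] by simp
  next
    case (Suc k')
    then show ?thesis using * Suc.IH[OF *(2), of k'] Suc.prems by simp
  qed
qed auto

lemma finite_chain_path: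
  assumes "\<And>s. finite (set_pmf (K s))"
  shows "finite (set_pmf (chain_path K m s))"
  by (induction m arbitrary: s) (auto simp: assms)

lemma finite_chain_state:
  assumes "\<And>s. finite (set_pmf (K s))"
  shows "finite (set_pmf (chain_state K m s))"
  by (induction m arbitrary: s) (auto simp: assms)

text \<open>The Markov property at a fixed time. Paths are cut into blocks and windows through this
  identity.\<close>

lemma map_drop_chain_path:
  "map_pmf (drop r) (chain_path K (r + m) s) = bind_pmf (chain_state K r s) (chain_path K m)"
proof (induction r arbitrary: s)
  case 0
  then show ?case by (simp add: bind_return_pmf map_pmf_ident)
next
  case (Suc r)
  then show ?case
    by (simp add: map_bind_pmf map_pmf_comp bind_assoc_pmf)
qed

lemma map_nth_chain_path:
  assumes "r \<le> m" shows "map_pmf (\<lambda>xs. xs ! r) (chain_path K m s) = chain_state K r s"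
  using assms
proof (induction r arbitrary: s m)
  case 0
  have "map_pmf (\<lambda>xs. xs ! 0) (chain_path K m s) = map_pmf (\<lambda>_. s) (chain_path K m s)"
    by (intro map_pmf_cong refl) (auto dest: chain_path_nth_0)
  then show ?case by (simp add: map_pmf_const)
next
  case (Suc r)
  then obtain m' where m: "m = Suc m'" by (cases m) auto
  show ?case using Suc.IH[of m'] Suc.prems
    by (simp add: m map_bind_pmf map_pmf_comp)
qed

lemma map_last_chain_path: "map_pmf last (chain_path K m s) = chain_state K m s"
proof -
  have "map_pmf last (chain_path K m s) = map_pmf (\<lambda>xs. xs ! m) (chain_path K m s)"
  proof (intro map_pmf_cong refl)
    fix xs assume "xs \<in> set_pmf (chain_path K m s)"
    then have "length xs = Suc m" using chain_path_hd_length[of xs K m s] by blast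
    then show "last xs = xs ! m" by (subst last_conv_nth) auto
  qed
  then show ?thesis by (simp add: map_nth_chain_path)
qed

lemma chain_state_add:
  "chain_state K (r + m) s = bind_pmf (chain_state K r s) (chain_state K m)"
proof (induction r arbitrary: s)
  case (Suc r)
  have "chain_state K (r + m) = (\<lambda>x. bind_pmf (chain_state K r x) (chain_state K m))"
    using Suc.IH by auto
  then show ?case by (simp add: bind_assoc_pmf)
qed (simp add: bind_return_pmf)

text \<open>An explicit product weight is what allows a path to be compared with its reversal factor
  by factor.\<close>

lemma pmf_chain_path:
  "pmf (chain_path K m s) xs =
    (if length xs = Suc m \<and> hd xs = s then \<Prod>k<m. pmf (K (xs ! k)) (xs ! Suc k) else 0)"
proof (induction m arbitrary: s xs)
  case 0
  have "xs = [s] \<longleftrightarrow> length xs = Suc 0 \<and> hd xs = s" by (cases xs) auto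
  then show ?case by (auto simp: pmf_return indicator_def)
next
  case (Suc m)
  show ?case
  proof (cases "length xs = Suc (Suc m) \<and> hd xs = s")
    case False
    then have "xs \<notin> set_pmf (chain_path K (Suc m) s)"
      using chain_path_hd_length[of xs K "Suc m" s] by blast
    then have "pmf (chain_path K (Suc m) s) xs = 0" by (metis set_pmf_iff)
    then show ?thesis by (simp only: False if_False)
  next
    case True
    define ys where "ys = tl xs"
    have "xs \<noteq> []" using True by auto
    then have xs: "xs = s # ys" using True list.collapse[of xs] by (simp add: ys_def)
    have l: "length ys = Suc m" using True by (simp add: ys_def)
    then have hdys: "hd ys = ys ! 0" by (intro hd_conv_nth) auto
    have "pmf (chain_path K (Suc m) s) xs
        = measure_pmf.expectation (K s) (\<lambda>s'. pmf (chain_path K m s') ys)"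
      unfolding xs by (simp add: pmf_bind pmf_map_inj')
    also have "\<dots> = measure_pmf.expectation (K s)
        (\<lambda>s'. indicator {hd ys} s' * (\<Prod>k<m. pmf (K (ys ! k)) (ys ! Suc k)))"
      using l by (intro Bochner_Integration.integral_cong refl) (auto simp: Suc.IH indicator_def)
    also have "\<dots> = pmf (K s) (hd ys) * (\<Prod>k<m. pmf (K (ys ! k)) (ys ! Suc k))"
      by (simp add: pmf.rep_eq)
    also have "\<dots> = (\<Prod>k<Suc m. pmf (K (xs ! k)) (xs ! Suc k))"
      by (subst prod.lessThan_Suc_shift) (simp add: xs hdys)
    finally show ?thesis using True by simp
  qed
qed

lemma expectation_bind_finite:
  fixes h :: "'b \<Rightarrow> 'c :: {banach, second_countable_topology}"
  assumes "finite (set_pmf p)" "\<And>x. x \<in> set_pmf p \<Longrightarrow> finite (set_pmf (f x))"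
  shows "measure_pmf.expectation (bind_pmf p f) h =
    measure_pmf.expectation p (\<lambda>x. measure_pmf.expectation (f x) h)"
proof -
  have "measure_pmf.expectation (bind_pmf p f) h =
      (\<Sum>a\<in>set_pmf p. pmf p a *\<^sub>R measure_pmf.expectation (f a) h)"
    using assms by (intro pmf_expectation_bind) auto
  also have "\<dots> = measure_pmf.expectation p (\<lambda>x. measure_pmf.expectation (f x) h)"
    using assms by (intro integral_measure_pmf[symmetric]) auto
  finally show ?thesis .
qed

lemma prob_bind_finite:
  assumes "finite (set_pmf p)" "\<And>x. x \<in> set_pmf p \<Longrightarrow> finite (set_pmf (f x))"
  shows "measure_pmf.prob (bind_pmf p f) A =
    measure_pmf.expectation p (\<lambda>x. measure_pmf.prob (f x) A)"
  using expectation_bind_finite[OF assms, where h="indicator A :: _ \<Rightarrow> real"] by simp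

lemma expectation_mono_finite:
  assumes "finite (set_pmf p)" "\<And>x. x \<in> set_pmf p \<Longrightarrow> f x \<le> (g x :: real)"
  shows "measure_pmf.expectation p f \<le> measure_pmf.expectation p g"
  using assms by (intro integral_mono_AE integrable_measure_pmf_finite) (auto simp: AE_measure_pmf_iff)

text \<open>Superharmonicity is required only at states reachable before time \<open>r\<close>,
  because the functions used later have this property only above a certain level.\<close>

lemma chain_state_superharmonic:
  fixes V :: "'s \<Rightarrow> real"
  assumes fin: "\<And>s. finite (set_pmf (K s))"
    and super: "\<And>j t. j < r \<Longrightarrow> t \<in> set_pmf (chain_state K j s) \<Longrightarrow> measure_pmf.expectation (K t) V \<le> V t"
  shows "measure_pmf.expectation (chain_state K r s) V \<le> V s"
  using super
proof (induction r arbitrary: s)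
  case (Suc r)
  have "measure_pmf.expectation (chain_state K (Suc r) s) V =
     measure_pmf.expectation (K s) (\<lambda>s'. measure_pmf.expectation (chain_state K r s') V)"
    by (simp add: expectation_bind_finite fin finite_chain_state)
  also have "\<dots> \<le> measure_pmf.expectation (K s) V"
  proof (intro expectation_mono_finite fin Suc.IH)
    fix x j t assume "x \<in> set_pmf (K s)" "j < r" "t \<in> set_pmf (chain_state K j x)"
    then show "measure_pmf.expectation (K t) V \<le> V t"
      using Suc.prems[of "Suc j" t] by auto
  qed
  also have "\<dots> \<le> V s" using Suc.prems[of 0 s] by simp
  finally show ?case .
qed simp

text \<open>Doob's maximal inequality for a supermartingale stopped on leaving \<open>A\<close>. The
  event asks all states before \<open>j\<close> to lie in \<open>A\<close>, so superharmonicity of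
  \<open>V\<close> is needed on \<open>A\<close> only. The induction conditions on the first step: a
  start above \<open>l\<close> makes the bound trivial, and a start outside \<open>A\<close> and
  below \<open>l\<close> makes the event impossible.\<close>

lemma chain_maximal_ineq:
  fixes V :: "'s \<Rightarrow> real"
  assumes fin: "\<And>s. finite (set_pmf (K s))"
    and V: "\<And>s. 0 \<le> V s" and l: "0 < l"
    and super: "\<And>s. s \<in> A \<Longrightarrow> measure_pmf.expectation (K s) V \<le> V s"
  shows "measure_pmf.prob (chain_path K m s)
    {xs. \<exists>j\<le>m. l \<le> V (xs ! j) \<and> (\<forall>i<j. xs ! i \<in> A)} \<le> V s / l"
proof (induction m arbitrary: s)
  case 0
  show ?case
    using V[of s] l by (auto simp: measure_return_pmf indicator_def)
next
  case (Suc m)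
  let ?E = "\<lambda>m. {xs. \<exists>j\<le>m. l \<le> V (xs ! j) \<and> (\<forall>i<j. xs ! i \<in> A)}"
  consider "l \<le> V s" | "V s < l" "s \<notin> A" | "V s < l" "s \<in> A" by linarith
  then show ?case
  proof cases
    case 1
    then have "1 \<le> V s / l" using l by simp
    then show ?thesis using order_trans[OF measure_pmf.prob_le_1] by fast
  next
    case 2
    have "set_pmf (chain_path K (Suc m) s) \<inter> ?E (Suc m) = {}"
    proof (rule equals0I)
      fix xs assume xs: "xs \<in> set_pmf (chain_path K (Suc m) s) \<inter> ?E (Suc m)"
      then obtain j where j: "l \<le> V (xs ! j)" "\<forall>i<j. xs ! i \<in> A" by auto
      have "xs ! 0 = s" using xs chain_path_nth_0 by fast
      then show False using j 2 by (cases j) auto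
    qed
    then have "measure_pmf.prob (chain_path K (Suc m) s) (?E (Suc m)) = 0"
      by (simp add: measure_pmf_zero_iff)
    then show ?thesis using V[of s] l by simp
  next
    case 3
    have "measure_pmf.prob (chain_path K (Suc m) s) (?E (Suc m)) =
      measure_pmf.expectation (K s) (\<lambda>s'. measure_pmf.prob (chain_path K m s') (Cons s -` ?E (Suc m)))"
      by (simp only: chain_path.simps)
        (subst prob_bind_finite, auto simp: fin finite_chain_path measure_map_pmf)
    also have "Cons s -` ?E (Suc m) \<subseteq> ?E m"
    proof
      fix ys assume "ys \<in> Cons s -` ?E (Suc m)"
      then obtain j where j: "j \<le> Suc m" "l \<le> V ((s # ys) ! j)" "\<forall>i<j. (s # ys) ! i \<in> A" by auto
      with 3 obtain j' where "j = Suc j'" by (cases j) auto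
      with j show "ys \<in> ?E m" by (auto intro!: exI[of _ j'])
    qed
    then have "measure_pmf.expectation (K s) (\<lambda>s'. measure_pmf.prob (chain_path K m s') (Cons s -` ?E (Suc m)))
      \<le> measure_pmf.expectation (K s) (\<lambda>s'. V s' / l)"
      by (intro expectation_mono_finite fin order_trans[OF _ Suc.IH] measure_pmf.finite_measure_mono) auto
    also have "\<dots> \<le> V s / l" using super[OF 3(2)] l by (simp add: divide_right_mono)
    finally show ?thesis .
  qed
qed

text \<open>Total mass 1 forces the constant to be 1. This spares any computation of the normalising
  constants in the reversal.\<close>

lemma pmf_eq_if_proportional:
  fixes p q :: "'a pmf"
  assumes "\<And>x. pmf p x = c * pmf q x"
  shows "p = q"
proof -
  have "(\<lambda>x. pmf p x) = (\<lambda>x. c * pmf q x)" using assms by auto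
  then have "infsetsum (pmf p) UNIV = c * infsetsum (pmf q) UNIV"
    by (simp add: infsetsum_cmult_right pmf_abs_summable)
  then have "c = 1" by (simp add: infsetsum_pmf_eq_1)
  then show ?thesis using assms by (intro pmf_eqI) simp
qed

lemma expectation_cond_pmf_finite:
  fixes h :: "'a \<Rightarrow> real"
  assumes "finite (set_pmf p)" "set_pmf p \<inter> A \<noteq> {}"
  shows "measure_pmf.expectation (cond_pmf p A) h =
    measure_pmf.expectation p (\<lambda>x. indicator A x * h x) / measure_pmf.prob p A"
proof -
  have "measure_pmf.expectation (cond_pmf p A) h = (\<Sum>x\<in>set_pmf p. h x * pmf (cond_pmf p A) x)"
    using assms by (intro integral_measure_pmf_real) (auto simp: set_cond_pmf)
  also have "\<dots> = (\<Sum>x\<in>set_pmf p. (indicator A x * h x) * pmf p x) / measure_pmf.prob p A"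
    unfolding sum_divide_distrib by (intro sum.cong) (auto simp: pmf_cond assms)
  also have "(\<Sum>x\<in>set_pmf p. (indicator A x * h x) * pmf p x) = measure_pmf.expectation p (\<lambda>x. indicator A x * h x)"
    using assms by (intro integral_measure_pmf_real[symmetric]) auto
  finally show ?thesis .
qed

section \<open>Time reversal\<close>

definition urn_prob :: "real \<Rightarrow> nat \<times> nat \<Rightarrow> real" where
  "urn_prob a s = real (fst s) powr a / (real (fst s) powr a + real (snd s) powr a)"

definition up_step :: "real \<Rightarrow> nat \<times> nat \<Rightarrow> (nat \<times> nat) pmf" where
  "up_step a s = map_pmf (\<lambda>b. if b then (fst s + 1, snd s) else (fst s, snd s + 1))
     (bernoulli_pmf (urn_prob a s))"

text \<open>On an axis other than at the origin \<open>urn_prob\<close> is 0 or 1, so the branch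
  with truncated subtraction has probability zero. The origin, where 0 / 0 = 0 selects the second
  branch, is absorbing.\<close>

definition down_step :: "real \<Rightarrow> nat \<times> nat \<Rightarrow> (nat \<times> nat) pmf" where
  "down_step a s = map_pmf (\<lambda>b. if b then (fst s - 1, snd s) else (fst s, snd s - 1))
     (bernoulli_pmf (urn_prob a s))"

definition level :: "nat \<times> nat \<Rightarrow> nat" where "level s = fst s + snd s"

definition imbalance :: "nat \<times> nat \<Rightarrow> real" where "imbalance s = real (fst s) - real (snd s)"

definition drift :: "real \<Rightarrow> nat \<times> nat \<Rightarrow> real" where
  "drift a s = (real (fst s) powr a - real (snd s) powr a) / (real (fst s) powr a + real (snd s) powr a)"

lemma urn_prob_bounds: "0 \<le> urn_prob a s" "urn_prob a s \<le> 1"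
proof -
  have "x / (x + y) \<le> 1" if "0 \<le> x" "0 \<le> y" for x y :: real
    using that by (cases "x + y = 0") (auto simp: divide_le_eq)
  then show "0 \<le> urn_prob a s" "urn_prob a s \<le> 1" by (auto simp: urn_prob_def)
qed

lemma urn_path_eq_chain_path: "urn_path a m s = chain_path (up_step a) m s"
proof (induction m arbitrary: s)
  case (Suc m)
  obtain i j where s: "s = (i, j)" by (cases s)
  show ?case
    unfolding s up_step_def[of a "(i, j)"] chain_path.simps urn_path.simps bind_map_pmf
    by (intro bind_pmf_cong) (auto simp: Suc.IH urn_prob_def)
qed simp

lemma finite_set_down_step [simp]: "finite (set_pmf (down_step a s))"
  by (simp add: down_step_def)

lemma finite_down_path [simp]: "finite (set_pmf (chain_path (down_step a) m s))"
  by (rule finite_chain_path) simp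

lemma finite_down_state [simp]: "finite (set_pmf (chain_state (down_step a) m s))"
  by (rule finite_chain_state) simp

lemma expectation_map_bernoulli:
  fixes h :: "'a \<Rightarrow> 'b :: {banach, second_countable_topology}"
  assumes "0 \<le> p" "p \<le> 1"
  shows "measure_pmf.expectation (map_pmf f (bernoulli_pmf p)) h = p *\<^sub>R h (f True) + (1 - p) *\<^sub>R h (f False)"
proof -
  have "measure_pmf.expectation (bernoulli_pmf p) (\<lambda>x. h (f x)) =
      (\<Sum>b\<in>UNIV. pmf (bernoulli_pmf p) b *\<^sub>R h (f b))"
    by (rule integral_measure_pmf) auto
  then show ?thesis using assms by (simp add: UNIV_bool)
qed

lemma pmf_map_bernoulli:
  assumes "0 \<le> p" "p \<le> 1"
  shows "pmf (map_pmf f (bernoulli_pmf p)) x = p * indicator {x} (f True) + (1 - p) * indicator {x} (f False)"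
  using expectation_map_bernoulli[OF assms, of f "indicator {x} :: _ \<Rightarrow> real"] by (simp add: pmf.rep_eq)

text \<open>The reversing weight. Since i^(-a) + j^(-a) = (i^a + j^a) / (i^a j^a), multiplying a
  transition probability by \<open>kappa\<close> leaves just the inverse power of the content that
  does not change, which is the same seen from either end of the step.\<close>

definition kappa :: "real \<Rightarrow> nat \<times> nat \<Rightarrow> real" where
  "kappa a s = real (fst s) powr - a + real (snd s) powr - a"

definition positive_state :: "nat \<times> nat \<Rightarrow> bool" where
  "positive_state s \<longleftrightarrow> 1 \<le> fst s \<and> 1 \<le> snd s"

lemma urn_prob_kappa:
  assumes "positive_state s"
  shows "urn_prob a s * kappa a s = real (snd s) powr - a"
    "(1 - urn_prob a s) * kappa a s = real (fst s) powr - a"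
proof -
  have p: "real (fst s) powr a > 0" "real (snd s) powr a > 0"
    using assms by (auto simp: positive_state_def)
  define x y where "x = real (fst s) powr a" and "y = real (snd s) powr a"
  have xy: "x > 0" "y > 0" using p by (auto simp: x_def y_def)
  then have "x + y \<noteq> 0" by linarith
  note xy = xy this
  have "x / (x + y) * (inverse x + inverse y) = inverse y"
    "(1 - x / (x + y)) * (inverse x + inverse y) = inverse x"
    using xy by (auto simp: divide_simps)
  then show "urn_prob a s * kappa a s = real (snd s) powr - a"
    "(1 - urn_prob a s) * kappa a s = real (fst s) powr - a"
    by (auto simp: urn_prob_def kappa_def powr_minus x_def y_def)
qed

text \<open>Both sides equal the (-a)-th power of the content untouched by the step. Positivity is
  needed because an up step never starts on an axis while a down step may end there.\<close>

lemma up_down_balance: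
  assumes "positive_state s" "positive_state t"
  shows "pmf (up_step a s) t * kappa a s = pmf (down_step a t) s * kappa a t"
proof -
  obtain i j k l where st: "s = (i, j)" "t = (k, l)" by (cases s, cases t)
  have pos: "1 \<le> i" "1 \<le> j" "1 \<le> k" "1 \<le> l" using assms by (auto simp: st positive_state_def)
  have "pmf (up_step a s) t * kappa a s =
     (urn_prob a s * kappa a s) * indicator {t} (i + 1, j) + ((1 - urn_prob a s) * kappa a s) * indicator {t} (i, j + 1)"
    by (simp add: up_step_def pmf_map_bernoulli urn_prob_bounds st algebra_simps)
  also have "\<dots> = real j powr - a * indicator {t} (i + 1, j) + real i powr - a * indicator {t} (i, j + 1)"
    unfolding urn_prob_kappa[OF assms(1)] by (simp add: st)
  also have "\<dots> = real l powr - a * indicator {s} (k - 1, l) + real k powr - a * indicator {s} (k, l - 1)"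
    using pos by (auto simp: st indicator_def)
  also have "\<dots> = (urn_prob a t * kappa a t) * indicator {s} (k - 1, l) + ((1 - urn_prob a t) * kappa a t) * indicator {s} (k, l - 1)"
    unfolding urn_prob_kappa[OF assms(2)] by (simp add: st)
  also have "\<dots> = pmf (down_step a t) s * kappa a t"
    by (simp add: down_step_def pmf_map_bernoulli urn_prob_bounds st algebra_simps)
  finally show ?thesis .
qed

text \<open>The weights \<open>kappa\<close> at interior states cancel, so only the two endpoints
  contribute.\<close>

lemma prod_balance:
  assumes "\<And>k. k \<le> m \<Longrightarrow> positive_state (f k)"
  shows "(\<Prod>k<m. pmf (up_step a (f k)) (f (Suc k))) * kappa a (f 0) =
    (\<Prod>k<m. pmf (down_step a (f (Suc k))) (f k)) * kappa a (f m)"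
  using assms
proof (induction m)
  case (Suc m)
  have "(\<Prod>k<Suc m. pmf (up_step a (f k)) (f (Suc k))) * kappa a (f 0) =
     pmf (up_step a (f m)) (f (Suc m)) * ((\<Prod>k<m. pmf (up_step a (f k)) (f (Suc k))) * kappa a (f 0))"
    by (simp add: mult_ac)
  also have "\<dots> = (\<Prod>k<m. pmf (down_step a (f (Suc k))) (f k)) * (pmf (up_step a (f m)) (f (Suc m)) * kappa a (f m))"
    using Suc by (simp add: mult_ac)
  also have "\<dots> = (\<Prod>k<m. pmf (down_step a (f (Suc k))) (f k)) * (pmf (down_step a (f (Suc m))) (f m) * kappa a (f (Suc m)))"
    using Suc.prems by (subst up_down_balance) auto
  finally show ?case by (simp add: mult_ac)
qed simp

lemma up_path_positive:
  assumes "xs \<in> set_pmf (chain_path (up_step a) m s)" "positive_state s" "k \<le> m"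
  shows "positive_state (xs ! k)"
  using assms(3)
proof (induction k)
  case 0
  then show ?case using assms chain_path_nth_0 by metis
next
  case (Suc k)
  have "xs ! Suc k \<in> set_pmf (up_step a (xs ! k))"
    using chain_path_step[OF assms(1), of k] Suc.prems by simp
  then show ?case using Suc by (auto simp: up_step_def positive_state_def split: if_splits)
qed

lemma down_step_le:
  "t \<in> set_pmf (down_step a s) \<Longrightarrow> fst t \<le> fst s \<and> snd t \<le> snd s"
  by (auto simp: down_step_def)

text \<open>Contents never increase along the reversed chain, so positivity at the end propagates
  back to every earlier state.\<close>

lemma down_path_positive:
  assumes "xs \<in> set_pmf (chain_path (down_step a) m s)" "positive_state (xs ! m)" "k \<le> m"
  shows "positive_state (xs ! k)"
  using assms(3)
proof (induction rule: inc_induct)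
  case (step k)
  have "xs ! Suc k \<in> set_pmf (down_step a (xs ! k))"
    using chain_path_step[OF assms(1), of k] step by simp
  from down_step_le[OF this] show ?case using step.IH by (auto simp: positive_state_def)
qed (fact assms(2))

text \<open>The indicators supply, for each chain, the endpoint that is not its starting point. A
  path inside the positive quadrant is handled by balance along it. Any other path has weight zero
  on both sides: the up chain cannot leave the quadrant, and the down chain cannot return to
  it.\<close>

lemma up_down_path_reversal:
  assumes s: "positive_state s" and e: "positive_state e"
  shows "pmf (chain_path (up_step a) m s) xs * indicator {xs. last xs = e} xs * kappa a s =
     pmf (chain_path (down_step a) m e) (rev xs) * indicator {xs. last xs = s} (rev xs) * kappa a e"
proof (cases "length xs = Suc m \<and> hd xs = s \<and> last xs = e")
  case False
  have "pmf (chain_path (up_step a) m s) xs * indicator {xs. last xs = e} xs = 0"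
    using False by (auto simp: pmf_chain_path indicator_def)
  moreover have "pmf (chain_path (down_step a) m e) (rev xs) * indicator {xs. last xs = s} (rev xs) = 0"
    using False by (auto simp: pmf_chain_path indicator_def hd_rev last_rev)
  ultimately show ?thesis by (simp only: mult_zero_left)
next
  case True
  then have ne: "xs \<noteq> []" by auto
  have nth: "xs ! 0 = s" "xs ! m = e"
    using True ne by (auto simp: hd_conv_nth last_conv_nth)
  have rnth: "rev xs ! k = xs ! (m - k)" if "k \<le> m" for k
    using True that by (simp add: rev_nth)
  have hl: "hd (rev xs) = e" "last (rev xs) = s" "length (rev xs) = Suc m"
    using True by (auto simp: hd_rev last_rev)
  show ?thesis
  proof (cases "\<forall>k\<le>m. positive_state (xs ! k)")
    case pos: True
    \<comment> \<open>Reversing the list turns the k-th down step into the step from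
      \<open>xs ! (m - k)\<close>; reindexing then lists the steps in forward order.\<close>
    have "pmf (chain_path (down_step a) m e) (rev xs) = (\<Prod>k<m. pmf (down_step a (xs ! (m - k))) (xs ! (m - Suc k)))"
      unfolding pmf_chain_path using hl by (auto intro!: prod.cong simp: rnth)
    also have "\<dots> = (\<Prod>k<m. pmf (down_step a (xs ! Suc (m - Suc k))) (xs ! (m - Suc k)))"
      by (intro prod.cong) (auto simp: Suc_diff_Suc)
    also have "\<dots> = (\<Prod>k<m. pmf (down_step a (xs ! Suc k)) (xs ! k))"
      by (rule prod.nat_diff_reindex)
    finally show ?thesis
      using prod_balance[of m "\<lambda>k. xs ! k" a] pos True nth hl
      by (simp add: pmf_chain_path[of "up_step a"])
  next
    case False
    then obtain k where k: "k \<le> m" "\<not> positive_state (xs ! k)" by auto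
    have "xs \<notin> set_pmf (chain_path (up_step a) m s)"
      using up_path_positive[OF _ s k(1)] k(2) by blast
    moreover have "rev xs \<notin> set_pmf (chain_path (down_step a) m e)"
      using down_path_positive[of "rev xs" a m e "m - k"] k s nth rnth[of "m - k"] rnth[of m] by auto
    ultimately show ?thesis by (simp add: set_pmf_iff)
  qed
qed

text \<open>By path reversal the two conditioned weights differ by a factor built from
  \<open>kappa\<close> at the two endpoints and the two normalisers. It does not depend on the path,
  hence equals 1. The hypothesis \<open>ne\<close> is first carried over to the forward chain, so
  that both conditionings are meaningful.\<close>

lemma cond_urn_chain_eq_down:
  assumes n: "n \<ge> 1"
    and ne: "set_pmf (chain_path (down_step a) (2 * n - 2) (n, n)) \<inter> {xs. last xs = (1, 1)} \<noteq> {}"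
  shows "cond_pmf (urn_chain a n) (bingo_nn n) =
    map_pmf rev (cond_pmf (chain_path (down_step a) (2 * n - 2) (n, n)) {xs. last xs = (1, 1)})"
proof -
  let ?p = "chain_path (up_step a) (2 * n - 2) (1, 1)" and ?q = "chain_path (down_step a) (2 * n - 2) (n, n)"
  let ?A = "{xs. last xs = (n, n)}" and ?B = "{xs. last xs = (1 :: nat, 1 :: nat)}"
  have pos: "positive_state (1, 1)" "positive_state (n, n)" using n by (auto simp: positive_state_def)
  have kp: "kappa a (1, 1) > 0" "kappa a (n, n) > 0" using n by (auto simp: kappa_def)
  define c where "c = kappa a (n, n) / kappa a (1, 1)"
  have c: "c > 0" using kp by (simp add: c_def)
  have *: "pmf ?p xs * indicator ?A xs = c * (pmf ?q (rev xs) * indicator ?B (rev xs))" for xs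
    using up_down_path_reversal[OF pos, of a "2 * n - 2" xs] kp by (simp add: c_def field_simps)
  obtain ys where ys: "ys \<in> set_pmf ?q" "last ys = (1, 1)" using ne by auto
  have "pmf ?p (rev ys) * indicator ?A (rev ys) > 0"
    unfolding * using ys c by (simp add: pmf_positive)
  then have "pmf ?p (rev ys) \<noteq> 0" "rev ys \<in> ?A"
    by (cases "last (rev ys) = (n, n)"; simp)+
  then have nep: "set_pmf ?p \<inter> ?A \<noteq> {}"
    unfolding set_pmf_eq by blast
  have "cond_pmf ?p ?A = map_pmf rev (cond_pmf ?q ?B)"
  proof (rule pmf_eq_if_proportional)
    fix xs
    have "pmf (map_pmf rev (cond_pmf ?q ?B)) xs = pmf (cond_pmf ?q ?B) (rev xs)"
      using pmf_map_inj'[of rev "cond_pmf ?q ?B" "rev xs"] by (simp add: inj_on_def)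
    also have "\<dots> = (pmf ?q (rev xs) * indicator ?B (rev xs)) / measure_pmf.prob ?q ?B"
      by (subst pmf_cond[OF ne]) (simp add: indicator_def)
    finally have 1: "pmf (map_pmf rev (cond_pmf ?q ?B)) xs = \<dots>" .
    have "pmf (cond_pmf ?p ?A) xs = (pmf ?p xs * indicator ?A xs) / measure_pmf.prob ?p ?A"
      by (subst pmf_cond[OF nep]) (simp add: indicator_def)
    moreover have "measure_pmf.prob ?q ?B > 0"
      using ys by (simp add: measure_pmf_posI)
    ultimately show "pmf (cond_pmf ?p ?A) xs =
        (c * measure_pmf.prob ?q ?B / measure_pmf.prob ?p ?A) * pmf (map_pmf rev (cond_pmf ?q ?B)) xs"
      unfolding 1 * by simp
  qed
  then show ?thesis
    by (simp add: urn_chain_def bingo_nn_def urn_path_eq_chain_path)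
qed

lemma urn_prob_drift:
  assumes "level s \<ge> 1"
  shows "urn_prob a s = (1 + drift a s) / 2"
proof -
  have "real (fst s) powr a > 0 \<or> real (snd s) powr a > 0"
    using assms by (auto simp: level_def)
  then have "real (fst s) powr a + real (snd s) powr a > 0"
    by (auto intro: add_pos_nonneg add_nonneg_pos)
  then show ?thesis by (simp add: urn_prob_def drift_def field_simps)
qed

lemma abs_drift_le_1: "\<bar>drift a s\<bar> \<le> 1"
proof -
  have "\<bar>x - y\<bar> / (x + y) \<le> 1" if "0 \<le> x" "0 \<le> y" for x y :: real
    using that by (cases "x + y = 0") (auto simp: divide_le_eq)
  from this[of "real (fst s) powr a" "real (snd s) powr a"] show ?thesis
    by (simp add: drift_def abs_divide)
qed

text \<open>The reversed step becomes a nearest neighbour step of the imbalance with mean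
  \<open>- drift a s\<close>. Truncated subtraction disappears because the branch it affects has
  weight zero as soon as the level is positive.\<close>

lemma expectation_down_step:
  fixes \<psi> :: "real \<Rightarrow> nat \<Rightarrow> 'b :: {banach, second_countable_topology}"
  assumes "level s \<ge> 1"
  shows "measure_pmf.expectation (down_step a s) (\<lambda>t. \<psi> (imbalance t) (level t)) =
    ((1 + drift a s) / 2) *\<^sub>R \<psi> (imbalance s - 1) (level s - 1) +
    ((1 - drift a s) / 2) *\<^sub>R \<psi> (imbalance s + 1) (level s - 1)"
proof -
  obtain i j where s: "s = (i, j)" by (cases s)
  have l: "i + j \<ge> 1" using assms by (simp add: s level_def)
  have e: "measure_pmf.expectation (down_step a s) (\<lambda>t. \<psi> (imbalance t) (level t)) =
    urn_prob a s *\<^sub>R \<psi> (real (i - 1) - real j) (i - 1 + j) + (1 - urn_prob a s) *\<^sub>R \<psi> (real i - real (j - 1)) (i + (j - 1))"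
    unfolding down_step_def by (subst expectation_map_bernoulli) (auto simp: urn_prob_bounds s imbalance_def level_def)
  have 1: "urn_prob a s *\<^sub>R \<psi> (real (i - 1) - real j) (i - 1 + j) = urn_prob a s *\<^sub>R \<psi> (imbalance s - 1) (level s - 1)"
  proof (cases "i = 0")
    case True
    then show ?thesis by (simp add: s urn_prob_def)
  next
    case False
    then have "real (i - 1) - real j = imbalance s - 1" "i - 1 + j = level s - 1"
      by (auto simp: s imbalance_def level_def of_nat_diff)
    then show ?thesis by simp
  qed
  have 2: "(1 - urn_prob a s) *\<^sub>R \<psi> (real i - real (j - 1)) (i + (j - 1)) = (1 - urn_prob a s) *\<^sub>R \<psi> (imbalance s + 1) (level s - 1)"
  proof (cases "j = 0")
    case True
    then have "urn_prob a s = 1" using l by (simp add: s urn_prob_def)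
    then show ?thesis by simp
  next
    case False
    then have "real i - real (j - 1) = imbalance s + 1" "i + (j - 1) = level s - 1"
      by (auto simp: s imbalance_def level_def of_nat_diff)
    then show ?thesis by simp
  qed
  have "1 - (1 + drift a s) / 2 = (1 - drift a s) / 2" by (simp add: field_simps)
  then show ?thesis unfolding e 1 2 unfolding urn_prob_drift[OF assms] by simp
qed

lemma down_step_level:
  assumes "t \<in> set_pmf (down_step a s)" "level s \<ge> 1"
  shows "level t = level s - 1"
proof -
  obtain i j where s: "s = (i, j)" by (cases s)
  have p: "set_pmf (bernoulli_pmf (urn_prob a s)) \<subseteq> (if i = 0 then {False} else if j = 0 then {True} else UNIV)"
  proof -
    have "urn_prob a s = 0" if "i = 0" using that by (simp add: s urn_prob_def)
    moreover have "urn_prob a s = 1" if "j = 0" "i \<noteq> 0" using that by (simp add: s urn_prob_def)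
    moreover have "set_pmf (bernoulli_pmf 0) \<subseteq> {False}" "set_pmf (bernoulli_pmf 1) \<subseteq> {True}"
      by (rule subsetI, rename_tac b, case_tac b, simp_all add: set_pmf_iff)+
    ultimately show ?thesis by auto
  qed
  show ?thesis using assms p by (auto simp: down_step_def level_def s split: if_splits)
qed

lemma down_state_level:
  assumes "t \<in> set_pmf (chain_state (down_step a) r s)" "r \<le> level s"
  shows "level t = level s - r"
  using assms
proof (induction r arbitrary: s)
  case (Suc r)
  then obtain u where u: "u \<in> set_pmf (down_step a s)" "t \<in> set_pmf (chain_state (down_step a) r u)" by auto
  from down_step_level[OF u(1)] Suc.prems have "level u = level s - 1" by simp
  then show ?case using Suc.IH[OF u(2)] Suc.prems by simp
qed simp

lemma abs_imbalance_le_level: "\<bar>imbalance s\<bar> \<le> level s"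
  by (simp add: imbalance_def level_def)

section \<open>Restoring drift and second moments\<close>

text \<open>The whole range down to x = -1 is covered since one urn of the reversed chain may be
  empty. Upper bound: ln (1 + x) <= x and a Taylor estimate of exp. Lower bound: ln (1 + x) >= x - 2
  x^2 for |x| <= 1/2, while outside this range x^2 dominates the linear terms.\<close>

lemma powr_one_plus_approx:
  fixes a x :: real
  assumes a: "a > 1" and x: "\<bar>x\<bar> \<le> 1"
  shows "\<bar>(1 + x) powr a - 1 - a * x\<bar> \<le> (a\<^sup>2 * exp a + 4 + 2 * a) * x\<^sup>2"
proof -
  have up: "(1 + x) powr a \<le> 1 + a * x + a\<^sup>2 * exp a * x\<^sup>2"
  proof (cases "x = -1")
    case True
    have "a * 1 \<le> a * a" using a by (intro mult_left_mono) auto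
    also have "a * a * 1 \<le> a * a * exp a" using a by (intro mult_left_mono) auto
    finally show ?thesis using True by (simp add: power2_eq_square)
  next
    case False
    then have "1 + x > 0" using x by linarith
    then have "(1 + x) powr a = exp (a * ln (1 + x))" by (simp add: powr_def)
    also have "\<dots> \<le> exp (a * x)" using \<open>1 + x > 0\<close> ln_add_one_self_le_self2[of x] a by auto
    also obtain t where t: "\<bar>t\<bar> \<le> \<bar>a * x\<bar>" "exp (a * x) = (\<Sum>m<2. (a * x) ^ m / fact m) + exp t / fact 2 * (a * x) ^ 2"
      using Maclaurin_exp_le[of "a * x" 2] by auto
    have "a * \<bar>x\<bar> \<le> a * 1" "\<bar>a * x\<bar> = a * \<bar>x\<bar>"
      using x a by (auto simp: abs_mult)
    then have "t \<le> a" using t(1) by linarith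
    then have "exp t / 2 \<le> exp a"
    proof -
      have "exp t / 2 \<le> exp t" by simp
      also have "\<dots> \<le> exp a" using \<open>t \<le> a\<close> by simp
      finally show ?thesis .
    qed
    then have "exp t / 2 * (a * x)\<^sup>2 \<le> exp a * (a * x)\<^sup>2" by (intro mult_right_mono) auto
    then have "exp (a * x) \<le> 1 + a * x + a\<^sup>2 * exp a * x\<^sup>2"
      unfolding t(2) by (simp add: numeral_2_eq_2 power_mult_distrib algebra_simps)
    finally show ?thesis .
  qed
  have lo: "(1 + x) powr a \<ge> 1 + a * x - (4 + 2 * a) * x\<^sup>2"
  proof -
    consider "\<bar>x\<bar> \<le> 1/2" | "x > 1/2" | "x < - 1/2" by linarith
    then show ?thesis
    proof cases
      case 1
      have "1 + (a * x - 2 * a * x\<^sup>2) \<le> exp (a * x - 2 * a * x\<^sup>2)" by (rule exp_ge_add_one_self)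
      also have "\<dots> \<le> exp (a * ln (1 + x))"
      proof -
        have "x - 2 * x\<^sup>2 \<le> ln (1 + x)" using abs_ln_one_plus_x_minus_x_bound[OF 1] by linarith
        then have "a * (x - 2 * x\<^sup>2) \<le> a * ln (1 + x)" using a by (intro mult_left_mono) auto
        then show ?thesis by (simp add: algebra_simps)
      qed
      also have "\<dots> = (1 + x) powr a" using 1 by (simp add: powr_def abs_le_iff)
      finally have "1 + (a * x - 2 * a * x\<^sup>2) \<le> (1 + x) powr a" .
      moreover have "0 \<le> 4 * x\<^sup>2" by simp
      ultimately show ?thesis by (simp only: algebra_simps; linarith)
    next
      case 2
      have "1 \<le> (1 + x) powr a" using 2 a by (intro ge_one_powr_ge_zero) auto
      moreover have "a * x * 1 \<le> a * x * (2 * x)" using 2 a by (intro mult_left_mono) auto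
      moreover have "0 \<le> 4 * x\<^sup>2" by simp
      ultimately show ?thesis by (simp only: algebra_simps power2_eq_square; linarith)
    next
      case 3
      have "0 \<le> (1 + x) powr a" by simp
      moreover have "a * x \<le> 0" using 3 a by (simp add: mult_nonneg_nonpos)
      moreover have "(1/2)\<^sup>2 \<le> (-x)\<^sup>2" using 3 by (intro power_mono) auto
      then have "1 \<le> 4 * x\<^sup>2" by (simp add: power2_eq_square)
      moreover have "0 \<le> 2 * a * x\<^sup>2" using a by simp
      ultimately show ?thesis by (simp only: algebra_simps; linarith)
    qed
  qed
  have "0 \<le> a\<^sup>2 * exp a * x\<^sup>2" "0 \<le> (4 + 2 * a) * x\<^sup>2" using a by auto
  moreover have "(a\<^sup>2 * exp a + 4 + 2 * a) * x\<^sup>2 = a\<^sup>2 * exp a * x\<^sup>2 + (4 + 2 * a) * x\<^sup>2"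
    by (simp add: algebra_simps)
  ultimately show ?thesis using up lo by linarith
qed

lemma drift_eq_ratio:
  assumes "level s \<ge> 1" and u: "u = imbalance s / level s"
  shows "drift a s = ((1 + u) powr a - (1 - u) powr a) / ((1 + u) powr a + (1 - u) powr a)"
proof -
  obtain i j where s: "s = (i, j)" by (cases s)
  define k :: real where "k = real (level s)"
  have k: "k > 0" using assms by (simp add: k_def)
  have u1: "\<bar>u\<bar> \<le> 1" using abs_imbalance_le_level[of s] assms by (simp add: u abs_divide divide_le_eq_1)
  have ij: "real i = (k / 2) * (1 + u)" "real j = (k / 2) * (1 - u)"
    using k unfolding u k_def by (auto simp: s imbalance_def level_def field_simps)
  have "(k / 2) powr a > 0" using k by simp
  moreover have "real i powr a = (k / 2) powr a * (1 + u) powr a" "real j powr a = (k / 2) powr a * (1 - u) powr a"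
    unfolding ij by (rule powr_mult; use k u1 in linarith)+
  ultimately show ?thesis
    by (simp add: drift_def s flip: distrib_left right_diff_distrib)
qed

text \<open>Both powers are expanded to first order; dividing is harmless because the larger one
  makes the denominator at least 1. The quadratic error is small enough for the Gaussian limit, and
  the linear bound serves the exponential supermartingale.\<close>

lemma drift_linear_approx:
  assumes a: "a > 1"
  obtains C where "C > 0"
    "\<And>s. level s \<ge> 1 \<Longrightarrow> \<bar>drift a s - a * (imbalance s / level s)\<bar> \<le> C * (imbalance s / level s)\<^sup>2"
    "\<And>s. level s \<ge> 1 \<Longrightarrow> \<bar>drift a s\<bar> \<le> C * \<bar>imbalance s / level s\<bar>"
proof -
  define E where "E = a\<^sup>2 * exp a + 4 + 2 * a"
  have E: "E > 0" using a by (auto simp: E_def intro!: add_nonneg_pos)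
  define C where "C = 2 * E + 2 * a * E"
  have C: "C > 0" using a E by (auto simp: C_def intro!: add_pos_pos mult_pos_pos)
  have *: "\<bar>drift a s - a * u\<bar> \<le> C * u\<^sup>2" "\<bar>u\<bar> \<le> 1" if "level s \<ge> 1" "u = imbalance s / level s" for s u
  proof -
    show u1: "\<bar>u\<bar> \<le> 1" using abs_imbalance_le_level[of s] that by (simp add: abs_divide divide_le_eq_1)
    define p q where "p = (1 + u) powr a" and "q = (1 - u) powr a"
    have p: "\<bar>p - 1 - a * u\<bar> \<le> E * u\<^sup>2" using powr_one_plus_approx[OF a u1] by (simp add: p_def E_def)
    have q: "\<bar>q - 1 + a * u\<bar> \<le> E * u\<^sup>2" using powr_one_plus_approx[OF a, of "-u"] u1 by (simp add: q_def E_def)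
    have "p + q \<ge> 1"
    proof (cases "u \<ge> 0")
      case True
      then have "p \<ge> 1" unfolding p_def using a by (intro ge_one_powr_ge_zero) auto
      then show ?thesis by (simp add: q_def add_increasing2)
    next
      case False
      then have "q \<ge> 1" unfolding q_def using a by (intro ge_one_powr_ge_zero) auto
      then show ?thesis by (simp add: p_def add_increasing)
    qed
    have "drift a s - a * u = ((p - q - 2 * a * u) - a * u * (p + q - 2)) / (p + q)"
      unfolding drift_eq_ratio[OF that] p_def[symmetric] q_def[symmetric] using \<open>p + q \<ge> 1\<close>
      by (simp add: field_simps)
    also have "\<bar>\<dots>\<bar> \<le> \<bar>(p - q - 2 * a * u) - a * u * (p + q - 2)\<bar>"
      unfolding abs_divide using \<open>p + q \<ge> 1\<close> by (simp add: divide_le_eq mult_le_cancel_left1)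
    also have "\<dots> \<le> \<bar>p - q - 2 * a * u\<bar> + \<bar>a * u * (p + q - 2)\<bar>" by (rule abs_triangle_ineq4)
    also have "\<bar>p - q - 2 * a * u\<bar> \<le> 2 * (E * u\<^sup>2)" using p q by linarith
    also have "\<bar>a * u * (p + q - 2)\<bar> \<le> a * 1 * (2 * (E * u\<^sup>2))"
      unfolding abs_mult using a u1 p q by (intro mult_mono) auto
    finally show "\<bar>drift a s - a * u\<bar> \<le> C * u\<^sup>2" by (simp add: C_def algebra_simps)
  qed
  show ?thesis
  proof
    show "C + a > 0" using a C by simp
    fix s assume s: "level s \<ge> 1"
    define u where "u = imbalance s / level s"
    have 1: "\<bar>drift a s - a * u\<bar> \<le> C * u\<^sup>2" "\<bar>u\<bar> \<le> 1" using *[OF s u_def] .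
    have "0 \<le> a * u\<^sup>2" using a by simp
    with 1 have "\<bar>drift a s - a * u\<bar> \<le> (C + a) * u\<^sup>2" by (simp add: distrib_right)
    then show "\<bar>drift a s - a * (imbalance s / level s)\<bar> \<le> (C + a) * (imbalance s / level s)\<^sup>2"
      by (simp add: u_def)
    have "\<bar>drift a s\<bar> \<le> C * u\<^sup>2 + \<bar>a * u\<bar>" using 1 by linarith
    also have "u\<^sup>2 = \<bar>u\<bar> * \<bar>u\<bar>" by (simp add: power2_eq_square)
    also have "C * (\<bar>u\<bar> * \<bar>u\<bar>) \<le> C * (\<bar>u\<bar> * 1)" using 1 C by (intro mult_left_mono) auto
    also have "\<bar>a * u\<bar> = a * \<bar>u\<bar>" using a by (simp add: abs_mult)
    finally show "\<bar>drift a s\<bar> \<le> (C + a) * \<bar>imbalance s / level s\<bar>"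
      unfolding u_def[symmetric] by (simp add: distrib_right)
  qed
qed

text \<open>The drift is at least as strong as D/k, its value for exponent 1. With contents x, y the
  difference after clearing denominators is 2xy (x - y) (x^(a-1) - y^(a-1)), nonnegative because a >
  1.\<close>

lemma imbalance_drift_ge:
  assumes a: "a > 1" and s: "level s \<ge> 1"
  shows "(imbalance s)\<^sup>2 / level s \<le> imbalance s * drift a s"
proof -
  obtain i j where ij: "s = (i, j)" by (cases s)
  define x y where "x = real i" and "y = real j"
  have xy: "x \<ge> 0" "y \<ge> 0" "x + y > 0" using s by (auto simp: x_def y_def ij level_def simp flip: of_nat_add)
  have pos: "x powr a + y powr a > 0"
  proof -
    have "x > 0 \<or> y > 0" using xy by linarith
    then show ?thesis by (auto intro: add_pos_nonneg add_nonneg_pos)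
  qed
  have pw: "z powr a = z * z powr (a - 1)" if "z \<ge> 0" for z :: real
    using that by (cases "z = 0") (auto simp: powr_mult_base)
  have "0 \<le> (x - y) * (x powr (a - 1) - y powr (a - 1))"
  proof (cases "x \<le> y")
    case True
    then have "x powr (a - 1) \<le> y powr (a - 1)" using xy a by (intro powr_mono2) auto
    then show ?thesis using True by (intro mult_nonpos_nonpos) auto
  next
    case False
    then have "y powr (a - 1) \<le> x powr (a - 1)" using xy a by (intro powr_mono2) auto
    then show ?thesis using False by (intro mult_nonneg_nonneg) auto
  qed
  then have "0 \<le> 2 * (x * y) * ((x - y) * (x powr (a - 1) - y powr (a - 1)))" using xy by simp
  also have "\<dots> = (x - y) * ((x powr a - y powr a) * (x + y)) - (x - y)\<^sup>2 * (x powr a + y powr a)"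
    unfolding pw[OF xy(1)] pw[OF xy(2)] by (simp add: algebra_simps power2_eq_square)
  finally have "(x - y)\<^sup>2 * (x powr a + y powr a) \<le> (x - y) * ((x powr a - y powr a) * (x + y))" by simp
  then have "(x - y)\<^sup>2 / (x + y) \<le> (x - y) * ((x powr a - y powr a) / (x powr a + y powr a))"
    using xy pos by (simp add: field_simps)
  then show ?thesis by (simp add: ij imbalance_def level_def drift_def x_def y_def)
qed

text \<open>A step raises D^2 by 1 on average, apart from a restoring term, and lowers the level by
  exactly 1.\<close>

lemma square_plus_level_superharmonic:
  assumes a: "a > 1" and s: "level s \<ge> 1"
  shows "measure_pmf.expectation (down_step a s) (\<lambda>t. (imbalance t)\<^sup>2 + level t) \<le> (imbalance s)\<^sup>2 + level s"
proof -
  have "measure_pmf.expectation (down_step a s) (\<lambda>t. (imbalance t)\<^sup>2 + level t) =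
     (imbalance s)\<^sup>2 + level s - 2 * (imbalance s * drift a s)"
    using expectation_down_step[OF s, where \<psi>="\<lambda>d k. d\<^sup>2 + real k" and a=a] s
    by (simp add: power2_eq_square field_simps of_nat_diff)
  moreover have "0 \<le> (imbalance s)\<^sup>2 / level s" by simp
  ultimately show ?thesis using imbalance_drift_ge[OF a s] by linarith
qed

text \<open>For exponent 1, where the drift is D/k, the function (D^2 - k) / (k (k - 1)) is exactly
  harmonic; the stronger drift makes it superharmonic. It is nonpositive at a balanced start, so at
  level k the second moment is at most k. The bound on \<open>r\<close> keeps the level at least 2,
  hence the denominator positive.\<close>

lemma second_moment_balanced:
  assumes a: "a > 1" and r: "r \<le> 2 * n - 2"
  shows "measure_pmf.expectation (chain_state (down_step a) r (n, n)) (\<lambda>t. (imbalance t)\<^sup>2) \<le> 2 * real n - real r"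
proof (cases "n \<ge> 1")
  case False
  then show ?thesis using r by (simp add: imbalance_def)
next
  case n: True
  let ?V = "\<lambda>t. ((imbalance t)\<^sup>2 - real (level t)) / (real (level t) * (real (level t) - 1))"
  let ?p = "chain_state (down_step a) r (n, n)"
  have ln: "level (n, n) = 2 * n" by (simp add: level_def)
  have V: "measure_pmf.expectation ?p ?V \<le> ?V (n, n)"
  proof (rule chain_state_superharmonic)
    fix j t assume j: "j < r" and t: "t \<in> set_pmf (chain_state (down_step a) j (n, n))"
    define k where "k = level t"
    have k: "k \<ge> 3" using down_state_level[OF t] j r by (simp add: ln k_def)
    define D where "D = imbalance t"
    have "measure_pmf.expectation (down_step a t) ?V =
      (D\<^sup>2 - 2 * (D * drift a t) + 1 - (k - 1)) / ((real k - 1) * (real k - 2))"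
    proof -
      define X where "X = (real k - 1) * (real k - 2)"
      have rk: "real (k - 1) = real k - 1" using k by (simp add: of_nat_diff)
      have "measure_pmf.expectation (down_step a t) ?V =
         (1 + drift a t) / 2 * (((D - 1)\<^sup>2 - (real k - 1)) / X) + (1 - drift a t) / 2 * (((D + 1)\<^sup>2 - (real k - 1)) / X)"
        using expectation_down_step[of t a "\<lambda>d k. (d\<^sup>2 - real k) / (real k * (real k - 1))"] k
        unfolding k_def[symmetric] D_def[symmetric] X_def rk by (simp add: algebra_simps)
      also have "\<dots> = ((1 + drift a t) / 2 * ((D - 1)\<^sup>2 - (real k - 1)) + (1 - drift a t) / 2 * ((D + 1)\<^sup>2 - (real k - 1))) / X"
        by (simp add: add_divide_distrib)
      also have "(1 + drift a t) / 2 * ((D - 1)\<^sup>2 - (real k - 1)) + (1 - drift a t) / 2 * ((D + 1)\<^sup>2 - (real k - 1)) =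
          D\<^sup>2 - 2 * (D * drift a t) + 1 - (real k - 1)"
        by (simp add: field_simps power2_eq_square)
      finally show ?thesis unfolding X_def rk .
    qed
    also have "\<dots> \<le> (D\<^sup>2 - 2 * (D\<^sup>2 / k) + 1 - (k - 1)) / ((real k - 1) * (real k - 2))"
      using imbalance_drift_ge[OF a, of t] k
      by (intro divide_right_mono diff_right_mono add_right_mono diff_left_mono mult_left_mono)
        (auto simp: D_def k_def)
    \<comment> \<open>The numerator equals (D^2 - k) (k - 2) / k, so the factor k - 2
      cancels.\<close>
    also have "\<dots> = (D\<^sup>2 - k) / (real k * (real k - 1))"
    proof -
      have "real k - 2 \<noteq> 0" "real k - 1 \<noteq> 0" "real k \<noteq> 0" using k by auto
      then have "(D\<^sup>2 - 2 * (D\<^sup>2 / k) + 1 - (real k - 1)) / ((real k - 1) * (real k - 2)) = (D\<^sup>2 - k) / (real k * (real k - 1))"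
        by (simp add: divide_simps) (simp add: algebra_simps)
      then show ?thesis using k by (simp add: of_nat_diff)
    qed
    finally show "measure_pmf.expectation (down_step a t) ?V \<le> ?V t" by (simp add: D_def k_def)
  qed simp
  define K where "K = 2 * real n - real r"
  have K: "K \<ge> 2" using r n by (simp add: K_def)
  have lv: "real (level t) = K" if "t \<in> set_pmf ?p" for t
    using down_state_level[OF that] r by (simp add: ln K_def of_nat_diff)
  have "measure_pmf.expectation ?p ?V = measure_pmf.expectation ?p (\<lambda>t. ((imbalance t)\<^sup>2 - K) / (K * (K - 1)))"
    by (intro integral_cong_AE) (auto simp: AE_measure_pmf_iff lv)
  also have "\<dots> = (measure_pmf.expectation ?p (\<lambda>t. (imbalance t)\<^sup>2) - K) / (K * (K - 1))"
    by (simp add: Bochner_Integration.integral_diff integrable_measure_pmf_finite)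
  finally have "(measure_pmf.expectation ?p (\<lambda>t. (imbalance t)\<^sup>2) - K) / (K * (K - 1)) \<le> ?V (n, n)" using V by simp
  also have "?V (n, n) \<le> 0" using n by (simp add: imbalance_def level_def divide_nonpos_nonneg)
  finally have "measure_pmf.expectation ?p (\<lambda>t. (imbalance t)\<^sup>2) - K \<le> 0"
    using K mult_pos_pos[of K "K - 1"] unfolding divide_le_0_iff by linarith
  then show ?thesis by (simp add: K_def)
qed

text \<open>Cruder than the bound for balanced starts, but valid from any state; needed when a block
  starts off the diagonal.\<close>

lemma second_moment_growth:
  assumes a: "a > 1" and r: "r \<le> level s"
  shows "measure_pmf.expectation (chain_state (down_step a) r s) (\<lambda>t. (imbalance t)\<^sup>2) \<le> (imbalance s)\<^sup>2 + level s"
proof -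
  have "measure_pmf.expectation (chain_state (down_step a) r s) (\<lambda>t. (imbalance t)\<^sup>2)
    \<le> measure_pmf.expectation (chain_state (down_step a) r s) (\<lambda>t. (imbalance t)\<^sup>2 + level t)"
    by (rule expectation_mono_finite) auto
  also have "\<dots> \<le> (imbalance s)\<^sup>2 + level s"
  proof (rule chain_state_superharmonic)
    fix j t assume j: "j < r" and t: "t \<in> set_pmf (chain_state (down_step a) j s)"
    then have "level t \<ge> 1" using down_state_level[OF t] r by simp
    then show "measure_pmf.expectation (down_step a t) (\<lambda>t. (imbalance t)\<^sup>2 + level t) \<le> (imbalance t)\<^sup>2 + level t"
      by (rule square_plus_level_superharmonic[OF a])
  qed simp
  finally show ?thesis .
qed

section \<open>The probability of hitting the corner\<close>

text \<open>The number of steps is the one that leads to level 2, where (1, 1) competes only with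
  (2, 0) and (0, 2).\<close>

definition hit :: "real \<Rightarrow> nat \<times> nat \<Rightarrow> real" where
  "hit a s = pmf (chain_state (down_step a) (level s - 2) s) (1, 1)"

lemma hit_bounds: "0 \<le> hit a s" "hit a s \<le> 1"
  by (auto simp: hit_def pmf_le_1)

lemma down_state_le:
  "t \<in> set_pmf (chain_state (down_step a) r s) \<Longrightarrow> fst t \<le> fst s \<and> snd t \<le> snd s"
proof (induction r arbitrary: s)
  case (Suc r)
  then obtain u where u: "u \<in> set_pmf (down_step a s)" "t \<in> set_pmf (chain_state (down_step a) r u)" by auto
  show ?case using down_step_le[OF u(1)] Suc.IH[OF u(2)] by auto
qed simp

lemma hit_boundary:
  assumes "fst s = 0 \<or> snd s = 0" shows "hit a s = 0"
proof -
  have "(1, 1) \<notin> set_pmf (chain_state (down_step a) (level s - 2) s)"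
    using down_state_le[of "(1, 1)" a "level s - 2" s] assms by auto
  then show ?thesis unfolding hit_def by (simp only: set_pmf_iff simp_thms)
qed

lemma hit_harmonic:
  assumes "level s \<ge> 3"
  shows "hit a s = measure_pmf.expectation (down_step a s) (hit a)"
proof -
  define m where "m = level s - 3"
  have m: "level s - 2 = Suc m" using assms by (simp add: m_def)
  have "hit a s = measure_pmf.expectation (down_step a s) (\<lambda>t. pmf (chain_state (down_step a) m t) (1, 1))"
    by (simp add: hit_def m pmf_bind)
  also have "\<dots> = measure_pmf.expectation (down_step a s) (hit a)"
  proof (intro integral_cong_AE)
    show "AE t in measure_pmf (down_step a s). pmf (chain_state (down_step a) m t) (1, 1) = hit a t"
    proof (clarsimp simp: AE_measure_pmf_iff hit_def)
      fix i j assume "(i, j) \<in> set_pmf (down_step a s)"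
      then have "level (i, j) - 2 = m" using down_step_level[of "(i, j)" a s] assms by (simp add: m_def)
      then show "pmf (chain_state (down_step a) m (i, j)) (Suc 0, Suc 0) =
           pmf (chain_state (down_step a) (level (i, j) - 2) (i, j)) (Suc 0, Suc 0)" by simp
    qed
  qed auto
  finally show ?thesis .
qed

lemma hit_rec:
  assumes "1 \<le> i" "1 \<le> j" "3 \<le> i + j"
  shows "(real i powr a + real j powr a) * hit a (i, j) = real i powr a * hit a (i - 1, j) + real j powr a * hit a (i, j - 1)"
proof -
  define x y where "x = real i powr a" and "y = real j powr a"
  have xy: "x > 0" "y > 0" using assms by (auto simp: x_def y_def)
  have "hit a (i, j) = x / (x + y) * hit a (i - 1, j) + (1 - x / (x + y)) * hit a (i, j - 1)"
    using hit_harmonic[of "(i, j)" a] assms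
    by (simp add: level_def down_step_def expectation_map_bernoulli urn_prob_bounds)
      (simp add: urn_prob_def x_def y_def)
  also have "1 - x / (x + y) = y / (x + y)" using xy by (simp add: field_simps)
  finally have "hit a (i, j) = (x * hit a (i - 1, j) + y * hit a (i, j - 1)) / (x + y)"
    by (simp add: add_divide_distrib)
  moreover have "x + y \<noteq> 0" using xy by linarith
  ultimately show ?thesis unfolding x_def[symmetric] y_def[symmetric] by simp
qed

text \<open>The rescaled difference of \<^term>\<open>hit\<close> in one coordinate is minus that in the other, and
  commuting the two differences shows that it is again harmonic; hence its boundary values bound it.\<close>

lemma hit_difference_bound:
  assumes "1 \<le> i" "1 \<le> j" "3 \<le> i + j"
  shows "\<bar>real i powr a * (hit a (i, j) - hit a (i - 1, j))\<bar> \<le> 1"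
    and "\<bar>real j powr a * (hit a (i, j) - hit a (i, j - 1))\<bar> \<le> 1"
proof -
  define u where "u i j = real i powr a * (hit a (i, j) - hit a (i - 1, j))" for i j :: nat
  have u2: "u i j = - (real j powr a * (hit a (i, j) - hit a (i, j - 1)))"
    if "1 \<le> i" "1 \<le> j" "3 \<le> i + j" for i j
    using hit_rec[OF that, of a] by (simp add: u_def algebra_simps)
  have b: "\<bar>u i j\<bar> \<le> 1" if "1 \<le> i" "1 \<le> j" "3 \<le> i + j" for i j
    using that
  proof (induction "i + j" arbitrary: i j rule: less_induct)
    case less
    consider "i = 1" | "j = 1" "i \<noteq> 1" | "i \<ge> 2" "j \<ge> 2" using less.prems by linarith
    then show ?case
    proof cases
      case 1
      then show ?thesis using hit_boundary[of "(0, j)" a] hit_bounds[of a "(1, j)"] by (simp add: u_def)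
    next
      case 2
      then show ?thesis
        unfolding u2[OF less.prems] using hit_boundary[of "(i, 0)" a] hit_bounds[of a "(i, 1)"] by simp
    next
      case 3
      define x y where "x = real i powr a" and "y = real j powr a"
      have xy: "x > 0" "y > 0" using 3 by (auto simp: x_def y_def)
      have r1: "u i j = x * (hit a (i, j) - hit a (i - 1, j))" by (simp add: u_def x_def)
      have r2: "u i j = - (y * (hit a (i, j) - hit a (i, j - 1)))" using u2[OF less.prems] by (simp add: y_def)
      have r3: "u i (j - 1) = x * (hit a (i, j - 1) - hit a (i - 1, j - 1))" by (simp add: u_def x_def)
      have r4: "u (i - 1) j = - (y * (hit a (i - 1, j) - hit a (i - 1, j - 1)))"
        using u2[of "i - 1" j] 3 by (simp add: y_def)
      \<comment> \<open>Each copy of \<open>u i j\<close> is replaced by the difference in the other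
        coordinate. The value at (i, j) then cancels, and both sides reduce to x y times the
        difference of \<open>hit\<close> at (i, j - 1) and (i - 1, j).\<close>
      have "(x + y) * u i j = x * u i j + y * u i j" by (simp add: algebra_simps)
      also have "x * u i j = x * (- (y * (hit a (i, j) - hit a (i, j - 1))))" by (simp only: r2)
      also have "y * u i j = y * (x * (hit a (i, j) - hit a (i - 1, j)))" by (simp only: r1)
      also have "x * (- (y * (hit a (i, j) - hit a (i, j - 1)))) + y * (x * (hit a (i, j) - hit a (i - 1, j)))
         = y * u i (j - 1) + x * u (i - 1) j" unfolding r3 r4 by (simp add: algebra_simps)
      finally have h: "(x + y) * u i j = y * u i (j - 1) + x * u (i - 1) j" .
      have "\<bar>u i (j - 1)\<bar> \<le> 1" "\<bar>u (i - 1) j\<bar> \<le> 1" using 3 by (auto intro!: less.hyps)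
      then have "\<bar>y * u i (j - 1)\<bar> \<le> y" "\<bar>x * u (i - 1) j\<bar> \<le> x" using xy by (auto simp: abs_mult)
      then have "\<bar>(x + y) * u i j\<bar> \<le> x + y" unfolding h by linarith
      then show ?thesis using xy by (simp add: abs_mult)
    qed
  qed
  show "\<bar>real i powr a * (hit a (i, j) - hit a (i - 1, j))\<bar> \<le> 1" using b[OF assms] by (simp add: u_def)
  show "\<bar>real j powr a * (hit a (i, j) - hit a (i, j - 1))\<bar> \<le> 1" using b[OF assms] u2[OF assms] by simp
qed

text \<open>At level 2 the squared imbalance is 0 at the corner and 4 elsewhere, and its mean is at
  most 2.\<close>

lemma hit_balanced_ge_half:
  assumes "a > 1" "n \<ge> 1"
  shows "hit a (n, n) \<ge> 1/2"
proof -
  let ?p = "chain_state (down_step a) (2 * n - 2) (n, n)"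
  have "measure_pmf.expectation ?p (\<lambda>t. (imbalance t)\<^sup>2) \<le> 2"
    using second_moment_balanced[OF assms(1), of "2 * n - 2" n] assms(2) by (simp add: of_nat_diff)
  moreover have "measure_pmf.expectation ?p (\<lambda>t. 4 - 4 * indicator {(1, 1)} t) \<le> measure_pmf.expectation ?p (\<lambda>t. (imbalance t)\<^sup>2)"
  proof (rule expectation_mono_finite)
    fix t assume t: "t \<in> set_pmf ?p"
    obtain i j where ij: "t = (i, j)" by (cases t)
    have "level t = 2" using down_state_level[OF t] assms(2) by (simp add: level_def)
    then have "i = 0 \<and> j = 2 \<or> i = 1 \<and> j = 1 \<or> i = 2 \<and> j = 0" by (auto simp: ij level_def)
    then show "4 - 4 * indicator {(1, 1)} t \<le> (imbalance t)\<^sup>2" by (auto simp: ij imbalance_def)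
  qed simp
  moreover have "measure_pmf.expectation ?p (\<lambda>t. 4 - 4 * indicator {(1, 1)} t) = 4 - 4 * hit a (n, n)"
    by (subst Bochner_Integration.integral_diff) (auto simp: hit_def level_def pmf.rep_eq mult_2 intro!: integrable_measure_pmf_finite)
  ultimately show ?thesis by linarith
qed

text \<open>A unit increase of one content to l changes \<open>hit\<close> by at most l^(-a),
  uniformly in the other content. As a > 1 these bounds are summable, so \<open>hit\<close> is
  Cauchy when both contents grow, and the diagonal bound 1/2 passes to the limit.\<close>

lemma hit_limit:
  assumes a: "a > 1"
  obtains h where "h \<ge> 1/2" "\<And>e. e > 0 \<Longrightarrow> \<exists>N. \<forall>i\<ge>N. \<forall>j\<ge>N. \<bar>hit a (i, j) - h\<bar> < e"
proof -
  define g where "g l = real (Suc l) powr - a" for l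
  have sg: "summable g"
    using a unfolding g_def by (subst summable_Suc_iff[where f="\<lambda>l. real l powr - a"]) (simp add: summable_real_powr_iff)
  have d1: "\<bar>hit a (i, j) - hit a (N, j)\<bar> \<le> sum g {N..<i}" if "2 \<le> N" "N \<le> i" "1 \<le> j" for i j N
    using that(2)
  proof (induction i rule: dec_induct)
    case (step i)
    have "real (Suc i) powr a * \<bar>hit a (Suc i, j) - hit a (i, j)\<bar> \<le> 1"
      using hit_difference_bound(1)[of "Suc i" j a] step that by (simp add: abs_mult)
    then have "\<bar>hit a (Suc i, j) - hit a (i, j)\<bar> \<le> g i"
      by (simp add: g_def powr_minus field_simps)
    then show ?case using step by simp
  qed simp
  have d2: "\<bar>hit a (i, j) - hit a (i, N)\<bar> \<le> sum g {N..<j}" if "2 \<le> N" "N \<le> j" "1 \<le> i" for i j N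
    using that(2)
  proof (induction j rule: dec_induct)
    case (step j)
    have "real (Suc j) powr a * \<bar>hit a (i, Suc j) - hit a (i, j)\<bar> \<le> 1"
      using hit_difference_bound(2)[of i "Suc j" a] step that by (simp add: abs_mult)
    then have "\<bar>hit a (i, Suc j) - hit a (i, j)\<bar> \<le> g j"
      by (simp add: g_def powr_minus field_simps)
    then show ?case using step by simp
  qed simp
  have near: "\<exists>N. \<forall>i\<ge>N. \<forall>j\<ge>N. \<bar>hit a (i, j) - hit a (N, N)\<bar> < e" if "e > 0" for e
  proof -
    obtain N0 where N0: "\<And>m n. m \<ge> N0 \<Longrightarrow> norm (sum g {m..<n}) < e / 2"
      using sg[unfolded summable_Cauchy] \<open>e > 0\<close> by (metis half_gt_zero)
    define N where "N = max N0 2"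
    have "\<bar>hit a (i, j) - hit a (N, N)\<bar> < e" if "i \<ge> N" "j \<ge> N" for i j
    proof -
      have "\<bar>hit a (i, j) - hit a (N, j)\<bar> \<le> sum g {N..<i}" using that by (intro d1) (auto simp: N_def)
      moreover have "\<bar>hit a (N, j) - hit a (N, N)\<bar> \<le> sum g {N..<j}" using that by (intro d2) (auto simp: N_def)
      moreover have "norm (sum g {N..<i}) < e / 2" "norm (sum g {N..<j}) < e / 2"
        by (rule N0, simp add: N_def)+
      ultimately show ?thesis by (simp add: abs_le_iff abs_less_iff)
    qed
    then show ?thesis by blast
  qed
  have "Cauchy (\<lambda>n. hit a (n, n))"
  proof (rule metric_CauchyI)
    fix e :: real assume "e > 0"
    then obtain N where N: "\<And>i j. i \<ge> N \<Longrightarrow> j \<ge> N \<Longrightarrow> \<bar>hit a (i, j) - hit a (N, N)\<bar> < e / 2"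
      using near[of "e / 2"] by auto
    have "dist (hit a (m, m)) (hit a (n, n)) < e" if "m \<ge> N" "n \<ge> N" for m n
      using N[OF that(1) that(1)] N[OF that(2) that(2)] unfolding dist_real_def by linarith
    then show "\<exists>N. \<forall>m\<ge>N. \<forall>n\<ge>N. dist (hit a (m, m)) (hit a (n, n)) < e" by blast
  qed
  then obtain h where h: "(\<lambda>n. hit a (n, n)) \<longlonglongrightarrow> h"
    using Cauchy_convergent_iff convergent_def by blast
  show ?thesis
  proof
    show "h \<ge> 1/2"
      using h by (rule LIMSEQ_le_const) (use hit_balanced_ge_half[OF a] in blast)
    fix e :: real assume "e > 0"
    then obtain N where N: "\<And>i j. i \<ge> N \<Longrightarrow> j \<ge> N \<Longrightarrow> \<bar>hit a (i, j) - hit a (N, N)\<bar> < e / 2"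
      using near[of "e / 2"] by auto
    have "\<bar>h - hit a (N, N)\<bar> \<le> e / 2"
    proof (rule LIMSEQ_le_const2[where X="\<lambda>n. \<bar>hit a (n, n) - hit a (N, N)\<bar>"])
      show "(\<lambda>n. \<bar>hit a (n, n) - hit a (N, N)\<bar>) \<longlonglongrightarrow> \<bar>h - hit a (N, N)\<bar>"
        by (intro tendsto_intros h)
      show "\<exists>M. \<forall>n\<ge>M. \<bar>hit a (n, n) - hit a (N, N)\<bar> \<le> e / 2"
        using N less_imp_le by blast
    qed
    then have "\<bar>hit a (i, j) - h\<bar> < e" if "i \<ge> N" "j \<ge> N" for i j
      using N[OF that] by linarith
    then show "\<exists>N. \<forall>i\<ge>N. \<forall>j\<ge>N. \<bar>hit a (i, j) - h\<bar> < e" by blast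
  qed
qed

section \<open>Characteristic functions of the rescaled chain\<close>

lemma iexp_minus_linear: "cmod (iexp x - (1 + \<i> * x)) \<le> x\<^sup>2 / 2"
  using iexp_approx1[of x 1] by (simp add: numeral_2_eq_2)

lemma iexp_minus_one: "cmod (iexp x - 1) \<le> \<bar>x\<bar>"
  using iexp_approx1[of x 0] by simp

text \<open>Real and imaginary parts of the third order estimate for the complex
  exponential.\<close>

lemma cos_sin_cubic:
  fixes x :: real
  shows "\<bar>cos x - 1 + x\<^sup>2 / 2\<bar> \<le> \<bar>x\<bar> ^ 3 / 6" "\<bar>sin x - x\<bar> \<le> \<bar>x\<bar> ^ 3 / 6"
proof -
  let ?z = "iexp x - (1 + \<i> * x - x\<^sup>2 / 2)"
  have z: "cmod ?z \<le> \<bar>x\<bar> ^ 3 / 6"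
    using iexp_approx1[of x 2] by (simp add: eval_nat_numeral algebra_simps fact_numeral)
  have e: "Re ?z = cos x - 1 + x\<^sup>2 / 2" "Im ?z = sin x - x"
    by (simp_all add: Re_exp Im_exp power2_eq_square)
  show "\<bar>cos x - 1 + x\<^sup>2 / 2\<bar> \<le> \<bar>x\<bar> ^ 3 / 6" "\<bar>sin x - x\<bar> \<le> \<bar>x\<bar> ^ 3 / 6"
    using abs_Re_le_cmod[of ?z] abs_Im_le_cmod[of ?z] z unfolding e by linarith+
qed

lemma exp_minus_quadratic:
  fixes x :: real assumes "x \<ge> 0"
  shows "\<bar>exp (- x) - 1 + x\<bar> \<le> x\<^sup>2 / 2"
proof -
  show ?thesis
  proof (cases "x = 0")
    case False
    with assms have x: "x > 0" by simp
    obtain s where s: "- x < s" "s < 0" "exp (- x) = (\<Sum>m<2. (- x) ^ m / fact m) + exp s / fact 2 * (- x) ^ 2"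
      using Maclaurin_minus[of "- x" 2 "\<lambda>n. exp" exp] x by (auto intro!: derivative_eq_intros)
    have "exp s \<le> 1" using s by simp
    then have "exp s / 2 * x\<^sup>2 \<le> 1 / 2 * x\<^sup>2" by (intro mult_right_mono divide_right_mono) auto
    moreover have "0 \<le> exp s / 2 * x\<^sup>2" by simp
    moreover have "exp (- x) - 1 + x = exp s / 2 * x\<^sup>2" unfolding s(3) by (simp add: numeral_2_eq_2)
    ultimately show ?thesis by linarith
  qed simp
qed

text \<open>Here \<open>\<mu>\<close> is the rescaled unit step, \<open>b\<close> the drift,
  \<open>\<beta>\<close> its linearisation, \<open>\<epsilon>\<close> the displacement caused by the
  change of scale and \<open>q\<close> the variance of the step. The term
  |\<open>\<mu> * \<beta> + \<epsilon>\<close>| measures how far the rescaling is from cancelling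
  the drift.\<close>

lemma one_step_char_error:
  fixes \<mu> b \<beta> \<epsilon> q :: real
  assumes b: "\<bar>b\<bar> \<le> 1" and q: "q \<ge> 0"
  shows "cmod (complex_of_real ((1 + b) / 2) * iexp (- \<mu>) + complex_of_real ((1 - b) / 2) * iexp \<mu> - iexp \<epsilon> * complex_of_real (exp (- q / 2)))
    \<le> \<bar>\<mu>\<bar> ^ 3 / 3 + \<bar>\<mu>\<bar> * \<bar>b - \<beta>\<bar> + \<bar>\<mu>\<^sup>2 - q\<bar> / 2 + \<bar>\<mu> * \<beta> + \<epsilon>\<bar> + q\<^sup>2 / 8 + \<epsilon>\<^sup>2 / 2 + q / 2 * \<bar>\<epsilon>\<bar>"
proof -
  define X where "X = complex_of_real ((1 + b) / 2) * iexp (- \<mu>) + complex_of_real ((1 - b) / 2) * iexp \<mu>"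
  define T where "T = iexp \<epsilon> * complex_of_real (exp (- q / 2))"
  have X: "X = complex_of_real (cos \<mu>) - \<i> * complex_of_real (b * sin \<mu>)"
    unfolding X_def by (rule complex_eqI) (simp_all add: Re_exp Im_exp field_simps)
  have t1: "cmod (complex_of_real (cos \<mu> - 1 + \<mu>\<^sup>2 / 2)) \<le> \<bar>\<mu>\<bar> ^ 3 / 6"
    using cos_sin_cubic(1)[of \<mu>] by (simp only: norm_of_real)
  have t2: "cmod (\<i> * complex_of_real (b * (sin \<mu> - \<mu>))) \<le> \<bar>\<mu>\<bar> ^ 3 / 6"
  proof -
    have "\<bar>b * (sin \<mu> - \<mu>)\<bar> \<le> 1 * (\<bar>\<mu>\<bar> ^ 3 / 6)"
      unfolding abs_mult using b cos_sin_cubic(2)[of \<mu>] by (intro mult_mono) auto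
    then show ?thesis by (simp only: norm_mult norm_of_real norm_ii mult_1)
  qed
  have t3: "cmod (\<i> * complex_of_real (\<mu> * (b - \<beta>))) = \<bar>\<mu>\<bar> * \<bar>b - \<beta>\<bar>"
    by (simp only: norm_mult norm_of_real norm_ii mult_1 abs_mult)
  have t4: "cmod (complex_of_real ((\<mu>\<^sup>2 - q) / 2)) = \<bar>\<mu>\<^sup>2 - q\<bar> / 2"
    by (simp only: norm_of_real abs_divide abs_numeral)
  have t5: "cmod (\<i> * complex_of_real (\<mu> * \<beta> + \<epsilon>)) = \<bar>\<mu> * \<beta> + \<epsilon>\<bar>"
    by (simp only: norm_mult norm_of_real norm_ii mult_1)
  have t6: "cmod (iexp \<epsilon> * complex_of_real (exp (- q / 2) - 1 + q / 2)) \<le> q\<^sup>2 / 8"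
    using exp_minus_quadratic[of "q / 2"] q
    by (simp only: norm_mult norm_exp_i_times norm_of_real mult_1) (simp add: power2_eq_square)
  have t7: "cmod (iexp \<epsilon> - (1 + \<i> * \<epsilon>)) \<le> \<epsilon>\<^sup>2 / 2" by (rule iexp_minus_linear)
  have t8: "cmod (complex_of_real (q / 2) * (iexp \<epsilon> - 1)) \<le> q / 2 * \<bar>\<epsilon>\<bar>"
    using iexp_minus_one[of \<epsilon>] q by (simp only: norm_mult norm_of_real) (auto intro!: mult_left_mono)
  \<comment> \<open>Eight differences, each replacing one ingredient by its approximation; the
    triangle inequality then gives the claim term by term.\<close>
  have "X - T = complex_of_real (cos \<mu> - 1 + \<mu>\<^sup>2 / 2) - \<i> * complex_of_real (b * (sin \<mu> - \<mu>)) -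
      \<i> * complex_of_real (\<mu> * (b - \<beta>)) - complex_of_real ((\<mu>\<^sup>2 - q) / 2) - \<i> * complex_of_real (\<mu> * \<beta> + \<epsilon>) -
      iexp \<epsilon> * complex_of_real (exp (- q / 2) - 1 + q / 2) - (iexp \<epsilon> - (1 + \<i> * \<epsilon>)) + complex_of_real (q / 2) * (iexp \<epsilon> - 1)"
    unfolding X T_def by (simp add: algebra_simps add_divide_distrib diff_divide_distrib)
  also have "cmod \<dots> \<le> \<bar>\<mu>\<bar> ^ 3 / 6 + \<bar>\<mu>\<bar> ^ 3 / 6 + \<bar>\<mu>\<bar> * \<bar>b - \<beta>\<bar> + \<bar>\<mu>\<^sup>2 - q\<bar> / 2 + \<bar>\<mu> * \<beta> + \<epsilon>\<bar> + q\<^sup>2 / 8 + \<epsilon>\<^sup>2 / 2 + q / 2 * \<bar>\<epsilon>\<bar>"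
    by (intro order_trans[OF norm_triangle_ineq] order_trans[OF norm_triangle_ineq4] add_mono t1 t2 t6 t7 t8 eq_refl[OF t3] eq_refl[OF t4] eq_refl[OF t5])
  finally show ?thesis unfolding X_def T_def by simp
qed

section \<open>Martingale scale and variance clock\<close>

definition wscale :: "real \<Rightarrow> nat \<Rightarrow> nat \<Rightarrow> real" where
  "wscale a n k = (real k / (2 * real n)) powr - a * sqrt ((2 * a - 1) / 2) / sqrt (real n)"

text \<open>With x = k / (2n), minus the derivative of x^(1-2a) times the mesh 1 / (2n) is (2a - 1)
  x^(-2a) / (2n), the square of \<open>wscale\<close>. The constant in \<open>wscale\<close> is
  chosen for this identity, so \<open>vtime\<close> is the clock of the rescaled chain.\<close>

definition vtime :: "real \<Rightarrow> nat \<Rightarrow> nat \<Rightarrow> real" where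
  "vtime a n k = (real k / (2 * real n)) powr (1 - 2 * a)"

definition wpos :: "real \<Rightarrow> nat \<Rightarrow> nat \<times> nat \<Rightarrow> real" where
  "wpos a n s = imbalance s * wscale a n (level s)"

lemma powr_diff_bounds:
  fixes x y p :: real
  assumes "0 < x" "x < y" "p > 0"
  shows "p * (y - x) * y powr (- p - 1) \<le> x powr - p - y powr - p"
    and "x powr - p - y powr - p \<le> p * (y - x) * x powr (- p - 1)"
proof -
  have "\<exists>z>x. z < y \<and> y powr - p - x powr - p = (y - x) * (- p * z powr (- p - 1))"
    using assms by (intro MVT2) (auto intro!: derivative_eq_intros)
  then obtain z where z: "x < z" "z < y" "y powr - p - x powr - p = (y - x) * (- p * z powr (- p - 1))" by blast
  have e: "x powr - p - y powr - p = p * (y - x) * z powr (- p - 1)" using z(3) by (simp add: algebra_simps)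
  have "y powr (- p - 1) \<le> z powr (- p - 1)" "z powr (- p - 1) \<le> x powr (- p - 1)"
    using assms z by (auto intro!: powr_mono2')
  then show "p * (y - x) * y powr (- p - 1) \<le> x powr - p - y powr - p"
    "x powr - p - y powr - p \<le> p * (y - x) * x powr (- p - 1)"
    unfolding e using assms by (auto intro!: mult_left_mono)
qed

text \<open>The three groups say: the scale is of order 1 / sqrt n away from level 0; its relative
  change per level is a / (k + 1) up to second order, which offsets the drift; its square matches
  the clock increment up to order 1 / n^2.\<close>

lemma scale_estimates:
  fixes a \<eta> :: real
  assumes a: "a > 1" and \<eta>: "\<eta> > 0"
  obtains C where "C > 0"
    "\<And>n k. n \<ge> 1 \<Longrightarrow> \<eta> * real n \<le> real k \<Longrightarrow> 0 \<le> wscale a n k \<and> wscale a n k \<le> C / sqrt n"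
    "\<And>n k. n \<ge> 1 \<Longrightarrow> k \<ge> 1 \<Longrightarrow> \<eta> * real n \<le> real k \<Longrightarrow>
        \<bar>wscale a n (Suc k) - wscale a n k * (1 - a / real (Suc k))\<bar> \<le> wscale a n k * C / (real (Suc k))\<^sup>2"
    "\<And>n k. n \<ge> 1 \<Longrightarrow> k \<ge> 1 \<Longrightarrow> \<eta> * real n \<le> real k \<Longrightarrow>
        \<bar>(wscale a n k)\<^sup>2 - (vtime a n k - vtime a n (Suc k))\<bar> \<le> C / (real n)\<^sup>2 \<and>
        0 \<le> vtime a n k - vtime a n (Suc k) \<and> vtime a n k - vtime a n (Suc k) \<le> C / real n"
proof -
  define c where "c = sqrt ((2 * a - 1) / 2)"
  have c: "c > 0" "c\<^sup>2 = (2 * a - 1) / 2" using a by (auto simp: c_def)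
  define C1 where "C1 = (\<eta> / 2) powr - a * c"
  define C2 where "C2 = a\<^sup>2 * exp a + 4 + 2 * a"
  define C3 where "C3 = (2 * a - 1) * a * (\<eta> / 2) powr (- 2 * a - 1)"
  define C4 where "C4 = (2 * a - 1) * (\<eta> / 2) powr (- 2 * a)"
  have pos: "C1 > 0" "C2 > 0" "C3 > 0" "C4 > 0"
    using a \<eta> c by (auto simp: C1_def C2_def C3_def C4_def intro!: add_nonneg_pos)
  have xge: "\<eta> / 2 \<le> real k / (2 * real n)" if "n \<ge> 1" "\<eta> * real n \<le> real k" for n k :: nat
    using that by (simp add: field_simps)
  show ?thesis
  proof
    show "C1 + C2 + C3 + C4 > 0" using pos by linarith
  next
    fix n k :: nat assume n: "n \<ge> 1" and k: "\<eta> * real n \<le> real k"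
    have "(real k / (2 * real n)) powr - a * c / sqrt n \<le> C1 / sqrt n"
      unfolding C1_def using xge[OF n k] a \<eta> c by (intro divide_right_mono mult_right_mono powr_mono2') auto
    also have "\<dots> \<le> (C1 + C2 + C3 + C4) / sqrt n" using pos by (intro divide_right_mono) auto
    finally show "0 \<le> wscale a n k \<and> wscale a n k \<le> (C1 + C2 + C3 + C4) / sqrt n"
      using a by (auto simp: wscale_def c_def)
  next
    fix n k :: nat assume n: "n \<ge> 1" and k1: "k \<ge> 1" and k: "\<eta> * real n \<le> real k"
    have w0: "wscale a n k \<ge> 0" using a by (simp add: wscale_def)
    define y where "y = real (Suc k) / (2 * real n)"
    define z where "z = 1 - 1 / real (Suc k)"
    have z: "z > 0" using k1 by (simp add: z_def)
    have y: "y > 0" using n by (simp add: y_def)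
    have "z = real k / real (Suc k)" by (simp add: z_def field_simps)
    then have x: "real k / (2 * real n) = y * z" by (simp add: y_def)
    have "(y * z) powr - a * z powr a = y powr - a"
      using y z by (simp add: powr_mult mult.assoc flip: powr_add)
    then have ws: "wscale a n (Suc k) = wscale a n k * z powr a"
      unfolding wscale_def x y_def[symmetric] by (simp add: field_simps)
    have "\<bar>z powr a - 1 + a / real (Suc k)\<bar> \<le> C2 * (1 / real (Suc k))\<^sup>2"
      using powr_one_plus_approx[OF a, of "- (1 / real (Suc k))"] by (simp add: z_def C2_def)
    then have b: "\<bar>z powr a - (1 - a / real (Suc k))\<bar> \<le> C2 / (real (Suc k))\<^sup>2" by (simp add: power_divide)
    have "\<bar>wscale a n (Suc k) - wscale a n k * (1 - a / real (Suc k))\<bar> = wscale a n k * \<bar>z powr a - (1 - a / real (Suc k))\<bar>"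
      unfolding ws using w0 by (simp add: abs_mult flip: right_diff_distrib)
    also have "\<dots> \<le> wscale a n k * (C2 / (real (Suc k))\<^sup>2)" using b w0 by (intro mult_left_mono)
    also have "\<dots> \<le> wscale a n k * ((C1 + C2 + C3 + C4) / (real (Suc k))\<^sup>2)"
      using pos w0 by (intro mult_left_mono divide_right_mono) auto
    finally show "\<bar>wscale a n (Suc k) - wscale a n k * (1 - a / real (Suc k))\<bar> \<le> wscale a n k * (C1 + C2 + C3 + C4) / (real (Suc k))\<^sup>2"
      by simp
  next
    fix n k :: nat assume n: "n \<ge> 1" and k1: "k \<ge> 1" and k: "\<eta> * real n \<le> real k"
    define x y where "x = real k / (2 * real n)" and "y = real (Suc k) / (2 * real n)"
    have xy: "0 < x" "x < y" "y - x = 1 / (2 * real n)" "\<eta> / 2 \<le> x"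
      using n k1 xge[OF n k] by (auto simp: x_def y_def field_simps)
    have p: "2 * a - 1 > 0" using a by simp
    define d where "d = x powr (1 - 2 * a) - y powr (1 - 2 * a)"
    have d: "vtime a n k - vtime a n (Suc k) = d" by (simp add: vtime_def x_def y_def d_def)
    have e: "- (2 * a - 1) = 1 - 2 * a" "- (2 * a - 1) - 1 = - (2 * a)" by auto
    have d1: "(2 * a - 1) * (1 / (2 * real n)) * y powr - (2 * a) \<le> d"
      "d \<le> (2 * a - 1) * (1 / (2 * real n)) * x powr - (2 * a)"
      using powr_diff_bounds[OF xy(1,2) p] unfolding e xy(3) d_def by auto
    \<comment> \<open>The squared scale is exactly the upper end of the mean value bracket for
      \<open>d\<close>, so the discrepancy is nonnegative and is controlled by the width of the
      bracket.\<close>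
    have w2: "(wscale a n k)\<^sup>2 = (2 * a - 1) * (1 / (2 * real n)) * x powr - (2 * a)"
    proof -
      have "(wscale a n k)\<^sup>2 = (x powr - a)\<^sup>2 * c\<^sup>2 / (sqrt (real n))\<^sup>2"
        by (simp add: wscale_def x_def c_def power_mult_distrib power_divide)
      also have "(x powr - a)\<^sup>2 = x powr - (2 * a)" using xy by (simp add: power2_eq_square flip: powr_add)
      finally show ?thesis unfolding c by simp
    qed
    have wd: "0 \<le> (wscale a n k)\<^sup>2 - d" using d1 w2 by simp
    have "(wscale a n k)\<^sup>2 - d \<le> (2 * a - 1) * (1 / (2 * real n)) * (x powr - (2 * a) - y powr - (2 * a))"
      using d1 unfolding w2 by (simp only: right_diff_distrib; linarith)
    also have "\<dots> \<le> (2 * a - 1) * (1 / (2 * real n)) * ((2 * a) * (1 / (2 * real n)) * x powr (- (2 * a) - 1))"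
      using powr_diff_bounds(2)[OF xy(1,2), of "2 * a"] a unfolding xy(3) by (intro mult_left_mono) auto
    also have "\<dots> \<le> (2 * a - 1) * (1 / (2 * real n)) * ((2 * a) * (1 / (2 * real n)) * (\<eta> / 2) powr (- (2 * a) - 1))"
      using a \<eta> xy by (intro mult_left_mono powr_mono2') auto
    also have "\<dots> = C3 / 2 / (real n)\<^sup>2" by (simp add: C3_def power2_eq_square)
    also have "\<dots> \<le> (C1 + C2 + C3 + C4) / (real n)\<^sup>2" using pos by (intro divide_right_mono) auto
    finally have 1: "\<bar>(wscale a n k)\<^sup>2 - d\<bar> \<le> (C1 + C2 + C3 + C4) / (real n)\<^sup>2" using wd by simp
    have "0 \<le> (2 * a - 1) * (1 / (2 * real n)) * y powr - (2 * a)" using p by simp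
    then have 2: "0 \<le> d" using d1 by linarith
    have "d \<le> (2 * a - 1) * (1 / (2 * real n)) * (\<eta> / 2) powr - (2 * a)"
      using d1(2) by (rule order_trans) (use a \<eta> xy in \<open>intro mult_left_mono powr_mono2'; auto\<close>)
    also have "\<dots> = C4 / 2 / real n" by (simp add: C4_def)
    also have "\<dots> \<le> (C1 + C2 + C3 + C4) / real n" using pos by (intro divide_right_mono) auto
    finally have 3: "d \<le> (C1 + C2 + C3 + C4) / real n" .
    show "\<bar>(wscale a n k)\<^sup>2 - (vtime a n k - vtime a n (Suc k))\<bar> \<le> (C1 + C2 + C3 + C4) / (real n)\<^sup>2 \<and>
        0 \<le> vtime a n k - vtime a n (Suc k) \<and> vtime a n k - vtime a n (Suc k) \<le> (C1 + C2 + C3 + C4) / real n"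
      unfolding d using 1 2 3 by blast
  qed
qed

text \<open>One step multiplies the characteristic function by a Gaussian factor up to an error
  n^(-3/2) (1 + D^2 / n). The factor in D^2 is kept because no uniform bound on the imbalance is
  available; second moments absorb it later.\<close>

lemma down_step_char_error:
  fixes a \<eta> \<theta> :: real
  assumes a: "a > 1" and \<eta>: "\<eta> > 0"
  obtains C where "C > 0"
    "\<And>n s. n \<ge> 1 \<Longrightarrow> level s \<ge> 2 \<Longrightarrow> \<eta> * real n \<le> real (level s - 1) \<Longrightarrow>
      cmod (measure_pmf.expectation (down_step a s) (\<lambda>t. iexp (\<theta> * wpos a n t)) -
            iexp (\<theta> * wpos a n s) * complex_of_real (exp (- (\<theta>\<^sup>2 * (vtime a n (level s - 1) - vtime a n (level s))) / 2)))
      \<le> C * (1 / sqrt n) ^ 3 * (1 + (imbalance s)\<^sup>2 / n)"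
proof -
  obtain C0 where C0: "C0 > 0" and
    sc1: "\<And>n k. n \<ge> 1 \<Longrightarrow> \<eta> * real n \<le> real k \<Longrightarrow> 0 \<le> wscale a n k \<and> wscale a n k \<le> C0 / sqrt n" and
    sc2: "\<And>n k. n \<ge> 1 \<Longrightarrow> k \<ge> 1 \<Longrightarrow> \<eta> * real n \<le> real k \<Longrightarrow>
        \<bar>wscale a n (Suc k) - wscale a n k * (1 - a / real (Suc k))\<bar> \<le> wscale a n k * C0 / (real (Suc k))\<^sup>2" and
    sc3: "\<And>n k. n \<ge> 1 \<Longrightarrow> k \<ge> 1 \<Longrightarrow> \<eta> * real n \<le> real k \<Longrightarrow>
        \<bar>(wscale a n k)\<^sup>2 - (vtime a n k - vtime a n (Suc k))\<bar> \<le> C0 / (real n)\<^sup>2 \<and>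
        0 \<le> vtime a n k - vtime a n (Suc k) \<and> vtime a n k - vtime a n (Suc k) \<le> C0 / real n"
    using scale_estimates[OF a \<eta>] by blast
  obtain C1 where C1: "C1 > 0" and
    dr: "\<And>s. level s \<ge> 1 \<Longrightarrow> \<bar>drift a s - a * (imbalance s / level s)\<bar> \<le> C1 * (imbalance s / level s)\<^sup>2"
    using drift_linear_approx[OF a] by blast
  define T where "T = \<bar>\<theta>\<bar>"
  define M where "M = T * C0"
  have TM: "T \<ge> 0" "M \<ge> 0" using C0 by (auto simp: T_def M_def)
  \<comment> \<open>One summand for each of the error terms \<open>s1\<close> to \<open>s7\<close>,
    in this order.\<close>
  define A where "A = M ^ 3 + M * C1 / \<eta>\<^sup>2 + T\<^sup>2 * C0 + M * C0 / \<eta> + (T\<^sup>2 * C0)\<^sup>2 + M\<^sup>2 * (C0 + a)\<^sup>2 / \<eta>\<^sup>2 + T\<^sup>2 * C0 * (M * (C0 + a))"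
  have nn: "0 \<le> M ^ 3" "0 \<le> M * C1 / \<eta>\<^sup>2" "0 \<le> T\<^sup>2 * C0" "0 \<le> M * C0 / \<eta>" "0 \<le> (T\<^sup>2 * C0)\<^sup>2" "0 \<le> M\<^sup>2 * (C0 + a)\<^sup>2 / \<eta>\<^sup>2" "0 \<le> T\<^sup>2 * C0 * (M * (C0 + a))"
    using TM C0 C1 a \<eta> by auto
  show ?thesis
  proof
    show "A + 1 > 0" using nn unfolding A_def by linarith
    fix n :: nat and s assume n: "n \<ge> 1" and ls: "level s \<ge> 2" and le: "\<eta> * real n \<le> real (level s - 1)"
    \<comment> \<open>\<open>k\<close> is the level after the step. The position after the step is
      scaled by \<open>w\<close>, the starting one by \<open>wscale a n (Suc k)\<close>, and
      \<open>\<epsilon>\<close> records the difference.\<close>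
    define k where "k = level s - 1"
    have k: "level s = Suc k" "k \<ge> 1" "\<eta> * real n \<le> real k" using ls le by (auto simp: k_def)
    define g where "g = 1 / sqrt (real n)"
    have g: "0 < g" "g \<le> 1" "g\<^sup>2 = 1 / real n" using n by (auto simp: g_def power_divide)
    have g4: "g ^ 4 = 1 / (real n)\<^sup>2" using g(3) by (metis power2_eq_square power4_eq_xxxx power_one_over mult.assoc)
    have g43: "g ^ 4 \<le> g ^ 3" using g by (intro power_decreasing) auto
    define D where "D = imbalance s"
    define P where "P = D\<^sup>2 * g\<^sup>2"
    have P: "P \<ge> 0" "P = (imbalance s)\<^sup>2 / n" by (auto simp: P_def D_def g(3))
    define w where "w = wscale a n k"
    define \<mu> where "\<mu> = \<theta> * w"
    define u where "u = D / real (Suc k)"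
    define \<beta> where "\<beta> = a * u"
    define \<epsilon> where "\<epsilon> = \<theta> * (D * (wscale a n (Suc k) - w))"
    define b where "b = drift a s"
    define q where "q = \<theta>\<^sup>2 * (vtime a n k - vtime a n (Suc k))"
    have w: "0 \<le> w" "w \<le> C0 * g" using sc1[OF n k(3)] by (auto simp: w_def g_def)
    have \<mu>: "\<bar>\<mu>\<bar> \<le> M * g"
      using w mult_left_mono[of w "C0 * g" T] TM by (auto simp: \<mu>_def abs_mult T_def M_def)
    have kk: "\<eta> * real n \<le> real (Suc k)" using k(3) by simp
    have ik: "1 / real (Suc k) \<le> g\<^sup>2 / \<eta>" using kk n \<eta> by (simp add: g(3) field_simps)
    have ik1: "1 / real (Suc k) \<le> 1" by simp
    have u1: "\<bar>u\<bar> \<le> 1" using abs_imbalance_le_level[of s] by (simp add: u_def D_def k abs_divide)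
    have u2: "u\<^sup>2 \<le> P * g\<^sup>2 / \<eta>\<^sup>2"
    proof -
      have "u\<^sup>2 = D\<^sup>2 * (1 / real (Suc k))\<^sup>2" by (simp add: u_def power_divide)
      also have "\<dots> \<le> D\<^sup>2 * (g\<^sup>2 / \<eta>)\<^sup>2" using ik by (intro mult_left_mono power_mono) auto
      finally show ?thesis by (simp add: P_def power2_eq_square)
    qed
    have q0: "0 \<le> q" "q \<le> T\<^sup>2 * C0 * g\<^sup>2"
    proof -
      have "0 \<le> vtime a n k - vtime a n (Suc k)" "vtime a n k - vtime a n (Suc k) \<le> C0 * g\<^sup>2"
        using sc3[OF n k(2,3)] by (auto simp: g(3))
      then show "0 \<le> q" "q \<le> T\<^sup>2 * C0 * g\<^sup>2" unfolding q_def T_def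
        by (auto simp: mult.assoc intro!: mult_left_mono)
    qed
    have \<mu>q: "\<bar>\<mu>\<^sup>2 - q\<bar> \<le> T\<^sup>2 * C0 * g ^ 4"
    proof -
      have "\<mu>\<^sup>2 - q = \<theta>\<^sup>2 * (w\<^sup>2 - (vtime a n k - vtime a n (Suc k)))"
        by (simp add: \<mu>_def q_def power_mult_distrib algebra_simps)
      then have "\<bar>\<mu>\<^sup>2 - q\<bar> = T\<^sup>2 * \<bar>w\<^sup>2 - (vtime a n k - vtime a n (Suc k))\<bar>" by (simp add: abs_mult T_def)
      also have "\<dots> \<le> T\<^sup>2 * (C0 * g ^ 4)" using sc3[OF n k(2,3)] by (intro mult_left_mono) (auto simp: g4 w_def)
      finally show ?thesis by simp
    qed
    have \<mu>\<epsilon>: "\<bar>\<mu> * \<beta> + \<epsilon>\<bar> \<le> \<bar>\<mu>\<bar> * \<bar>u\<bar> * C0 * (1 / real (Suc k))"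
    proof -
      \<comment> \<open>Linearised drift and change of scale combine into the second estimate for
        \<open>wscale\<close>.\<close>
      have "\<mu> * \<beta> + \<epsilon> = \<theta> * D * (wscale a n (Suc k) - w * (1 - a / real (Suc k)))"
        by (simp add: \<mu>_def \<beta>_def \<epsilon>_def u_def algebra_simps)
      then have "\<bar>\<mu> * \<beta> + \<epsilon>\<bar> = T * \<bar>D\<bar> * \<bar>wscale a n (Suc k) - w * (1 - a / real (Suc k))\<bar>" by (simp add: abs_mult T_def)
      also have "\<dots> \<le> T * \<bar>D\<bar> * (w * C0 / (real (Suc k))\<^sup>2)"
        using sc2[OF n k(2,3)] TM by (intro mult_left_mono) (auto simp: w_def)
      also have "\<dots> = \<bar>\<mu>\<bar> * \<bar>u\<bar> * C0 * (1 / real (Suc k))"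
        using w by (simp add: \<mu>_def u_def T_def abs_mult power2_eq_square)
      finally show ?thesis .
    qed
    have \<epsilon>: "\<bar>\<epsilon>\<bar> \<le> M * g * ((C0 + a) * \<bar>u\<bar>)"
    proof -
      have "\<bar>\<mu>\<bar> * \<bar>u\<bar> * C0 * (1 / real (Suc k)) \<le> \<bar>\<mu>\<bar> * \<bar>u\<bar> * C0 * 1"
        using C0 by (intro mult_left_mono ik1) auto
      moreover have "\<bar>\<mu> * \<beta>\<bar> = \<bar>\<mu>\<bar> * \<bar>u\<bar> * a" using a by (simp add: \<beta>_def abs_mult)
      ultimately have "\<bar>\<epsilon>\<bar> \<le> \<bar>\<mu>\<bar> * \<bar>u\<bar> * C0 * 1 + \<bar>\<mu>\<bar> * \<bar>u\<bar> * a" using \<mu>\<epsilon> by linarith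
      also have "\<dots> = \<bar>\<mu>\<bar> * ((C0 + a) * \<bar>u\<bar>)" by (simp add: algebra_simps)
      also have "\<dots> \<le> M * g * ((C0 + a) * \<bar>u\<bar>)" using \<mu> C0 a by (intro mult_right_mono) auto
      finally show ?thesis .
    qed
    have b1: "\<bar>b\<bar> \<le> 1" by (simp add: b_def abs_drift_le_1)
    have b\<beta>: "\<bar>b - \<beta>\<bar> \<le> C1 * u\<^sup>2" using dr[of s] k by (simp add: b_def \<beta>_def u_def D_def)
    have s1: "\<bar>\<mu>\<bar> ^ 3 / 3 \<le> M ^ 3 * g ^ 3"
    proof -
      have "\<bar>\<mu>\<bar> ^ 3 \<le> (M * g) ^ 3" using \<mu> by (intro power_mono) auto
      moreover have "0 \<le> \<bar>\<mu>\<bar> ^ 3" by simp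
      ultimately show ?thesis unfolding power_mult_distrib by linarith
    qed
    have s2: "\<bar>\<mu>\<bar> * \<bar>b - \<beta>\<bar> \<le> M * C1 / \<eta>\<^sup>2 * g ^ 3 * P"
    proof -
      have "\<bar>\<mu>\<bar> * \<bar>b - \<beta>\<bar> \<le> (M * g) * (C1 * (P * g\<^sup>2 / \<eta>\<^sup>2))"
        using \<mu> b\<beta> u2 C1 TM g mult_left_mono[OF u2, of C1] by (intro mult_mono) auto
      then show ?thesis by (simp add: power2_eq_square power3_eq_cube algebra_simps)
    qed
    have s3: "\<bar>\<mu>\<^sup>2 - q\<bar> / 2 \<le> T\<^sup>2 * C0 * g ^ 3"
    proof -
      have "x / 2 \<le> y" if "\<bar>x\<bar> \<le> y" for x y :: real using that by linarith
      from this[of "\<bar>\<mu>\<^sup>2 - q\<bar>"] show ?thesis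
        using order_trans[OF \<mu>q mult_left_mono[OF g43 nn(3)]] by simp
    qed
    have s4: "\<bar>\<mu> * \<beta> + \<epsilon>\<bar> \<le> M * C0 / \<eta> * g ^ 3"
    proof -
      have "\<bar>\<mu>\<bar> * \<bar>u\<bar> * C0 * (1 / real (Suc k)) \<le> (M * g) * 1 * C0 * (g\<^sup>2 / \<eta>)"
        using \<mu> u1 C0 TM g ik by (intro mult_mono) auto
      then show ?thesis using \<mu>\<epsilon> by (simp add: power2_eq_square power3_eq_cube algebra_simps)
    qed
    have s5: "q\<^sup>2 / 8 \<le> (T\<^sup>2 * C0)\<^sup>2 * g ^ 3"
    proof -
      have "q\<^sup>2 \<le> (T\<^sup>2 * C0 * g\<^sup>2)\<^sup>2" using q0 by (intro power_mono) auto
      also have "\<dots> = (T\<^sup>2 * C0)\<^sup>2 * g ^ 4" by (simp add: power_mult_distrib flip: power_mult)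
      also have "\<dots> \<le> (T\<^sup>2 * C0)\<^sup>2 * g ^ 3" using g43 by (intro mult_left_mono) auto
      moreover have "0 \<le> q\<^sup>2" by simp
      ultimately show ?thesis by linarith
    qed
    have s6: "\<epsilon>\<^sup>2 / 2 \<le> M\<^sup>2 * (C0 + a)\<^sup>2 / \<eta>\<^sup>2 * g ^ 3 * P"
    proof -
      have "\<epsilon>\<^sup>2 \<le> (M * g * ((C0 + a) * \<bar>u\<bar>))\<^sup>2" using power_mono[OF \<epsilon>, of 2] by simp
      also have "\<dots> = M\<^sup>2 * (C0 + a)\<^sup>2 * g\<^sup>2 * u\<^sup>2" by (simp add: power_mult_distrib)
      also have "\<dots> \<le> M\<^sup>2 * (C0 + a)\<^sup>2 * g\<^sup>2 * (P * g\<^sup>2 / \<eta>\<^sup>2)" using u2 by (intro mult_left_mono) auto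
      also have "\<dots> = M\<^sup>2 * (C0 + a)\<^sup>2 / \<eta>\<^sup>2 * P * g ^ 4" by (simp add: power4_eq_xxxx power2_eq_square)
      also have "\<dots> \<le> M\<^sup>2 * (C0 + a)\<^sup>2 / \<eta>\<^sup>2 * P * g ^ 3" using g43 P by (intro mult_left_mono) auto
      finally have "\<epsilon>\<^sup>2 \<le> M\<^sup>2 * (C0 + a)\<^sup>2 / \<eta>\<^sup>2 * g ^ 3 * P" by (simp only: mult_ac)
      moreover have "\<epsilon>\<^sup>2 / 2 \<le> \<epsilon>\<^sup>2" by simp
      ultimately show ?thesis by (rule order_trans[rotated])
    qed
    have s7: "q / 2 * \<bar>\<epsilon>\<bar> \<le> T\<^sup>2 * C0 * (M * (C0 + a)) * g ^ 3"
    proof -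
      have "\<bar>\<epsilon>\<bar> \<le> M * g * ((C0 + a) * 1)"
        using \<epsilon> by (rule order_trans) (use u1 TM g C0 a in \<open>intro mult_left_mono; auto\<close>)
      then have "q / 2 * \<bar>\<epsilon>\<bar> \<le> (T\<^sup>2 * C0 * g\<^sup>2) * (M * g * ((C0 + a) * 1))"
        using q0 C0 by (intro mult_mono) auto
      then show ?thesis by (simp add: power2_eq_square power3_eq_cube algebra_simps)
    qed
    define X where "X = complex_of_real ((1 + b) / 2) * iexp (- \<mu>) + complex_of_real ((1 - b) / 2) * iexp \<mu>"
    have "cmod (X - iexp \<epsilon> * complex_of_real (exp (- q / 2))) \<le>
        \<bar>\<mu>\<bar> ^ 3 / 3 + \<bar>\<mu>\<bar> * \<bar>b - \<beta>\<bar> + \<bar>\<mu>\<^sup>2 - q\<bar> / 2 + \<bar>\<mu> * \<beta> + \<epsilon>\<bar> + q\<^sup>2 / 8 + \<epsilon>\<^sup>2 / 2 + q / 2 * \<bar>\<epsilon>\<bar>"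
      unfolding X_def by (rule one_step_char_error[OF b1 q0(1)])
    also have "\<dots> \<le> M ^ 3 * g ^ 3 + M * C1 / \<eta>\<^sup>2 * g ^ 3 * P + T\<^sup>2 * C0 * g ^ 3 + M * C0 / \<eta> * g ^ 3 + (T\<^sup>2 * C0)\<^sup>2 * g ^ 3 +
        M\<^sup>2 * (C0 + a)\<^sup>2 / \<eta>\<^sup>2 * g ^ 3 * P + T\<^sup>2 * C0 * (M * (C0 + a)) * g ^ 3"
      using s1 s2 s3 s4 s5 s6 s7 by linarith
    also have "\<dots> \<le> (A + 1) * g ^ 3 * (1 + P)"
    proof -
      have *: "x * g ^ 3 \<le> x * g ^ 3 * (1 + P)" "x * g ^ 3 * P \<le> x * g ^ 3 * (1 + P)" if "x \<ge> 0" for x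
        using that g P by (simp_all add: distrib_left)
      have "0 \<le> g ^ 3 * (1 + P)" using g P by simp
      with *(1)[OF nn(1)] *(2)[OF nn(2)] *(1)[OF nn(3)] *(1)[OF nn(4)] *(1)[OF nn(5)] *(2)[OF nn(6)] *(1)[OF nn(7)]
      show ?thesis unfolding A_def by (simp only: distrib_right mult_1; linarith)
    qed
    finally have main: "cmod (X - iexp \<epsilon> * complex_of_real (exp (- q / 2))) \<le> (A + 1) * g ^ 3 * (1 + P)" .
    have "measure_pmf.expectation (down_step a s) (\<lambda>t. iexp (\<theta> * wpos a n t)) =
        complex_of_real ((1 + b) / 2) * iexp (\<theta> * ((D - 1) * w)) + complex_of_real ((1 - b) / 2) * iexp (\<theta> * ((D + 1) * w))"
      using expectation_down_step[of s a "\<lambda>d l. iexp (\<theta> * (d * wscale a n l))"] k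
      by (simp add: wpos_def b_def D_def w_def scaleR_conv_of_real)
    also have "iexp (\<theta> * ((D - 1) * w)) = iexp (\<theta> * (D * w)) * iexp (- \<mu>)"
      by (simp add: \<mu>_def algebra_simps flip: exp_add)
    also have "iexp (\<theta> * ((D + 1) * w)) = iexp (\<theta> * (D * w)) * iexp \<mu>"
      by (simp add: \<mu>_def algebra_simps flip: exp_add)
    finally have e1: "measure_pmf.expectation (down_step a s) (\<lambda>t. iexp (\<theta> * wpos a n t)) = iexp (\<theta> * (D * w)) * X"
      by (simp add: X_def algebra_simps)
    have e2: "iexp (\<theta> * wpos a n s) = iexp (\<theta> * (D * w)) * iexp \<epsilon>"
      unfolding wpos_def k \<epsilon>_def D_def[symmetric] by (simp add: algebra_simps flip: exp_add)
    have e3: "- (\<theta>\<^sup>2 * (vtime a n (level s - 1) - vtime a n (level s))) / 2 = - q / 2" by (simp add: q_def k)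
    have "cmod (measure_pmf.expectation (down_step a s) (\<lambda>t. iexp (\<theta> * wpos a n t)) -
            iexp (\<theta> * wpos a n s) * complex_of_real (exp (- q / 2))) =
        cmod (iexp (\<theta> * (D * w)) * (X - iexp \<epsilon> * complex_of_real (exp (- q / 2))))"
      unfolding e1 e2 by (simp only: right_diff_distrib mult.assoc)
    also have "\<dots> = cmod (X - iexp \<epsilon> * complex_of_real (exp (- q / 2)))"
      by (simp only: norm_mult norm_exp_i_times mult_1)
    also note main
    finally show "cmod (measure_pmf.expectation (down_step a s) (\<lambda>t. iexp (\<theta> * wpos a n t)) -
            iexp (\<theta> * wpos a n s) * complex_of_real (exp (- (\<theta>\<^sup>2 * (vtime a n (level s - 1) - vtime a n (level s))) / 2)))
      \<le> (A + 1) * (1 / sqrt n) ^ 3 * (1 + (imbalance s)\<^sup>2 / n)"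
      unfolding e3 P(2)[symmetric] g_def[symmetric] .
  qed
qed

text \<open>Errors of single steps add up along the block: later Gaussian factors have modulus at
  most 1, and D^2 is controlled in mean by the value at the start of the block.\<close>

lemma block_char_error:
  fixes a \<eta> \<theta> :: real
  assumes a: "a > 1" and \<eta>: "\<eta> > 0"
  obtains C where "C > 0"
    "\<And>n s r. n \<ge> 1 \<Longrightarrow> r < level s \<Longrightarrow> level s \<le> 2 * n \<Longrightarrow> \<eta> * real n \<le> real (level s - r) \<Longrightarrow>
      cmod (measure_pmf.expectation (chain_state (down_step a) r s) (\<lambda>t. iexp (\<theta> * wpos a n t)) -
            iexp (\<theta> * wpos a n s) * complex_of_real (exp (- (\<theta>\<^sup>2 * (vtime a n (level s - r) - vtime a n (level s))) / 2)))
      \<le> C / sqrt n * (1 + (imbalance s)\<^sup>2 / n)"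
proof -
  obtain C where C: "C > 0" and step:
    "\<And>n s. n \<ge> 1 \<Longrightarrow> level s \<ge> 2 \<Longrightarrow> \<eta> * real n \<le> real (level s - 1) \<Longrightarrow>
      cmod (measure_pmf.expectation (down_step a s) (\<lambda>t. iexp (\<theta> * wpos a n t)) -
            iexp (\<theta> * wpos a n s) * complex_of_real (exp (- (\<theta>\<^sup>2 * (vtime a n (level s - 1) - vtime a n (level s))) / 2)))
      \<le> C * (1 / sqrt n) ^ 3 * (1 + (imbalance s)\<^sup>2 / n)"
    using down_step_char_error[OF a \<eta>, of \<theta>] by blast
  show ?thesis
  proof
    show "6 * C > 0" using C by simp
    fix n r :: nat and s assume n: "n \<ge> 1" and r: "r < level s" and ls: "level s \<le> 2 * n" and \<eta>r: "\<eta> * real n \<le> real (level s - r)"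
    define K where "K = level s"
    \<comment> \<open>The 3 is 1 plus the bound 2 for \<open>level s\<close> / n coming from the
      growth of the second moment.\<close>
    define B where "B = C * (1 / sqrt n) ^ 3 * (3 + (imbalance s)\<^sup>2 / n)"
    have B: "0 \<le> B" unfolding B_def using C by (intro mult_nonneg_nonneg) auto
    let ?v = "vtime a n"
    have "cmod (measure_pmf.expectation (chain_state (down_step a) j s) (\<lambda>t. iexp (\<theta> * wpos a n t)) -
            iexp (\<theta> * wpos a n s) * complex_of_real (exp (- (\<theta>\<^sup>2 * (?v (K - j) - ?v K)) / 2))) \<le> real j * B" if "j \<le> r" for j
      using that
    proof (induction j)
      case (Suc j)
      let ?p = "chain_state (down_step a) j s"
      define q where "q = \<theta>\<^sup>2 * (?v (K - Suc j) - ?v (K - j))"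
      \<comment> \<open>The clock increases as the level decreases, so \<open>q\<close> is
        nonnegative and the factor exp (-q/2) does not amplify earlier errors.\<close>
      have vm: "?v (K - j) \<le> ?v (K - Suc j)"
        unfolding vtime_def using a n Suc.prems r by (intro powr_mono2') (auto simp: K_def divide_right_mono)
      then have q0: "q \<ge> 0" by (simp add: q_def)
      define E where "E t = measure_pmf.expectation (down_step a t) (\<lambda>t. iexp (\<theta> * wpos a n t)) - iexp (\<theta> * wpos a n t) * complex_of_real (exp (- q / 2))" for t
      have lt: "level t = K - j" if "t \<in> set_pmf ?p" for t
        using down_state_level[OF that] Suc.prems r by (simp add: K_def)
      have Eb: "cmod (E t) \<le> C * (1 / sqrt n) ^ 3 * (1 + (imbalance t)\<^sup>2 / n)" if "t \<in> set_pmf ?p" for t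
      proof -
        have K1: "level t - 1 = K - Suc j" "level t \<ge> 2" using lt[OF that] Suc.prems r by (auto simp: K_def)
        have "\<eta> * real n \<le> real (level t - 1)"
          using \<eta>r Suc.prems unfolding K1 K_def by (rule_tac order_trans) auto
        from step[OF n K1(2) this] show ?thesis unfolding E_def q_def K1(1)[symmetric] lt[OF that, symmetric] .
      qed
      have "measure_pmf.expectation (chain_state (down_step a) (Suc j) s) (\<lambda>t. iexp (\<theta> * wpos a n t)) =
          measure_pmf.expectation ?p (\<lambda>t. measure_pmf.expectation (down_step a t) (\<lambda>t. iexp (\<theta> * wpos a n t)))"
      proof -
        have "chain_state (down_step a) 0 = return_pmf" by auto
        then have "chain_state (down_step a) (Suc 0) = down_step a" by (auto simp: bind_return_pmf')
        then have "chain_state (down_step a) (Suc j) s = bind_pmf ?p (down_step a)"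
          using chain_state_add[of "down_step a" j 1 s] by simp
        then show ?thesis by (simp add: expectation_bind_finite)
      qed
      also have "\<dots> = measure_pmf.expectation ?p (\<lambda>t. E t + iexp (\<theta> * wpos a n t) * complex_of_real (exp (- q / 2)))"
        by (simp add: E_def)
      also have "\<dots> = measure_pmf.expectation ?p E + measure_pmf.expectation ?p (\<lambda>t. iexp (\<theta> * wpos a n t)) * complex_of_real (exp (- q / 2))"
        by (subst Bochner_Integration.integral_add) (auto intro!: integrable_measure_pmf_finite)
      finally have ex: "measure_pmf.expectation (chain_state (down_step a) (Suc j) s) (\<lambda>t. iexp (\<theta> * wpos a n t)) = \<dots>" .
      define Z where "Z = iexp (\<theta> * wpos a n s)"
      define F where "F = complex_of_real (exp (- (\<theta>\<^sup>2 * (?v (K - j) - ?v K)) / 2))"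
      have zf: "Z * complex_of_real (exp (- (\<theta>\<^sup>2 * (?v (K - Suc j) - ?v K)) / 2)) = Z * F * complex_of_real (exp (- q / 2))"
        unfolding F_def q_def mult.assoc of_real_mult[symmetric] exp_add[symmetric] by (simp add: algebra_simps add_divide_distrib diff_divide_distrib)
      have "cmod (measure_pmf.expectation (chain_state (down_step a) (Suc j) s) (\<lambda>t. iexp (\<theta> * wpos a n t)) -
          Z * complex_of_real (exp (- (\<theta>\<^sup>2 * (?v (K - Suc j) - ?v K)) / 2))) =
         cmod (measure_pmf.expectation ?p E + (measure_pmf.expectation ?p (\<lambda>t. iexp (\<theta> * wpos a n t)) - Z * F) * complex_of_real (exp (- q / 2)))"
        unfolding ex zf by (simp only: left_diff_distrib add_diff_eq)
      also have "\<dots> \<le> cmod (measure_pmf.expectation ?p E) + cmod (measure_pmf.expectation ?p (\<lambda>t. iexp (\<theta> * wpos a n t)) - Z * F) * exp (- q / 2)"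
        by (rule order_trans[OF norm_triangle_ineq]) (simp add: norm_mult)
      also have "cmod (measure_pmf.expectation ?p (\<lambda>t. iexp (\<theta> * wpos a n t)) - Z * F) * exp (- q / 2) \<le> (real j * B) * 1"
        using Suc q0 B by (intro mult_mono) (auto simp: Z_def F_def)
      also have "cmod (measure_pmf.expectation ?p E) \<le> measure_pmf.expectation ?p (\<lambda>t. cmod (E t))"
        by (rule integral_norm_bound)
      also have "\<dots> \<le> measure_pmf.expectation ?p (\<lambda>t. C * (1 / sqrt n) ^ 3 * (1 + (imbalance t)\<^sup>2 / n))"
        by (intro expectation_mono_finite Eb) auto
      also have "\<dots> = C * (1 / sqrt n) ^ 3 * (1 + measure_pmf.expectation ?p (\<lambda>t. (imbalance t)\<^sup>2) / n)"
        by (simp add: integrable_measure_pmf_finite)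
      also have "\<dots> \<le> C * (1 / sqrt n) ^ 3 * (1 + ((imbalance s)\<^sup>2 + level s) / n)"
        using second_moment_growth[OF a, of j s] Suc.prems r C
        by (intro mult_left_mono add_left_mono divide_right_mono) auto
      also have "\<dots> \<le> B"
      proof -
        have "real (level s) / n \<le> 2" using ls n by (simp add: divide_le_eq)
        then show ?thesis unfolding B_def using C
          by (intro mult_left_mono) (auto simp: add_divide_distrib)
      qed
      finally show ?case by (simp add: Z_def algebra_simps)
    qed simp
    from this[of r] have "cmod (measure_pmf.expectation (chain_state (down_step a) r s) (\<lambda>t. iexp (\<theta> * wpos a n t)) -
            iexp (\<theta> * wpos a n s) * complex_of_real (exp (- (\<theta>\<^sup>2 * (?v (level s - r) - ?v (level s))) / 2))) \<le> real r * B"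
      by (simp add: K_def)
    \<comment> \<open>At most 2n steps, and 3 + y <= 3 (1 + y); together they produce the constant
      6.\<close>
    also have "real r * B \<le> (2 * real n) * (C * (1 / sqrt n) ^ 3 * (3 * (1 + (imbalance s)\<^sup>2 / n)))"
    proof -
      have y: "0 \<le> (imbalance s)\<^sup>2 / n" by simp
      have "real r * B \<le> (2 * real n) * B" using r ls B by (intro mult_right_mono) auto
      also have "B \<le> C * (1 / sqrt n) ^ 3 * (3 * (1 + (imbalance s)\<^sup>2 / n))"
      proof -
        have "3 + y \<le> 3 * (1 + y)" if "0 \<le> y" for y :: real using that by simp
        from this[OF y] show ?thesis unfolding B_def by (rule mult_left_mono) (use C in auto)
      qed
      finally show ?thesis by (simp add: mult_left_mono)
    qed
    also have "\<dots> = 6 * C / sqrt n * (1 + (imbalance s)\<^sup>2 / n)"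
    proof -
      have "real n * (1 / sqrt n) ^ 3 = 1 / sqrt n"
        using n by (simp add: power3_eq_cube field_simps)
      moreover have "(2 * real n) * (C * G * (3 * Y)) = 6 * C * (real n * G) * Y" for G Y :: real by simp
      ultimately show ?thesis by (simp only: times_divide_eq_right mult_1_right)
    qed
    finally show "cmod (measure_pmf.expectation (chain_state (down_step a) r s) (\<lambda>t. iexp (\<theta> * wpos a n t)) -
            iexp (\<theta> * wpos a n s) * complex_of_real (exp (- (\<theta>\<^sup>2 * (vtime a n (level s - r) - vtime a n (level s))) / 2)))
      \<le> 6 * C / sqrt n * (1 + (imbalance s)\<^sup>2 / n)" .
  qed
qed

section \<open>Gaussian blocks\<close>

lemma sets_centered_normal [simp, measurable_cong]: "sets (centered_normal v) = sets borel"
  by (simp add: centered_normal_def)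

lemma prob_space_centered_normal: "v \<ge> 0 \<Longrightarrow> prob_space (centered_normal v)"
  by (auto simp: centered_normal_def prob_space_return intro!: prob_space_normal_density)

lemma real_distribution_centered_normal: "v \<ge> 0 \<Longrightarrow> real_distribution (centered_normal v)"
  by (simp add: real_distribution_def real_distribution_axioms_def prob_space_centered_normal)

lemma char_centered_normal:
  assumes "v \<ge> 0"
  shows "char (centered_normal v) t = complex_of_real (exp (- (t\<^sup>2 * v) / 2))"
proof (cases "v = 0")
  case True
  then show ?thesis by (simp add: char_def centered_normal_def integral_return)
next
  case False
  define \<sigma> where "\<sigma> = sqrt v"
  have \<sigma>: "\<sigma> > 0" "\<sigma>\<^sup>2 = v" using assms False by (auto simp: \<sigma>_def)
  let ?N = "centered_normal v"
  interpret prob_space ?N using assms by (rule prob_space_centered_normal)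
  have N: "?N = density lborel (normal_density 0 \<sigma>)" using False by (simp add: centered_normal_def \<sigma>_def)
  have "distributed ?N lborel (\<lambda>x. x) (normal_density 0 \<sigma>)"
  proof -
    have "distr ?N lborel (\<lambda>x. x) = density lborel (normal_density 0 \<sigma>)"
      using distr_id2[of lborel ?N] by (simp add: N)
    then show ?thesis by (simp add: distributed_def)
  qed
  then have "distributed ?N lborel (\<lambda>x. (x - 0) / \<sigma>) std_normal_density"
    by (simp only: normal_standard_normal_convert[OF \<sigma>(1), of "\<lambda>x. x" 0])
  then have "distr ?N lborel (\<lambda>x. x / \<sigma>) = std_normal_distribution" by (simp add: distributed_def)
  moreover have "distr ?N lborel (\<lambda>x. x / \<sigma>) = distr ?N borel (\<lambda>x. x / \<sigma>)" by (intro distr_cong) auto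
  ultimately have d: "distr ?N borel (\<lambda>x. x / \<sigma>) = std_normal_distribution" by simp
  have "char ?N t = (CLINT x|?N. iexp ((t * \<sigma>) * (x / \<sigma>)))" using \<sigma> by (simp add: char_def)
  also have "\<dots> = char (distr ?N borel (\<lambda>x. x / \<sigma>)) (t * \<sigma>)"
    unfolding char_def by (subst integral_distr) auto
  also have "\<dots> = complex_of_real (exp (- (t * \<sigma>)\<^sup>2 / 2))" unfolding d char_std_normal_distribution ..
  finally show ?thesis using \<sigma> by (simp add: power_mult_distrib)
qed

text \<open>The increment of the limiting clock over the dyadic block [l, l + 1] / 2^m. The block
  touching 0 would have infinite variance and gets the default 0; index sets start at 1.\<close>

definition bvar :: "real \<Rightarrow> nat \<Rightarrow> nat \<Rightarrow> real" where
  "bvar a m l = (if l = 0 then 0 else (real l / 2 ^ m) powr (1 - 2 * a) - (real (Suc l) / 2 ^ m) powr (1 - 2 * a))"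

text \<open>The level belonging to time l / 2^m, with the same rounding as in
  \<open>scaled_Delta\<close>.\<close>

definition gridpt :: "nat \<Rightarrow> nat \<Rightarrow> nat \<Rightarrow> nat" where
  "gridpt n m l = (2 * n * l) div 2 ^ m"

lemma bvar_nonneg: "a > 1 \<Longrightarrow> bvar a m l \<ge> 0"
proof (cases "l = 0")
  case False
  assume "a > 1"
  then have "(real (Suc l) / 2 ^ m) powr (1 - 2 * a) \<le> (real l / 2 ^ m) powr (1 - 2 * a)"
    using False by (intro powr_mono2' divide_right_mono) auto
  then show ?thesis using False by (simp add: bvar_def)
qed (simp add: bvar_def)

lemma gridpt_mono: "l \<le> l' \<Longrightarrow> gridpt n m l \<le> gridpt n m l'"
  unfolding gridpt_def by (intro div_le_mono mult_le_mono2)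

lemma gridpt_top: "gridpt n m (2 ^ m) = 2 * n"
  by (simp add: gridpt_def)

lemma gridpt_le: "l \<le> 2 ^ m \<Longrightarrow> gridpt n m l \<le> 2 * n"
  using gridpt_mono[of l "2 ^ m" n m] by (simp add: gridpt_top)

lemma gridpt_bounds:
  "2 * real n * (real l / 2 ^ m) - 1 \<le> real (gridpt n m l)" "real (gridpt n m l) \<le> 2 * real n * (real l / 2 ^ m)"
proof -
  have "real (gridpt n m l) = real_of_int \<lfloor>real (2 * n * l) / real (2 ^ m)\<rfloor>"
    unfolding gridpt_def floor_divide_of_nat_eq by simp
  moreover have "real (2 * n * l) / real (2 ^ m) = 2 * real n * (real l / 2 ^ m)" by simp
  ultimately have e: "real (gridpt n m l) = real_of_int \<lfloor>2 * real n * (real l / 2 ^ m)\<rfloor>" by metis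
  show "2 * real n * (real l / 2 ^ m) - 1 \<le> real (gridpt n m l)" "real (gridpt n m l) \<le> 2 * real n * (real l / 2 ^ m)"
    unfolding e using floor_correct[of "2 * real n * (real l / 2 ^ m)"] by auto
qed

lemma gridpt_limit: "(\<lambda>n. real (gridpt n m l) / (2 * real n)) \<longlonglongrightarrow> real l / 2 ^ m"
proof (rule tendsto_sandwich)
  show "\<forall>\<^sub>F n in sequentially. real l / 2 ^ m - 1 / (2 * real n) \<le> real (gridpt n m l) / (2 * real n)"
    using eventually_gt_at_top[of 0]
  proof eventually_elim
    case (elim n)
    have "real l / 2 ^ m - 1 / (2 * real n) = (2 * real n * (real l / 2 ^ m) - 1) / (2 * real n)"
      using elim by (simp add: field_simps)
    also have "\<dots> \<le> real (gridpt n m l) / (2 * real n)" using gridpt_bounds(1) by (intro divide_right_mono) auto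
    finally show ?case .
  qed
  show "\<forall>\<^sub>F n in sequentially. real (gridpt n m l) / (2 * real n) \<le> real l / 2 ^ m"
    using eventually_gt_at_top[of 0]
  proof eventually_elim
    case (elim n)
    have "real (gridpt n m l) / (2 * real n) \<le> (2 * real n * (real l / 2 ^ m)) / (2 * real n)"
      using gridpt_bounds(2) by (intro divide_right_mono) auto
    then show ?case using elim by simp
  qed
  have "(\<lambda>n. 1 / (2 * real n)) \<longlonglongrightarrow> 0" by real_asymp
  from tendsto_diff[OF tendsto_const this] show "(\<lambda>n. real l / 2 ^ m - 1 / (2 * real n)) \<longlonglongrightarrow> real l / 2 ^ m" by simp
qed simp

text \<open>For n >= 2^m the unit lost by rounding is absorbed by giving up half of 2 n l /
  2^m.\<close>

lemma gridpt_ge_linear: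
  assumes "1 \<le> l" "2 ^ m \<le> n"
  shows "real l / 2 ^ m * real n \<le> real (gridpt n m l)"
proof -
  define x where "x = real l / 2 ^ m * real n"
  have "1 \<le> x"
  proof -
    have "(2::real) ^ m \<le> real n" using assms(2) by (metis of_nat_le_iff of_nat_numeral of_nat_power)
    then have "1 * 2 ^ m \<le> real l * real n" using assms(1) by (intro mult_mono) auto
    then show ?thesis by (simp add: x_def field_simps)
  qed
  moreover have "2 * real n * (real l / 2 ^ m) = 2 * x" by (simp add: x_def)
  ultimately show ?thesis using gridpt_bounds(1)[of n l m] unfolding x_def[symmetric] by linarith
qed

lemma gridpt_ge_2:
  assumes "1 \<le> l" "2 ^ m \<le> n" shows "2 \<le> gridpt n m l"
proof -
  have "2 * 2 ^ m \<le> 2 * n * l" using assms mult_le_mono[of "2 ^ m" n 1 l] by simp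
  then have "(2 * 2 ^ m) div 2 ^ m \<le> gridpt n m l" unfolding gridpt_def by (rule div_le_mono)
  then show ?thesis by simp
qed

lemma eventually_ge_2_power: "\<forall>\<^sub>F n in sequentially. 2 ^ m \<le> n"
  by (rule eventually_ge_at_top)

lemma vtime_gridpt_limit:
  assumes "1 \<le> l"
  shows "(\<lambda>n. vtime a n (gridpt n m l)) \<longlonglongrightarrow> (real l / 2 ^ m) powr (1 - 2 * a)"
  unfolding vtime_def using assms by (intro tendsto_powr gridpt_limit tendsto_const) auto

text \<open>The start may vary with n as long as its imbalance is O(sqrt n). That the limit law does
  not depend on the start is the source of the independence of blocks.\<close>

lemma block_weak_conv:
  assumes a: "a > 1" and l: "1 \<le> l" "Suc l \<le> 2 ^ m"
    and lev: "\<And>n. level (s n) = gridpt n m (Suc l)"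
    and imb: "\<forall>\<^sub>F n in sequentially. (imbalance (s n))\<^sup>2 \<le> R * real n"
  shows "weak_conv_m (\<lambda>n. distr (measure_pmf (chain_state (down_step a) (gridpt n m (Suc l) - gridpt n m l) (s n)))
      borel (\<lambda>t. wpos a n t - wpos a n (s n))) (centered_normal (bvar a m l))"
proof (rule levy_continuity)
  let ?p = "\<lambda>n. chain_state (down_step a) (gridpt n m (Suc l) - gridpt n m l) (s n)"
  let ?\<mu> = "\<lambda>n. distr (measure_pmf (?p n)) borel (\<lambda>t. wpos a n t - wpos a n (s n))"
  show "real_distribution (?\<mu> n)" for n
    by (rule prob_space.real_distribution_distr) (auto intro: measure_pmf.prob_space_axioms)
  show "real_distribution (centered_normal (bvar a m l))"
    by (intro real_distribution_centered_normal bvar_nonneg a)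
  fix \<theta> :: real
  define \<eta> where "\<eta> = real l / 2 ^ m"
  have \<eta>: "\<eta> > 0" using l by (simp add: \<eta>_def)
  obtain C where C: "C > 0" and err:
    "\<And>n s r. n \<ge> 1 \<Longrightarrow> r < level s \<Longrightarrow> level s \<le> 2 * n \<Longrightarrow> \<eta> * real n \<le> real (level s - r) \<Longrightarrow>
      cmod (measure_pmf.expectation (chain_state (down_step a) r s) (\<lambda>t. iexp (\<theta> * wpos a n t)) -
            iexp (\<theta> * wpos a n s) * complex_of_real (exp (- (\<theta>\<^sup>2 * (vtime a n (level s - r) - vtime a n (level s))) / 2)))
      \<le> C / sqrt n * (1 + (imbalance s)\<^sup>2 / n)"
    using block_char_error[OF a \<eta>, of \<theta>] by blast
  let ?T = "\<lambda>n. complex_of_real (exp (- (\<theta>\<^sup>2 * (vtime a n (gridpt n m l) - vtime a n (gridpt n m (Suc l)))) / 2))"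
  have lim0: "(\<lambda>n. char (?\<mu> n) \<theta> - ?T n) \<longlonglongrightarrow> 0"
  proof (rule Lim_null_comparison)
    show "(\<lambda>n. C / sqrt (real n) * (1 + R)) \<longlonglongrightarrow> 0" by real_asymp
    show "\<forall>\<^sub>F n in sequentially. cmod (char (?\<mu> n) \<theta> - ?T n) \<le> C / sqrt (real n) * (1 + R)"
      using imb eventually_ge_2_power[of m] eventually_ge_at_top[of 1]
    proof eventually_elim
      case (elim n)
      let ?r = "gridpt n m (Suc l) - gridpt n m l"
      have g: "gridpt n m l \<le> gridpt n m (Suc l)" "gridpt n m l \<ge> 2" "gridpt n m (Suc l) \<le> 2 * n"
        using gridpt_mono gridpt_ge_2[OF l(1) elim(2)] gridpt_le[OF l(2)] by auto
      have lr: "level (s n) - ?r = gridpt n m l" using g by (simp add: lev)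
      have "char (?\<mu> n) \<theta> = (CLINT t|?p n. iexp (\<theta> * (wpos a n t - wpos a n (s n))))"
        unfolding char_def by (subst integral_distr) auto
      also have "\<dots> = (CLINT t|?p n. iexp (\<theta> * wpos a n t) * iexp (- (\<theta> * wpos a n (s n))))"
        by (simp add: algebra_simps flip: exp_add)
      also have "\<dots> = (CLINT t|?p n. iexp (\<theta> * wpos a n t)) * iexp (- (\<theta> * wpos a n (s n)))" by simp
      finally have ch: "char (?\<mu> n) \<theta> = (CLINT t|?p n. iexp (\<theta> * wpos a n t)) * iexp (- (\<theta> * wpos a n (s n)))" .
      have one: "iexp (\<theta> * wpos a n (s n)) * iexp (- (\<theta> * wpos a n (s n))) = 1"
        by (simp flip: exp_add)
      have "char (?\<mu> n) \<theta> - ?T n =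
          ((CLINT t|?p n. iexp (\<theta> * wpos a n t)) - iexp (\<theta> * wpos a n (s n)) * ?T n) * iexp (- (\<theta> * wpos a n (s n)))"
      proof -
        have "(A - Z * T) * W = A * W - T" if "Z * W = 1" for A Z T W :: complex
        proof -
          have "(A - Z * T) * W = A * W - T * (Z * W)" by (simp add: algebra_simps)
          then show ?thesis using that by simp
        qed
        from this[OF one] show ?thesis unfolding ch by simp
      qed
      then have "cmod (char (?\<mu> n) \<theta> - ?T n) = cmod ((CLINT t|?p n. iexp (\<theta> * wpos a n t)) - iexp (\<theta> * wpos a n (s n)) * ?T n)"
        by (simp only: norm_mult norm_exp_i_times mult_1_right)
      also have "\<dots> \<le> C / sqrt n * (1 + (imbalance (s n))\<^sup>2 / n)"
        using err[of n ?r "s n"] elim g lr gridpt_ge_linear[OF l(1) elim(2)] by (simp add: lev \<eta>_def)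
      also have "\<dots> \<le> C / sqrt n * (1 + R)"
        using C elim by (intro mult_left_mono add_left_mono) (auto simp: divide_le_eq)
      finally show ?case .
    qed
  qed
  have "?T \<longlonglongrightarrow> char (centered_normal (bvar a m l)) \<theta>"
    unfolding char_centered_normal[OF bvar_nonneg[OF a]]
    by (intro tendsto_intros tendsto_eq_rhs[OF tendsto_diff[OF vtime_gridpt_limit vtime_gridpt_limit]])
      (use l in \<open>auto simp: bvar_def\<close>)
  from tendsto_add[OF lim0 this] show "(\<lambda>n. char (?\<mu> n) \<theta>) \<longlonglongrightarrow> char (centered_normal (bvar a m l)) \<theta>"
    by simp
qed

text \<open>Below level 2n the factor (k / 2n)^(-a) is at least 1, so a bounded rescaled position
  gives an imbalance O(sqrt n), the condition on the start of the next block.\<close>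

lemma imbalance_le_wpos:
  assumes a: "a > 1" and "level s \<le> 2 * n"
  shows "\<bar>imbalance s\<bar> \<le> \<bar>wpos a n s\<bar> * sqrt n / sqrt ((2 * a - 1) / 2)"
proof (cases "level s = 0")
  case True
  then show ?thesis using abs_imbalance_le_level[of s] a by simp
next
  case False
  define c where "c = sqrt ((2 * a - 1) / 2)"
  have c: "c > 0" using a by (simp add: c_def)
  have n: "n > 0" using assms False by simp
  have "1 \<le> (real (level s) / (2 * real n)) powr - a"
  proof -
    have "real (level s) / (2 * real n) \<le> 1" using assms n by (simp add: divide_le_eq)
    then have "1 powr - a \<le> (real (level s) / (2 * real n)) powr - a"
      using False n a by (intro powr_mono2') auto
    then show ?thesis by simp
  qed
  then have "1 * (c / sqrt n) \<le> wscale a n (level s)"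
    unfolding wscale_def c_def[symmetric] times_divide_eq_right[symmetric] using c by (intro mult_right_mono) auto
  then have "\<bar>imbalance s\<bar> * (c / sqrt n) \<le> \<bar>wpos a n s\<bar>"
    unfolding wpos_def abs_mult by (intro mult_left_mono) auto
  then show ?thesis using c n unfolding c_def[symmetric] by (simp add: field_simps)
qed

lemma wscale_pos: "a > 1 \<Longrightarrow> n > 0 \<Longrightarrow> k > 0 \<Longrightarrow> wscale a n k > 0"
  by (simp add: wscale_def)

lemma state_eqI:
  assumes "level s = level t" "imbalance s = imbalance t" shows "s = t"
proof -
  have "real (fst s) + real (snd s) = real (fst t) + real (snd t)"
    using assms(1) unfolding level_def by linarith
  with assms(2) have "real (fst s) = real (fst t)" "real (snd s) = real (snd t)"
    unfolding imbalance_def by linarith+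
  then show ?thesis by (simp add: prod_eq_iff)
qed

text \<open>The list is a reversed path starting at grid level i, which explains the index
  differences. Padding by zero puts all numbers of blocks into the single space of real sequences,
  whose product topology carries the test functions.\<close>

definition block_incr :: "real \<Rightarrow> nat \<Rightarrow> nat \<Rightarrow> nat \<Rightarrow> (nat \<times> nat) list \<Rightarrow> nat \<Rightarrow> real" where
  "block_incr a n m i xs l = (if l \<in> {1..<i} then
     wpos a n (xs ! (gridpt n m i - gridpt n m l)) - wpos a n (xs ! (gridpt n m i - gridpt n m (Suc l))) else 0)"

text \<open>Points of a product measure are undefined outside the index set; this gives them the
  same padding as \<open>block_incr\<close>.\<close>

definition zero_ext :: "nat set \<Rightarrow> (nat \<Rightarrow> real) \<Rightarrow> nat \<Rightarrow> real" where
  "zero_ext I x l = (if l \<in> I then x l else 0)"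

abbreviation gauss_blocks :: "real \<Rightarrow> nat \<Rightarrow> nat set \<Rightarrow> (nat \<Rightarrow> real) measure" where
  "gauss_blocks a m I \<equiv> PiM I (\<lambda>l. centered_normal (bvar a m l))"

lemma measurable_zero_ext [measurable]: "zero_ext I \<in> borel_measurable (gauss_blocks a m I)"
proof (rule measurable_coordinatewise_then_product)
  fix l show "(\<lambda>x. zero_ext I x l) \<in> borel_measurable (gauss_blocks a m I)"
  proof (cases "l \<in> I")
    case True
    have "(\<lambda>x. x l) \<in> measurable (gauss_blocks a m I) (centered_normal (bvar a m l))"
      using True by (rule measurable_component_singleton)
    then show ?thesis using True by (simp add: zero_ext_def)
  qed (simp add: zero_ext_def)
qed

lemma product_prob_gauss: "a > 1 \<Longrightarrow> product_prob_space (\<lambda>l. centered_normal (bvar a m l))"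
  by (rule product_prob_spaceI, rule prob_space_centered_normal, rule bvar_nonneg)

lemma measurable_zero_ext_upd:
  "(\<lambda>z. (zero_ext I (fst z))(i := snd z)) \<in> borel_measurable (gauss_blocks a m I \<Otimes>\<^sub>M centered_normal v)"
proof (rule measurable_coordinatewise_then_product)
  fix l
  have s: "snd \<in> measurable (gauss_blocks a m I \<Otimes>\<^sub>M centered_normal v) borel"
    using measurable_snd[of "gauss_blocks a m I" "centered_normal v"]
    unfolding measurable_cong_sets[OF refl sets_centered_normal] .
  have "(\<lambda>x. zero_ext I x l) \<in> borel_measurable (gauss_blocks a m I)"
    using measurable_product_then_coordinatewise[OF measurable_zero_ext] .
  from measurable_compose[OF measurable_fst this] s
  show "(\<lambda>z. ((zero_ext I (fst z))(i := snd z)) l) \<in> borel_measurable (gauss_blocks a m I \<Otimes>\<^sub>M centered_normal v)"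
    by (cases "l = i") auto
qed

text \<open>Fubini in the order suited to the induction over blocks: the new coordinate is
  integrated outermost, just as the chain is conditioned on its first block.\<close>

lemma gauss_blocks_insert:
  fixes g :: "(nat \<Rightarrow> real) \<Rightarrow> real"
  assumes a: "a > 1" and I: "finite I" "i \<notin> I"
    and g: "g \<in> borel_measurable borel" "\<And>x. \<bar>g x\<bar> \<le> B"
  shows "(\<integral>x. g (zero_ext (insert i I) x) \<partial>gauss_blocks a m (insert i I)) =
    (\<integral>y. (\<integral>x. g ((zero_ext I x)(i := y)) \<partial>gauss_blocks a m I) \<partial>centered_normal (bvar a m i))"
    and "(\<lambda>y. \<integral>x. g ((zero_ext I x)(i := y)) \<partial>gauss_blocks a m I) \<in> borel_measurable borel"
proof -
  interpret P: product_prob_space "\<lambda>l. centered_normal (bvar a m l)" by (rule product_prob_gauss[OF a])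
  interpret F: finite_product_prob_space "\<lambda>l. centered_normal (bvar a m l)" "insert i I"
    by unfold_locales (use I in auto)
  interpret G: finite_product_prob_space "\<lambda>l. centered_normal (bvar a m l)" I
    by unfold_locales (use I in auto)
  interpret N: prob_space "centered_normal (bvar a m i)" by (intro prob_space_centered_normal bvar_nonneg a)
  interpret PP: pair_prob_space "gauss_blocks a m I" "centered_normal (bvar a m i)" ..
  have m1: "(\<lambda>x. g (zero_ext (insert i I) x)) \<in> borel_measurable (gauss_blocks a m (insert i I))"
    using measurable_compose[OF measurable_zero_ext g(1)] .
  have m2: "(\<lambda>z. g ((zero_ext I (fst z))(i := snd z))) \<in> borel_measurable (gauss_blocks a m I \<Otimes>\<^sub>M centered_normal (bvar a m i))"
    using measurable_compose[OF measurable_zero_ext_upd g(1)] .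
  have "(\<integral>x. g (zero_ext (insert i I) x) \<partial>gauss_blocks a m (insert i I)) =
     (\<integral>x. (\<integral>y. g (zero_ext (insert i I) (x(i := y))) \<partial>centered_normal (bvar a m i)) \<partial>gauss_blocks a m I)"
    by (rule P.product_integral_insert[OF I]) (auto intro!: F.integrable_const_bound[where B=B] m1 simp: g)
  also have "\<dots> = (\<integral>x. (\<integral>y. g ((zero_ext I x)(i := y)) \<partial>centered_normal (bvar a m i)) \<partial>gauss_blocks a m I)"
  proof -
    have "zero_ext (insert i I) (x(i := y)) = (zero_ext I x)(i := y)" for x y using I by (auto simp: zero_ext_def)
    then show ?thesis by simp
  qed
  also have "\<dots> = (\<integral>y. (\<integral>x. g ((zero_ext I x)(i := y)) \<partial>gauss_blocks a m I) \<partial>centered_normal (bvar a m i))"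
    by (rule PP.Fubini_integral[symmetric])
      (auto intro!: PP.integrable_const_bound[where B=B] simp: g case_prod_beta' m2)
  finally show "(\<integral>x. g (zero_ext (insert i I) x) \<partial>gauss_blocks a m (insert i I)) =
    (\<integral>y. (\<integral>x. g ((zero_ext I x)(i := y)) \<partial>gauss_blocks a m I) \<partial>centered_normal (bvar a m i))" .
  have "(\<lambda>y. \<integral>x. g ((zero_ext I x)(i := y)) \<partial>gauss_blocks a m I) \<in> borel_measurable (centered_normal (bvar a m i))"
    using measurable_compose[OF measurable_pair_swap' m2]
    by (intro sigma_finite_measure.borel_measurable_lebesgue_integral prob_space_imp_sigma_finite
        prob_space_PiM prob_space_centered_normal bvar_nonneg a)
      (simp add: case_prod_beta')
  then show "(\<lambda>y. \<integral>x. g ((zero_ext I x)(i := y)) \<partial>gauss_blocks a m I) \<in> borel_measurable borel"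
    unfolding measurable_cong_sets[OF sets_centered_normal refl] .
qed

lemma borel_measurable_finite_support:
  fixes f :: "real \<Rightarrow> real"
  assumes "finite Z" "\<And>y. y \<notin> Z \<Longrightarrow> f y = 0"
  shows "f \<in> borel_measurable borel"
proof -
  have "f y = (\<Sum>z\<in>Z. indicator {z} y * f z)" for y
  proof (cases "y \<in> Z")
    case True
    have "(\<Sum>z\<in>Z. indicator {z} y * f z) = (\<Sum>z\<in>Z. if z = y then f y else 0)"
      by (intro sum.cong) (auto simp: indicator_def)
    then show ?thesis using True assms(1) by simp
  next
    case False
    then show ?thesis using assms by (auto simp: indicator_def intro!: sum.neutral[symmetric])
  qed
  then have "f = (\<lambda>y. \<Sum>z\<in>Z. indicator {z} y * f z)" by (rule ext)
  also have "\<dots> \<in> borel_measurable borel" by measurable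
  finally show ?thesis .
qed

section \<open>Finite-dimensional limits of the reversed chain\<close>

text \<open>Continuous convergence. Test functions must be allowed to vary with n, since both the
  increment already plugged in and the rounding of grid levels depend on n; this notion survives
  plugging in convergent coordinates.\<close>

definition cont_conv :: "(nat \<Rightarrow> (nat \<Rightarrow> real) \<Rightarrow> real) \<Rightarrow> ((nat \<Rightarrow> real) \<Rightarrow> real) \<Rightarrow> bool" where
  "cont_conv gn g \<longleftrightarrow> (\<forall>X x. (\<forall>l. (\<lambda>n. X n l) \<longlonglongrightarrow> x l) \<longrightarrow> (\<lambda>n. gn n (X n)) \<longlonglongrightarrow> g x)"

lemma prob_last_eq_hit:
  "measure_pmf.prob (chain_path (down_step a) (level s - 2) s) {xs. last xs = (1, 1)} = hit a s"
proof -
  have "hit a s = pmf (map_pmf last (chain_path (down_step a) (level s - 2) s)) (1, 1)"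
    by (simp add: hit_def map_last_chain_path)
  also have "\<dots> = measure_pmf.prob (chain_path (down_step a) (level s - 2) s) (last -` {(1, 1)})"
    by (rule pmf_map)
  also have "last -` {(1, 1)} = {xs. last xs = (1, 1)}" by auto
  finally show ?thesis by simp
qed

text \<open>The contents are (k + D) / 2 and (k - D) / 2 with k of order n and D of order sqrt n, so
  both tend to infinity.\<close>

lemma hit_tendsto:
  assumes h: "\<And>e. e > 0 \<Longrightarrow> \<exists>N. \<forall>i\<ge>N. \<forall>j\<ge>N. \<bar>hit a (i, j) - h\<bar> < e"
    and l: "1 \<le> l" and lev: "\<And>n. level (s n) = gridpt n m l"
    and imb: "\<forall>\<^sub>F n in sequentially. (imbalance (s n))\<^sup>2 \<le> R * real n"
  shows "(\<lambda>n. hit a (s n)) \<longlonglongrightarrow> h"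
proof (rule LIMSEQ_I)
  fix e :: real assume "e > 0"
  then obtain N where N: "\<And>i j. i \<ge> N \<Longrightarrow> j \<ge> N \<Longrightarrow> \<bar>hit a (i, j) - h\<bar> < e" using h by blast
  define c where "c = real l / 2 ^ m"
  have c: "c > 0" using l by (simp add: c_def)
  define q where "q = sqrt (max R 0)"
  have "filterlim (\<lambda>n. (c * real n - q * sqrt (real n)) / 2) at_top sequentially"
    using c by real_asymp
  then have "\<forall>\<^sub>F n in sequentially. real N \<le> (c * real n - q * sqrt (real n)) / 2"
    by (simp add: filterlim_at_top)
  then have "\<forall>\<^sub>F n in sequentially. \<bar>hit a (s n) - h\<bar> < e"
    using imb eventually_ge_2_power[of m]
  proof eventually_elim
    case (elim n)
    have "(imbalance (s n))\<^sup>2 \<le> max R 0 * real n" using elim(2) by (rule order_trans) (intro mult_right_mono; simp)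
    then have A: "\<bar>imbalance (s n)\<bar> \<le> q * sqrt (real n)"
      unfolding q_def real_sqrt_mult[symmetric] by (intro real_le_rsqrt) simp
    have B: "c * real n \<le> real (level (s n))" using gridpt_ge_linear[OF l elim(3)] by (simp add: lev c_def)
    have C: "real (fst (s n)) = (real (level (s n)) + imbalance (s n)) / 2" "real (snd (s n)) = (real (level (s n)) - imbalance (s n)) / 2"
      by (auto simp: level_def imbalance_def)
    have "real N \<le> real (fst (s n))" using A B C(1) elim(1) by (simp add: abs_le_iff field_simps)
    moreover have "real N \<le> real (snd (s n))" using A B C(2) elim(1) by (simp add: abs_le_iff field_simps)
    ultimately show ?case using N[of "fst (s n)" "snd (s n)"] by simp
  qed
  then show "\<exists>no. \<forall>n\<ge>no. norm (hit a (s n) - h) < e" by (simp add: eventually_sequentially)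
qed

section \<open>Peeling off the first block\<close>

lemma block_incr_drop:
  assumes "i \<ge> 1" and len: "length xs = Suc (gridpt n m (Suc i) - 2)" and K: "gridpt n m i \<ge> 2"
  defines "r \<equiv> gridpt n m (Suc i) - gridpt n m i"
  shows "block_incr a n m (Suc i) xs = (block_incr a n m i (drop r xs))(i := wpos a n (drop r xs ! 0) - wpos a n (xs ! 0))"
proof
  fix l
  have mono: "gridpt n m i \<le> gridpt n m (Suc i)" by (rule gridpt_mono) simp
  have r: "r \<le> length xs" using len mono K by (simp add: r_def)
  consider "l = i" | "l \<in> {1..<i}" | "l \<noteq> i" "l \<notin> {1..<i}" by blast
  then show "block_incr a n m (Suc i) xs l = ((block_incr a n m i (drop r xs))(i := wpos a n (drop r xs ! 0) - wpos a n (xs ! 0))) l"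
  proof cases
    case 1
    then show ?thesis using assms(1) r by (simp add: block_incr_def r_def)
  next
    case 2
    have "gridpt n m (Suc i) - gridpt n m l = r + (gridpt n m i - gridpt n m l)"
      using gridpt_mono[of l i n m] 2 mono by (simp add: r_def)
    moreover have "gridpt n m (Suc i) - gridpt n m (Suc l) = r + (gridpt n m i - gridpt n m (Suc l))"
      using gridpt_mono[of "Suc l" i n m] 2 mono by (simp add: r_def)
    ultimately show ?thesis using 2 r by (simp add: block_incr_def)
  next
    case 3
    then show ?thesis by (auto simp: block_incr_def)
  qed
qed

lemma fdd_first_block:
  assumes i: "i \<ge> 1" and K: "gridpt n m i \<ge> 2" and lev: "level s = gridpt n m (Suc i)"
  shows "measure_pmf.expectation (chain_path (down_step a) (gridpt n m (Suc i) - 2) s)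
      (\<lambda>xs. indicator {xs. last xs = (1, 1)} xs * gf (block_incr a n m (Suc i) xs)) =
    measure_pmf.expectation (chain_state (down_step a) (gridpt n m (Suc i) - gridpt n m i) s)
      (\<lambda>t. measure_pmf.expectation (chain_path (down_step a) (gridpt n m i - 2) t)
        (\<lambda>ys. indicator {xs. last xs = (1, 1)} ys * (gf ((block_incr a n m i ys)(i := wpos a n t - wpos a n s)) :: real)))"
proof -
  define r where "r = gridpt n m (Suc i) - gridpt n m i"
  define m' where "m' = gridpt n m i - 2"
  have mono: "gridpt n m i \<le> gridpt n m (Suc i)" by (rule gridpt_mono) simp
  have e: "gridpt n m (Suc i) - 2 = r + m'" using mono K by (simp add: r_def m'_def)
  let ?L = "{xs. last xs = (1 :: nat, 1 :: nat)}"
  define F' where "F' ys = indicator ?L ys * gf ((block_incr a n m i ys)(i := wpos a n (ys ! 0) - wpos a n s))" for ys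
  have "measure_pmf.expectation (chain_path (down_step a) (r + m') s) (\<lambda>xs. indicator ?L xs * gf (block_incr a n m (Suc i) xs))
     = measure_pmf.expectation (chain_path (down_step a) (r + m') s) (\<lambda>xs. F' (drop r xs))"
  proof (intro integral_cong_AE)
    show "AE xs in measure_pmf (chain_path (down_step a) (r + m') s). indicator ?L xs * gf (block_incr a n m (Suc i) xs) = F' (drop r xs)"
    proof (rule AE_pmfI)
      fix xs assume xs: "xs \<in> set_pmf (chain_path (down_step a) (r + m') s)"
      have len: "length xs = Suc (gridpt n m (Suc i) - 2)" using chain_path_hd_length[OF xs] e by simp
      have x0: "xs ! 0 = s" using chain_path_nth_0[OF xs] .
      have "last (drop r xs) = last xs" using len by (intro last_drop) (simp add: e)
      then show "indicator ?L xs * gf (block_incr a n m (Suc i) xs) = F' (drop r xs)"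
        unfolding F'_def block_incr_drop[OF i len K, folded r_def] x0 by (simp add: indicator_def)
    qed
  qed auto
  also have "\<dots> = measure_pmf.expectation (map_pmf (drop r) (chain_path (down_step a) (r + m') s)) F'" by simp
  also have "\<dots> = measure_pmf.expectation (chain_state (down_step a) r s) (\<lambda>t. measure_pmf.expectation (chain_path (down_step a) m' t) F')"
    unfolding map_drop_chain_path by (rule expectation_bind_finite) auto
  also have "\<dots> = measure_pmf.expectation (chain_state (down_step a) r s) (\<lambda>t. measure_pmf.expectation (chain_path (down_step a) m' t)
        (\<lambda>ys. indicator ?L ys * gf ((block_incr a n m i ys)(i := wpos a n t - wpos a n s))))"
    by (intro Bochner_Integration.integral_cong refl integral_cong_AE AE_pmfI) (auto simp: F'_def dest!: chain_path_nth_0)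
  finally show ?thesis unfolding e by (simp add: r_def m'_def)
qed

lemma cont_conv_bound:
  assumes "cont_conv gn g" "\<And>n x. \<bar>gn n x\<bar> \<le> B" shows "\<bar>g x\<bar> \<le> B"
proof -
  have "(\<lambda>n. gn n x) \<longlonglongrightarrow> g x" using assms(1) by (auto simp: cont_conv_def)
  then have "(\<lambda>n. \<bar>gn n x\<bar>) \<longlonglongrightarrow> \<bar>g x\<bar>" by (rule tendsto_rabs)
  then show ?thesis by (rule LIMSEQ_le_const2) (use assms(2) in blast)
qed

text \<open>Induction on the number of blocks still ahead of the reversed chain. After the first
  block its increment converges in law, while given the end state the rest converges by induction to
  a limit depending on that increment alone. Almost sure representations turn this into dominated
  convergence. The indicator of ending at (1, 1) contributes just the factor
  \<open>h\<close>.\<close>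

lemma fdd_blocks:
  assumes a: "a > 1"
    and h: "\<And>e. e > 0 \<Longrightarrow> \<exists>N. \<forall>i\<ge>N. \<forall>j\<ge>N. \<bar>hit a (i, j) - h\<bar> < e"
    and "1 \<le> i" "i \<le> 2 ^ m"
    and "\<And>n. level (s n) = gridpt n m i"
    and "\<forall>\<^sub>F n in sequentially. (imbalance (s n))\<^sup>2 \<le> R * real n"
    and "\<And>n x. \<bar>gn n x\<bar> \<le> B" "continuous_on UNIV g" "cont_conv gn g"
  shows "(\<lambda>n. measure_pmf.expectation (chain_path (down_step a) (gridpt n m i - 2) (s n))
      (\<lambda>xs. indicator {xs. last xs = (1, 1)} xs * gn n (block_incr a n m i xs)))
    \<longlonglongrightarrow> h * (\<integral>x. g (zero_ext {1..<i} x) \<partial>gauss_blocks a m {1..<i})"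
  using assms(3-)
proof (induction i arbitrary: s R gn g rule: nat_induct_at_least)
  case base
  \<comment> \<open>With no block left only the conditioning survives, with probability tending to
    \<open>h\<close>.\<close>
  have b: "block_incr a n m 1 xs = (\<lambda>l. 0)" for n xs by (auto simp: block_incr_def)
  have "(\<lambda>n. hit a (s n) * gn n (\<lambda>l. 0)) \<longlonglongrightarrow> h * g (\<lambda>l. 0)"
  proof (intro tendsto_mult)
    show "(\<lambda>n. hit a (s n)) \<longlonglongrightarrow> h" by (rule hit_tendsto[OF h _ base(2,3)]) auto
    show "(\<lambda>n. gn n (\<lambda>l. 0)) \<longlonglongrightarrow> g (\<lambda>l. 0)" using base(6) by (simp add: cont_conv_def)
  qed
  moreover have "measure_pmf.expectation (chain_path (down_step a) (gridpt n m 1 - 2) (s n))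
      (\<lambda>xs. indicator {xs. last xs = (1, 1)} xs * gn n (block_incr a n m 1 xs)) = hit a (s n) * gn n (\<lambda>l. 0)" for n
    unfolding b prob_last_eq_hit[symmetric] base(2) by simp
  moreover have "(\<integral>x. g (zero_ext {1..<1} x) \<partial>gauss_blocks a m {1..<1}) = g (\<lambda>l. 0)"
  proof -
    interpret prob_space "gauss_blocks a m {1..<1}"
      by (intro prob_space_PiM prob_space_centered_normal bvar_nonneg a)
    have "zero_ext {1..<1} = (\<lambda>x l. 0)" by (auto simp: zero_ext_def fun_eq_iff)
    then show ?thesis using prob_space by simp
  qed
  ultimately show ?case by simp
next
  case (Suc i)
  note lev = Suc.prems(2) and imb = Suc.prems(3) and gB = Suc.prems(4) and gc = Suc.prems(5) and cc = Suc.prems(6)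
  have i: "i \<ge> 1" "Suc i \<le> 2 ^ m" using Suc by auto
  let ?K = "\<lambda>n. gridpt n m i" and ?K' = "\<lambda>n. gridpt n m (Suc i)"
  let ?L = "{xs. last xs = (1 :: nat, 1 :: nat)}"
  define p where "p n = chain_state (down_step a) (?K' n - ?K n) (s n)" for n
  define f where "f n t = wpos a n t - wpos a n (s n)" for n t
  define H where "H n t y = measure_pmf.expectation (chain_path (down_step a) (?K n - 2) t)
     (\<lambda>ys. indicator ?L ys * gn n ((block_incr a n m i ys)(i := y)))" for n t y
  define Z where "Z n = f n ` set_pmf (p n)" for n
  \<comment> \<open>On the support of \<open>p n\<close> the level is fixed, so the increment
    determines the end state. Choosing that state makes the conditional expectation a function
    \<open>\<psi>\<close> of the real increment, as required for a change of probability
    space.\<close>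
  define \<sigma> where "\<sigma> n y = (SOME t. t \<in> set_pmf (p n) \<and> f n t = y)" for n y
  define \<psi> where "\<psi> n y = (if y \<in> Z n then H n (\<sigma> n y) y else 0)" for n y
  define \<mu> where "\<mu> n = distr (measure_pmf (p n)) borel (f n)" for n
  define \<Phi> where "\<Phi> y = (\<integral>x. g ((zero_ext {1..<i} x)(i := y)) \<partial>gauss_blocks a m {1..<i})" for y
  have B0: "B \<ge> 0" using gB[of 0 undefined] by linarith
  have gb: "\<bar>g x\<bar> \<le> B" for x by (rule cont_conv_bound[OF cc gB])
  have gm: "g \<in> borel_measurable borel" using gc by (rule borel_measurable_continuous_onI)
  have finp: "finite (set_pmf (p n))" for n by (simp add: p_def)
  have finZ: "finite (Z n)" for n by (simp add: Z_def finp)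
  have lp: "level t = ?K n" if "t \<in> set_pmf (p n)" for t n
  proof -
    have "level t = level (s n) - (?K' n - ?K n)"
      using that unfolding p_def by (rule down_state_level) (simp add: lev)
    then show ?thesis using gridpt_mono[of i "Suc i" n m] by (simp add: lev)
  qed
  have \<sigma>: "\<sigma> n y \<in> set_pmf (p n)" "f n (\<sigma> n y) = y" if "y \<in> Z n" for n y
  proof -
    have "\<exists>t. t \<in> set_pmf (p n) \<and> f n t = y" using that by (auto simp: Z_def)
    from someI_ex[OF this] show "\<sigma> n y \<in> set_pmf (p n)" "f n (\<sigma> n y) = y" by (auto simp: \<sigma>_def)
  qed
  have HB: "\<bar>H n t y\<bar> \<le> B" for n t y
  proof -
    have "\<bar>H n t y\<bar> \<le> measure_pmf.expectation (chain_path (down_step a) (?K n - 2) t)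
       (\<lambda>ys. \<bar>indicator ?L ys * gn n ((block_incr a n m i ys)(i := y))\<bar>)"
      unfolding H_def by (rule integral_abs_bound)
    also have "\<dots> \<le> measure_pmf.expectation (chain_path (down_step a) (?K n - 2) t) (\<lambda>_. B)"
      using gB B0 by (intro expectation_mono_finite) (auto simp: abs_mult indicator_def)
    finally show ?thesis by simp
  qed
  have \<psi>B: "\<bar>\<psi> n y\<bar> \<le> B" for n y using HB B0 by (simp add: \<psi>_def)
  have \<psi>m: "\<psi> n \<in> borel_measurable borel" for n
    by (rule borel_measurable_finite_support[OF finZ[of n]]) (simp add: \<psi>_def)
  have eqE: "measure_pmf.expectation (chain_path (down_step a) (?K' n - 2) (s n))
      (\<lambda>xs. indicator ?L xs * gn n (block_incr a n m (Suc i) xs)) = (\<integral>y. \<psi> n y \<partial>\<mu> n)" if n: "2 ^ m \<le> n" for n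
  proof -
    have K2: "?K n \<ge> 2" using gridpt_ge_2[OF i(1) n] .
    have n0: "n > 0" using n by (metis less_le_trans zero_less_numeral zero_less_power)
    have "measure_pmf.expectation (chain_path (down_step a) (?K' n - 2) (s n))
      (\<lambda>xs. indicator ?L xs * gn n (block_incr a n m (Suc i) xs)) = measure_pmf.expectation (p n) (\<lambda>t. H n t (f n t))"
      unfolding fdd_first_block[OF i(1) K2 lev] p_def H_def f_def ..
    also have "\<dots> = measure_pmf.expectation (p n) (\<lambda>t. \<psi> n (f n t))"
    proof (intro integral_cong_AE AE_pmfI)
      fix t assume t: "t \<in> set_pmf (p n)"
      then have z: "f n t \<in> Z n" by (simp add: Z_def)
      have "wpos a n (\<sigma> n (f n t)) = wpos a n t" using \<sigma>(2)[OF z] by (simp add: f_def)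
      moreover have "wscale a n (?K n) > 0" using wscale_pos[OF a n0, of "?K n"] K2 by simp
      ultimately have "\<sigma> n (f n t) = t"
        using lp[OF t] lp[OF \<sigma>(1)[OF z]] by (intro state_eqI) (auto simp: wpos_def)
      then show "H n t (f n t) = \<psi> n (f n t)" using z by (simp add: \<psi>_def)
    qed auto
    also have "\<dots> = (\<integral>y. \<psi> n y \<partial>\<mu> n)"
      unfolding \<mu>_def by (rule integral_distr[symmetric]) (auto intro: \<psi>m)
    finally show ?thesis .
  qed
  have rd: "real_distribution (\<mu> n)" for n
    unfolding \<mu>_def by (rule prob_space.real_distribution_distr) (auto intro: measure_pmf.prob_space_axioms)
  have rdN: "real_distribution (centered_normal (bvar a m i))"
    by (intro real_distribution_centered_normal bvar_nonneg a)
  have wc: "weak_conv_m \<mu> (centered_normal (bvar a m i))"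
    using block_weak_conv[OF a i lev imb] unfolding \<mu>_def p_def f_def .
  \<comment> \<open>Skorohod representation of the convergence of the first increment.\<close>
  obtain \<Omega> :: "real measure" and Yn Y where
    prob: "prob_space \<Omega>" and Yn [measurable]: "\<And>n. Yn n \<in> borel_measurable \<Omega>"
    and dYn: "\<And>n. distr \<Omega> borel (Yn n) = \<mu> n" and Y': "Y \<in> measurable \<Omega> lborel"
    and dY: "distr \<Omega> borel Y = centered_normal (bvar a m i)"
    and conv: "\<And>\<omega>. \<omega> \<in> space \<Omega> \<Longrightarrow> (\<lambda>n. Yn n \<omega>) \<longlonglongrightarrow> Y \<omega>"
    using Skorohod[OF rd rdN wc] by blast
  interpret \<Omega>: prob_space \<Omega> by (rule prob)
  have Y [measurable]: "Y \<in> borel_measurable \<Omega>" using Y' by simp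
  \<comment> \<open>The representing variables keep the discrete laws, so almost surely each takes
    values attainable by the chain.\<close>
  have ae: "AE \<omega> in \<Omega>. \<forall>n. Yn n \<omega> \<in> Z n"
  proof (subst AE_all_countable, rule allI)
    fix n
    have sZ: "{y \<in> space borel. y \<in> Z n} \<in> sets borel" using finZ[of n] by (simp add: borel_closed finite_imp_closed)
    have "AE y in \<mu> n. y \<in> Z n"
      unfolding \<mu>_def by (subst AE_distr_iff) (use sZ in \<open>auto intro!: AE_pmfI simp: Z_def\<close>)
    then have "AE y in distr \<Omega> borel (Yn n). y \<in> Z n" unfolding dYn .
    then show "AE \<omega> in \<Omega>. Yn n \<omega> \<in> Z n"
      by (subst (asm) AE_distr_iff) (use sZ in auto)
  qed
  have \<Phi>m: "\<Phi> \<in> borel_measurable borel"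
    unfolding \<Phi>_def by (rule gauss_blocks_insert(2)[OF a _ _ gm gb]) auto
  define c where "c = sqrt ((2 * a - 1) / 2)"
  have c: "c > 0" using a by (simp add: c_def)
  have lim: "(\<lambda>n. \<psi> n (Yn n \<omega>)) \<longlonglongrightarrow> h * \<Phi> (Y \<omega>)" if w: "\<omega> \<in> space \<Omega>" and wZ: "\<And>n. Yn n \<omega> \<in> Z n" for \<omega>
  proof -
    define t where "t n = \<sigma> n (Yn n \<omega>)" for n
    have tp: "t n \<in> set_pmf (p n)" "f n (t n) = Yn n \<omega>" for n using \<sigma>[OF wZ[of n]] by (auto simp: t_def)
    have tl: "level (t n) = ?K n" for n using lp[OF tp(1)] .
    have "Bseq (\<lambda>n. Yn n \<omega>)" using conv[OF w] by (intro convergent_imp_Bseq convergentI)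
    then obtain b where b: "b > 0" "\<And>n. \<bar>Yn n \<omega>\<bar> \<le> b" by (auto simp: Bseq_def)
    define \<eta> where "\<eta> = real (Suc i) / 2 ^ m"
    have \<eta>: "\<eta> > 0" by (simp add: \<eta>_def)
    obtain C where C: "C > 0" and
      sc: "\<And>n k. n \<ge> 1 \<Longrightarrow> \<eta> * real n \<le> real k \<Longrightarrow> 0 \<le> wscale a n k \<and> wscale a n k \<le> C / sqrt n"
      by (rule scale_estimates[OF a \<eta>]) (rule that, assumption+)
    \<comment> \<open>Bound for the rescaled position after the block: rescaled starting position
      plus increment.\<close>
    define W where "W = sqrt (max R 0) * C + b"
    have "\<forall>\<^sub>F n in sequentially. (imbalance (t n))\<^sup>2 \<le> (W / c)\<^sup>2 * real n"
      using imb eventually_ge_2_power[of m] eventually_ge_at_top[of 1]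
    proof eventually_elim
      case (elim n)
      have "(imbalance (s n))\<^sup>2 \<le> max R 0 * real n" using elim(1) by (rule order_trans) (intro mult_right_mono; simp)
      then have im: "\<bar>imbalance (s n)\<bar> \<le> sqrt (max R 0) * sqrt (real n)"
        unfolding real_sqrt_mult[symmetric] by (intro real_le_rsqrt) simp
      have wsc: "0 \<le> wscale a n (?K' n)" "wscale a n (?K' n) \<le> C / sqrt n"
        using sc[OF elim(3), of "?K' n"] gridpt_ge_linear[of "Suc i" m n] elim(2) by (auto simp: \<eta>_def)
      have "\<bar>wpos a n (s n)\<bar> = \<bar>imbalance (s n)\<bar> * wscale a n (?K' n)" using wsc by (simp add: wpos_def lev abs_mult)
      also have "\<dots> \<le> (sqrt (max R 0) * sqrt (real n)) * (C / sqrt n)" using im wsc by (intro mult_mono) auto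
      also have "\<dots> = sqrt (max R 0) * C" using elim(3) by simp
      finally have wW: "\<bar>wpos a n (t n)\<bar> \<le> W" using tp(2)[of n] b(2)[of n] by (simp add: f_def W_def)
      have "\<bar>imbalance (t n)\<bar> \<le> \<bar>wpos a n (t n)\<bar> * sqrt n / c"
        unfolding c_def using gridpt_le[of i m n] i by (intro imbalance_le_wpos[OF a]) (simp add: tl)
      also have "\<dots> \<le> W * sqrt n / c" using wW c by (intro divide_right_mono mult_right_mono) auto
      finally have "\<bar>imbalance (t n)\<bar> \<le> W * sqrt n / c" .
      then have "\<bar>imbalance (t n)\<bar>\<^sup>2 \<le> (W * sqrt n / c)\<^sup>2" by (intro power_mono) auto
      then show ?case by (simp add: power_mult_distrib power_divide)
    qed
    note tim = this
    let ?gn = "\<lambda>n x. gn n (x(i := Yn n \<omega>))" and ?g = "\<lambda>x. g (x(i := Y \<omega>))"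
    have "(\<lambda>n. measure_pmf.expectation (chain_path (down_step a) (?K n - 2) (t n))
      (\<lambda>xs. indicator ?L xs * ?gn n (block_incr a n m i xs))) \<longlonglongrightarrow> h * (\<integral>x. ?g (zero_ext {1..<i} x) \<partial>gauss_blocks a m {1..<i})"
    proof (rule Suc.IH[OF _ tl tim])
      show "i \<le> 2 ^ m" using i by simp
      show "\<bar>?gn n x\<bar> \<le> B" for n x by (rule gB)
      show "continuous_on UNIV ?g"
      proof (rule continuous_on_compose2[OF gc])
        show "continuous_on UNIV (\<lambda>x :: nat \<Rightarrow> real. x(i := Y \<omega>))"
        proof (rule continuous_on_coordinatewise_then_product)
          fix l show "continuous_on UNIV (\<lambda>x :: nat \<Rightarrow> real. (x(i := Y \<omega>)) l)"
            by (cases "l = i") (auto intro: continuous_on_product_coordinates)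
        qed
      qed auto
      show "cont_conv ?gn ?g" unfolding cont_conv_def
      proof (intro allI impI)
        fix X :: "nat \<Rightarrow> nat \<Rightarrow> real" and x assume X: "\<forall>l. (\<lambda>n. X n l) \<longlonglongrightarrow> x l"
        have "(\<lambda>n. ((X n)(i := Yn n \<omega>)) l) \<longlonglongrightarrow> (x(i := Y \<omega>)) l" for l
          using X conv[OF w] by (cases "l = i") auto
        then show "(\<lambda>n. gn n ((X n)(i := Yn n \<omega>))) \<longlonglongrightarrow> g (x(i := Y \<omega>))"
          using cc[unfolded cont_conv_def, rule_format, of "\<lambda>n. (X n)(i := Yn n \<omega>)" "x(i := Y \<omega>)"] by simp
      qed
    qed
    moreover have "\<psi> n (Yn n \<omega>) = measure_pmf.expectation (chain_path (down_step a) (?K n - 2) (t n))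
      (\<lambda>xs. indicator ?L xs * ?gn n (block_incr a n m i xs))" for n
      using wZ[of n] by (simp add: \<psi>_def H_def t_def)
    ultimately show ?thesis by (simp add: \<Phi>_def)
  qed
  have "(\<lambda>n. \<integral>\<omega>. \<psi> n (Yn n \<omega>) \<partial>\<Omega>) \<longlonglongrightarrow> (\<integral>\<omega>. h * \<Phi> (Y \<omega>) \<partial>\<Omega>)"
  proof (rule integral_dominated_convergence[where w="\<lambda>_. B"])
    show "(\<lambda>\<omega>. h * \<Phi> (Y \<omega>)) \<in> borel_measurable \<Omega>"
      using measurable_compose[OF Y \<Phi>m] by simp
    show "(\<lambda>\<omega>. \<psi> n (Yn n \<omega>)) \<in> borel_measurable \<Omega>" for n
      using measurable_compose[OF Yn \<psi>m] .
    show "AE \<omega> in \<Omega>. (\<lambda>n. \<psi> n (Yn n \<omega>)) \<longlonglongrightarrow> h * \<Phi> (Y \<omega>)"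
      using ae AE_space by eventually_elim (rule lim, auto)
  qed (use \<psi>B in auto)
  moreover have "(\<integral>\<omega>. \<psi> n (Yn n \<omega>) \<partial>\<Omega>) = (\<integral>y. \<psi> n y \<partial>\<mu> n)" for n
    unfolding dYn[symmetric] by (rule integral_distr[symmetric]) (auto intro: \<psi>m)
  moreover have "(\<integral>\<omega>. h * \<Phi> (Y \<omega>) \<partial>\<Omega>) = h * (\<integral>x. g (zero_ext {1..<Suc i} x) \<partial>gauss_blocks a m {1..<Suc i})"
  proof -
    have "(\<integral>\<omega>. \<Phi> (Y \<omega>) \<partial>\<Omega>) = (\<integral>y. \<Phi> y \<partial>centered_normal (bvar a m i))"
      unfolding dY[symmetric] by (rule integral_distr[symmetric]) (auto intro: \<Phi>m)
    also have "\<dots> = (\<integral>x. g (zero_ext (insert i {1..<i}) x) \<partial>gauss_blocks a m (insert i {1..<i}))"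
      unfolding \<Phi>_def by (rule gauss_blocks_insert(1)[OF a _ _ gm gb, symmetric]) auto
    also have "insert i {1..<i} = {1..<Suc i}" using i by auto
    finally show ?thesis by simp
  qed
  ultimately have "(\<lambda>n. \<integral>y. \<psi> n y \<partial>\<mu> n) \<longlonglongrightarrow> h * (\<integral>x. g (zero_ext {1..<Suc i} x) \<partial>gauss_blocks a m {1..<Suc i})" by (simp only:)
  moreover have "\<forall>\<^sub>F n in sequentially. (\<integral>y. \<psi> n y \<partial>\<mu> n) = measure_pmf.expectation (chain_path (down_step a) (?K' n - 2) (s n))
      (\<lambda>xs. indicator ?L xs * gn n (block_incr a n m (Suc i) xs))"
    using eventually_ge_2_power[of m] by eventually_elim (rule eqE[symmetric])
  ultimately show ?case by (rule Lim_transform_eventually)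
qed

section \<open>Modulus of continuity\<close>

lemma prob_mono_support:
  assumes "\<And>x. x \<in> set_pmf p \<Longrightarrow> x \<in> A \<Longrightarrow> x \<in> B"
  shows "measure_pmf.prob p A \<le> measure_pmf.prob p B"
  by (rule measure_pmf.finite_measure_mono_AE) (auto intro!: AE_pmfI assms)

lemma prob_drop_chain_path:
  assumes "\<And>s. finite (set_pmf (K s))" "r \<le> m"
  shows "measure_pmf.prob (chain_path K m s) {ys. drop r ys \<in> E} =
    measure_pmf.expectation (chain_state K r s) (\<lambda>t. measure_pmf.prob (chain_path K (m - r) t) E)"
proof -
  have "measure_pmf.prob (chain_path K m s) {ys. drop r ys \<in> E} =
      measure_pmf.prob (map_pmf (drop r) (chain_path K (r + (m - r)) s)) E"
    using assms by (simp add: measure_map_pmf vimage_def)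
  then show ?thesis unfolding map_drop_chain_path
    by (simp add: prob_bind_finite finite_chain_path finite_chain_state assms)
qed

lemma chain_path_nth_state:
  assumes "zs \<in> set_pmf (chain_path K m t)" "j \<le> m"
  shows "zs ! j \<in> set_pmf (chain_state K j t)"
proof -
  have "zs ! j \<in> set_pmf (map_pmf (\<lambda>xs. xs ! j) (chain_path K m t))" using assms(1) by auto
  then show ?thesis by (simp only: map_nth_chain_path[OF assms(2)])
qed

text \<open>Restarting at level \<open>K\<close>, where the second moment is at most
  \<open>K\<close>, the maximal inequality for D^2 + k yields the factor 2K. The bound is linear in
  \<open>K\<close>, so it is small for levels below a small multiple of n.\<close>

lemma near_zero_bound:
  assumes a: "a > 1" and K: "2 \<le> K" "K \<le> 2 * n" and l: "l > 0"
  shows "measure_pmf.prob (chain_path (down_step a) (2 * n - 2) (n, n))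
    {ys. \<exists>k\<in>{2..K}. l \<le> (imbalance (ys ! (2 * n - k)))\<^sup>2} \<le> 2 * real K / l"
proof -
  define r where "r = 2 * n - K"
  have r: "r \<le> 2 * n - 2" "2 * n - 2 - r = K - 2" using K by (auto simp: r_def)
  let ?V = "\<lambda>s. (imbalance s)\<^sup>2 + real (level s)"
  let ?E = "{zs. \<exists>j\<le>K - 2. l \<le> ?V (zs ! j) \<and> (\<forall>i<j. zs ! i \<in> UNIV)}"
  have super: "measure_pmf.expectation (down_step a s) ?V \<le> ?V s" for s
  proof (cases "level s \<ge> 1")
    case True
    then show ?thesis by (rule square_plus_level_superharmonic[OF a])
  next
    case False
    then have "s = (0, 0)" by (cases s) (auto simp: level_def)
    moreover have "down_step a (0, 0) = map_pmf (\<lambda>_. (0, 0)) (bernoulli_pmf (urn_prob a (0, 0)))"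
      unfolding down_step_def by (intro map_pmf_cong) auto
    ultimately show ?thesis by (simp add: imbalance_def level_def)
  qed
  have "measure_pmf.prob (chain_path (down_step a) (2 * n - 2) (n, n)) {ys. \<exists>k\<in>{2..K}. l \<le> (imbalance (ys ! (2 * n - k)))\<^sup>2}
    \<le> measure_pmf.prob (chain_path (down_step a) (2 * n - 2) (n, n)) {ys. drop r ys \<in> ?E}"
  proof (rule prob_mono_support)
    fix ys assume ys: "ys \<in> set_pmf (chain_path (down_step a) (2 * n - 2) (n, n))"
      and "ys \<in> {ys. \<exists>k\<in>{2..K}. l \<le> (imbalance (ys ! (2 * n - k)))\<^sup>2}"
    then obtain k where k: "2 \<le> k" "k \<le> K" "l \<le> (imbalance (ys ! (2 * n - k)))\<^sup>2" by auto
    have "length ys = Suc (2 * n - 2)" using chain_path_hd_length[OF ys] by simp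
    then have "drop r ys ! (K - k) = ys ! (2 * n - k)" using r k K by (simp add: r_def)
    then have "l \<le> ?V (drop r ys ! (K - k))" using k(3) by simp
    then show "ys \<in> {ys. drop r ys \<in> ?E}" using k by (auto intro!: exI[of _ "K - k"])
  qed
  also have "\<dots> = measure_pmf.expectation (chain_state (down_step a) r (n, n)) (\<lambda>t. measure_pmf.prob (chain_path (down_step a) (K - 2) t) ?E)"
    using prob_drop_chain_path[of "down_step a" r "2 * n - 2" "(n, n)" ?E] r by simp
  also have "\<dots> \<le> measure_pmf.expectation (chain_state (down_step a) r (n, n)) (\<lambda>t. ?V t / l)"
  proof (rule expectation_mono_finite)
    fix t
    show "measure_pmf.prob (chain_path (down_step a) (K - 2) t) ?E \<le> ?V t / l"
      by (rule chain_maximal_ineq) (use l super in auto)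
  qed simp
  also have "\<dots> = measure_pmf.expectation (chain_state (down_step a) r (n, n)) (\<lambda>t. ((imbalance t)\<^sup>2 + real K) / l)"
  proof (intro integral_cong_AE AE_pmfI)
    fix t assume "t \<in> set_pmf (chain_state (down_step a) r (n, n))"
    then have "level t = K" using down_state_level[of t a r "(n, n)"] K by (simp add: level_def r_def)
    then show "?V t / l = ((imbalance t)\<^sup>2 + real K) / l" by simp
  qed auto
  also have "\<dots> = (measure_pmf.expectation (chain_state (down_step a) r (n, n)) (\<lambda>t. (imbalance t)\<^sup>2) + real K) / l"
    by (simp add: integrable_measure_pmf_finite)
  also have "\<dots> \<le> (real K + real K) / l"
    using second_moment_balanced[OF a r(1)] K l by (intro divide_right_mono add_right_mono) (auto simp: r_def of_nat_diff)
  finally show ?thesis by simp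
qed

section \<open>Exponential bounds on short windows\<close>

lemma exp_le_quadratic:
  fixes x :: real assumes "\<bar>x\<bar> \<le> 1" shows "exp x \<le> 1 + x + x\<^sup>2"
proof (cases "x \<ge> 0")
  case True
  then show ?thesis using assms exp_bound[of x] by simp
next
  case False
  have "\<bar>exp (- (- x)) - 1 + (- x)\<bar> \<le> (- x)\<^sup>2 / 2" using False by (intro exp_minus_quadratic) auto
  then have "\<bar>exp x - 1 - x\<bar> \<le> x\<^sup>2 / 2" by simp
  moreover have "0 \<le> x\<^sup>2" by simp
  ultimately show ?thesis by linarith
qed

text \<open>While |D| <= R and the level is at least M, the drift is at most C1 R / M. Then exp
  (\<open>\<theta>\<close> D) grows per step by at most exp \<open>\<gamma>\<close>, and the term in
  the level compensates this growth.\<close>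

lemma window_bound_one_sided:
  assumes a: "a > 1" and C1: "\<And>s. level s \<ge> 1 \<Longrightarrow> \<bar>drift a s\<bar> \<le> C1 * \<bar>imbalance s / level s\<bar>" "C1 > 0"
    and lt: "L < level t" "M \<le> real (level t - L)" "M > 0" and R: "R \<ge> 0" and \<theta>: "\<bar>\<theta>\<bar> \<le> 1" and Lm: "L \<le> m"
  defines "\<gamma> \<equiv> \<bar>\<theta>\<bar> * (C1 * R / M) + \<theta>\<^sup>2"
  shows "measure_pmf.prob (chain_path (down_step a) m t)
    {zs. \<exists>j\<le>L. q \<le> \<theta> * (imbalance (zs ! j) - imbalance t) \<and> (\<forall>i<j. \<bar>imbalance (zs ! i)\<bar> \<le> R)} \<le> exp (- q + \<gamma> * real L)"
proof -
  have \<gamma>: "\<gamma> \<ge> 0" unfolding \<gamma>_def using C1 R lt by (intro add_nonneg_nonneg mult_nonneg_nonneg divide_nonneg_nonneg) auto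
  let ?V = "\<lambda>s. exp (\<theta> * (imbalance s - imbalance t) + \<gamma> * (real (level s) - real (level t)))"
  \<comment> \<open>The level condition describes the states before step \<open>L\<close>, where
    \<open>M\<close> bounds the level from below.\<close>
  let ?A = "{s. level t - L < level s \<and> \<bar>imbalance s\<bar> \<le> R}"
  define l where "l = exp (q - \<gamma> * real L)"
  have super: "measure_pmf.expectation (down_step a s) ?V \<le> ?V s" if "s \<in> ?A" for s
  proof -
    have ls: "level s \<ge> 1" "M \<le> real (level s)" "\<bar>imbalance s\<bar> \<le> R" using that lt by auto
    have b: "\<bar>drift a s\<bar> \<le> C1 * R / M"
    proof -
      have "\<bar>imbalance s / level s\<bar> \<le> R / M"
        unfolding abs_divide using ls lt by (intro frac_le) auto
      then have "C1 * \<bar>imbalance s / level s\<bar> \<le> C1 * (R / M)" using C1 by (intro mult_left_mono) auto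
      then show ?thesis using C1(1)[OF ls(1)] by simp
    qed
    define b where "b = drift a s"
    define W where "W = ?V s * exp (- \<gamma>)"
    have W: "W > 0" by (simp add: W_def)
    have b1: "\<bar>b\<bar> \<le> 1" by (simp add: b_def abs_drift_le_1)
    have "measure_pmf.expectation (down_step a s) ?V =
       (1 + b) / 2 * (W * exp (- \<theta>)) + (1 - b) / 2 * (W * exp \<theta>)"
      using expectation_down_step[OF ls(1), where a=a and \<psi>="\<lambda>d k. exp (\<theta> * (d - imbalance t) + \<gamma> * (real k - real (level t)))"] ls
      by (simp add: b_def W_def of_nat_diff algebra_simps flip: exp_add)
    also have "\<dots> \<le> (1 + b) / 2 * (W * (1 + (- \<theta>) + (- \<theta>)\<^sup>2)) + (1 - b) / 2 * (W * (1 + \<theta> + \<theta>\<^sup>2))"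
      using exp_le_quadratic[of \<theta>] exp_le_quadratic[of "- \<theta>"] \<theta> W b1 by (intro add_mono mult_left_mono) auto
    also have "\<dots> = W * (1 - b * \<theta> + \<theta>\<^sup>2)" by (simp add: field_simps)
    also have "\<dots> \<le> W * (1 + \<gamma>)"
    proof -
      have "\<bar>b * \<theta>\<bar> \<le> \<bar>\<theta>\<bar> * (C1 * R / M)" unfolding abs_mult mult.commute[of "\<bar>b\<bar>"] using b by (intro mult_left_mono) (auto simp: b_def)
      then have "1 - b * \<theta> + \<theta>\<^sup>2 \<le> 1 + \<gamma>" unfolding \<gamma>_def by linarith
      then show ?thesis using W by (intro mult_left_mono) auto
    qed
    also have "\<dots> \<le> W * exp \<gamma>" using W by (intro mult_left_mono) (auto simp: exp_ge_add_one_self)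
    also have "\<dots> = ?V s" by (simp add: W_def mult.assoc flip: exp_add)
    finally show ?thesis .
  qed
  have "measure_pmf.prob (chain_path (down_step a) m t)
    {zs. \<exists>j\<le>L. q \<le> \<theta> * (imbalance (zs ! j) - imbalance t) \<and> (\<forall>i<j. \<bar>imbalance (zs ! i)\<bar> \<le> R)}
   \<le> measure_pmf.prob (chain_path (down_step a) m t) {xs. \<exists>j\<le>m. l \<le> ?V (xs ! j) \<and> (\<forall>i<j. xs ! i \<in> ?A)}"
  proof (rule prob_mono_support)
    fix zs assume zs: "zs \<in> set_pmf (chain_path (down_step a) m t)"
      and "zs \<in> {zs. \<exists>j\<le>L. q \<le> \<theta> * (imbalance (zs ! j) - imbalance t) \<and> (\<forall>i<j. \<bar>imbalance (zs ! i)\<bar> \<le> R)}"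
    then obtain j where j: "j \<le> L" "q \<le> \<theta> * (imbalance (zs ! j) - imbalance t)" "\<forall>i<j. \<bar>imbalance (zs ! i)\<bar> \<le> R" by auto
    have lev: "level (zs ! i) = level t - i" if "i \<le> L" for i
      by (rule down_state_level[OF chain_path_nth_state[OF zs]]) (use that lt Lm in auto)
    have "real (level (zs ! j)) - real (level t) = - real j" using lev[OF j(1)] j lt by (simp add: of_nat_diff)
    moreover have "\<gamma> * real j \<le> \<gamma> * real L" using j \<gamma> by (intro mult_left_mono) auto
    ultimately have "l \<le> ?V (zs ! j)" using j(2) by (simp add: l_def)
    moreover have "zs ! i \<in> ?A" if "i < j" for i using j that lev[of i] lt by auto
    ultimately show "zs \<in> {xs. \<exists>j\<le>m. l \<le> ?V (xs ! j) \<and> (\<forall>i<j. xs ! i \<in> ?A)}"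
      using j(1) Lm by (intro CollectI exI[of _ j] conjI allI impI) auto
  qed
  also have "\<dots> \<le> ?V t / l"
    by (rule chain_maximal_ineq) (use super in \<open>auto simp: l_def\<close>)
  also have "\<dots> = exp (- q + \<gamma> * real L)" by (simp add: l_def exp_diff[symmetric] exp_minus[symmetric] inverse_eq_divide[symmetric])
  finally show ?thesis .
qed

lemma window_bound:
  assumes a: "a > 1" and C1: "\<And>s. level s \<ge> 1 \<Longrightarrow> \<bar>drift a s\<bar> \<le> C1 * \<bar>imbalance s / level s\<bar>" "C1 > 0"
    and lt: "L < level t" "M \<le> real (level t - L)" "M > 0" and R: "R \<ge> 0" and \<theta>: "0 \<le> \<theta>" "\<theta> \<le> 1" and Lm: "L \<le> m"
  shows "measure_pmf.prob (chain_path (down_step a) m t)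
    {zs. \<exists>j\<le>L. \<epsilon> < \<bar>imbalance (zs ! j) - imbalance t\<bar> \<and> (\<forall>i<j. \<bar>imbalance (zs ! i)\<bar> \<le> R)}
    \<le> 2 * exp (- \<theta> * \<epsilon> + (\<theta> * (C1 * R / M) + \<theta>\<^sup>2) * real L)"
proof -
  let ?E = "\<lambda>\<theta>'. {zs. \<exists>j\<le>L. \<theta> * \<epsilon> \<le> \<theta>' * (imbalance (zs ! j) - imbalance t) \<and> (\<forall>i<j. \<bar>imbalance (zs ! i)\<bar> \<le> R)}"
  let ?p = "measure_pmf.prob (chain_path (down_step a) m t)"
  have "?p {zs. \<exists>j\<le>L. \<epsilon> < \<bar>imbalance (zs ! j) - imbalance t\<bar> \<and> (\<forall>i<j. \<bar>imbalance (zs ! i)\<bar> \<le> R)} \<le> ?p (?E \<theta> \<union> ?E (- \<theta>))"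
  proof (rule prob_mono_support)
    fix zs assume "zs \<in> {zs. \<exists>j\<le>L. \<epsilon> < \<bar>imbalance (zs ! j) - imbalance t\<bar> \<and> (\<forall>i<j. \<bar>imbalance (zs ! i)\<bar> \<le> R)}"
    then obtain j where j: "j \<le> L" "\<epsilon> < \<bar>imbalance (zs ! j) - imbalance t\<bar>" "\<forall>i<j. \<bar>imbalance (zs ! i)\<bar> \<le> R" by auto
    define d where "d = imbalance (zs ! j) - imbalance t"
    have "\<epsilon> \<le> d \<or> \<epsilon> \<le> - d" using j(2) by (auto simp: d_def)
    then have "\<theta> * \<epsilon> \<le> \<theta> * d \<or> \<theta> * \<epsilon> \<le> \<theta> * (- d)" using \<theta>(1) mult_left_mono by blast
    then have "\<theta> * \<epsilon> \<le> \<theta> * d \<or> \<theta> * \<epsilon> \<le> - \<theta> * d" by simp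
    then show "zs \<in> ?E \<theta> \<union> ?E (- \<theta>)" using j unfolding d_def by blast
  qed
  also have "\<dots> \<le> ?p (?E \<theta>) + ?p (?E (- \<theta>))" by (rule measure_Un_le) auto
  also have "?p (?E \<theta>) \<le> exp (- (\<theta> * \<epsilon>) + (\<bar>\<theta>\<bar> * (C1 * R / M) + \<theta>\<^sup>2) * real L)"
    by (rule window_bound_one_sided[OF a C1 lt R _ Lm]) (use \<theta> in auto)
  also have "?p (?E (- \<theta>)) \<le> exp (- (\<theta> * \<epsilon>) + (\<bar>- \<theta>\<bar> * (C1 * R / M) + (- \<theta>)\<^sup>2) * real L)"
    by (rule window_bound_one_sided[OF a C1 lt R _ Lm]) (use \<theta> in auto)
  finally show ?thesis using \<theta> by simp
qed

text \<open>Three bad events of probability at most \<open>\<rho>\<close> / 3 each: the path exceeds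
  R sqrt n somewhere; it exceeds \<open>e\<close> sqrt n at low levels; it moves by more than
  \<open>e\<close> sqrt n within one of O(1 / \<open>\<delta>\<close>) windows. Off them, two close
  levels are either both low or both in one window.\<close>

lemma down_modulus:
  fixes a \<epsilon> \<rho> :: real
  assumes a: "a > 1" and \<epsilon>: "\<epsilon> > 0" and \<rho>: "\<rho> > 0"
  obtains \<delta> where "\<delta> > 0"
    "\<forall>\<^sub>F n in sequentially. measure_pmf.prob (chain_path (down_step a) (2 * n - 2) (n, n))
       {ys. \<exists>j k. 2 \<le> j \<and> j \<le> k \<and> k \<le> 2 * n \<and> real (k - j) \<le> \<delta> * real n \<and>
          \<epsilon> * sqrt n < \<bar>imbalance (ys ! (2 * n - k)) - imbalance (ys ! (2 * n - j))\<bar>} \<le> \<rho>"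
proof -
  obtain C1 where C1: "C1 > 0" and dr: "\<And>s. level s \<ge> 1 \<Longrightarrow> \<bar>drift a s\<bar> \<le> C1 * \<bar>imbalance s / level s\<bar>"
    by (rule drift_linear_approx[OF a]) (rule that, assumption+)
  define e where "e = \<epsilon> / 2"
  have e: "e > 0" using \<epsilon> by (simp add: e_def)
  \<comment> \<open>From 2 (2n) / (R^2 n) = 4 / R^2 = \<open>\<rho>\<close> / 3.\<close>
  define R where "R = sqrt (12 / \<rho>)"
  have R: "R > 0" "R\<^sup>2 = 12 / \<rho>" using \<rho> by (auto simp: R_def)
  \<comment> \<open>The first entry makes 6 \<open>\<eta>\<close> / e^2 at most
    \<open>\<rho>\<close> / 3; the second keeps the low region 3 \<open>\<eta>\<close> n within
    2n.\<close>
  define \<eta> where "\<eta> = min (\<rho> * e\<^sup>2 / 18) (2 / 3)"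
  have \<eta>: "\<eta> > 0" "\<eta> \<le> \<rho> * e\<^sup>2 / 18" "3 * \<eta> \<le> 2" using \<rho> e by (auto simp: \<eta>_def)
  define B where "B = 2 * C1 * R / \<eta>"
  \<comment> \<open>Number of windows times the bound for one window: exp (- e / sqrt
    \<open>\<delta>\<close>) beats every power of 1 / \<open>\<delta>\<close>.\<close>
  have "((\<lambda>\<delta>. (4 / \<delta> + 1) * (2 * exp (- e / sqrt \<delta> + B * sqrt \<delta> + 2))) \<longlongrightarrow> 0) (at_right 0)"
    using e by real_asymp
  then have "\<forall>\<^sub>F \<delta> in at_right 0. (4 / \<delta> + 1) * (2 * exp (- e / sqrt \<delta> + B * sqrt \<delta> + 2)) < \<rho> / 3"
    using \<rho> by (intro order_tendstoD(2)) auto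
  moreover have "\<forall>\<^sub>F \<delta> in at_right 0. \<delta> < \<eta> / 2"
    using \<eta>(1) by (intro order_tendstoD(2)[OF tendsto_ident_at]) simp
  moreover have "\<forall>\<^sub>F \<delta> in at_right 0. \<delta> > (0::real)" by (rule eventually_at_right_less)
  ultimately have "\<forall>\<^sub>F \<delta> in at_right 0. (4 / \<delta> + 1) * (2 * exp (- e / sqrt \<delta> + B * sqrt \<delta> + 2)) < \<rho> / 3 \<and> \<delta> < \<eta> / 2 \<and> \<delta> > 0"
    by eventually_elim auto
  then obtain \<delta> where \<delta>: "(4 / \<delta> + 1) * (2 * exp (- e / sqrt \<delta> + B * sqrt \<delta> + 2)) < \<rho> / 3" "\<delta> < \<eta> / 2" "\<delta> > 0"
    using eventually_happens[of _ "at_right (0::real)"] by (auto simp: trivial_limit_at_right_real)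
  show ?thesis
  proof (rule that[OF \<delta>(3)])
    have "\<forall>\<^sub>F n in sequentially. 1 \<le> \<delta> * real n" "\<forall>\<^sub>F n in sequentially. 2 \<le> \<eta> * real n"
      using \<delta>(3) \<eta>(1) by real_asymp+
    then show "\<forall>\<^sub>F n in sequentially. measure_pmf.prob (chain_path (down_step a) (2 * n - 2) (n, n))
       {ys. \<exists>j k. 2 \<le> j \<and> j \<le> k \<and> k \<le> 2 * n \<and> real (k - j) \<le> \<delta> * real n \<and>
          \<epsilon> * sqrt n < \<bar>imbalance (ys ! (2 * n - k)) - imbalance (ys ! (2 * n - j))\<bar>} \<le> \<rho>"
    proof eventually_elim
      case (elim n)
      let ?P = "chain_path (down_step a) (2 * n - 2) (n, n)"
      let ?D = "\<lambda>ys k. imbalance (ys ! (2 * n - k))"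
      have n: "n \<ge> 1" using elim by (cases n) auto
      define L where "L = nat \<lfloor>\<delta> * real n\<rfloor>"
      have Lu: "real L \<le> \<delta> * real n" using elim by (simp add: L_def)
      have Ll: "\<delta> * real n / 2 \<le> real L"
      proof -
        have 1: "1 \<le> \<lfloor>\<delta> * real n\<rfloor>" using elim by (simp add: le_floor_iff)
        then have "real L = of_int \<lfloor>\<delta> * real n\<rfloor>" by (simp add: L_def)
        moreover have "(1::real) \<le> of_int \<lfloor>\<delta> * real n\<rfloor>" using 1 by simp
        ultimately show ?thesis by linarith
      qed
      have L1: "L \<ge> 1" using elim by (simp add: L_def le_nat_iff le_floor_iff)
      \<comment> \<open>Three shares of \<open>\<eta>\<close> n: one remains below every window, one
        covers a window of length 2 L, and one absorbs the additive 2.\<close>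
      define K where "K = nat \<lfloor>3 * \<eta> * real n\<rfloor>"
      have Ku: "real K \<le> 3 * \<eta> * real n" using \<eta> by (simp add: K_def)
      have K2: "K \<ge> 2" using elim by (simp add: K_def le_nat_iff le_floor_iff)
      have Kn: "K \<le> 2 * n"
      proof -
        have "3 * \<eta> * real n \<le> 2 * real n" using \<eta> by (intro mult_right_mono) auto
        with Ku have "real K \<le> real (2 * n)" by simp
        then show ?thesis by (simp only: of_nat_le_iff)
      qed
      define Q where "Q = 2 * n div L + 1"
      have Qb: "real Q \<le> 4 / \<delta> + 1"
      proof -
        have "real (2 * n div L) \<le> real (2 * n) / real L" by (rule of_nat_div_le_of_nat)
        also have "\<dots> \<le> real (2 * n) / (\<delta> * real n / 2)" using Ll L1 \<delta>(3) n by (intro divide_left_mono mult_pos_pos) auto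
        also have "\<dots> = 4 / \<delta>" using n \<delta>(3) by (simp add: field_simps)
        finally show ?thesis by (simp add: Q_def)
      qed
      define T where "T q = min (q * L) (2 * n)" for q
      define W1 where "W1 = {ys. \<exists>k\<in>{2..2 * n}. R\<^sup>2 * real n \<le> (?D ys k)\<^sup>2}"
      define W2 where "W2 = {ys. \<exists>k\<in>{2..K}. e\<^sup>2 * real n \<le> (?D ys k)\<^sup>2}"
      define Ev where "Ev = {zs. \<exists>j\<le>2 * L. e * sqrt n < \<bar>imbalance (zs ! j) - imbalance (zs ! 0)\<bar> \<and> (\<forall>i<j. \<bar>imbalance (zs ! i)\<bar> \<le> R * sqrt n)}"
      define W3 where "W3 q = {ys. drop (2 * n - T q) ys \<in> Ev}" for q
      define I where "I = {q \<in> {1..Q}. 2 * L + 2 \<le> T q \<and> \<eta> * real n \<le> real (T q - 2 * L)}"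
      have P1: "measure_pmf.prob ?P W1 \<le> \<rho> / 3"
      proof -
        have "measure_pmf.prob ?P W1 \<le> 2 * real (2 * n) / (R\<^sup>2 * real n)"
          unfolding W1_def using n R \<rho> by (intro near_zero_bound[OF a]) auto
        also have "\<dots> = \<rho> / 3" using n \<rho> by (simp add: R(2))
        finally show ?thesis .
      qed
      have P2: "measure_pmf.prob ?P W2 \<le> \<rho> / 3"
      proof -
        have "measure_pmf.prob ?P W2 \<le> 2 * real K / (e\<^sup>2 * real n)"
          unfolding W2_def using n e K2 Kn by (intro near_zero_bound[OF a]) auto
        also have "\<dots> \<le> 2 * (3 * \<eta> * real n) / (e\<^sup>2 * real n)" using Ku e n by (intro divide_right_mono) auto
        also have "\<dots> = 6 * \<eta> / e\<^sup>2" using n by simp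
        also have "\<dots> \<le> 6 * (\<rho> * e\<^sup>2 / 18) / e\<^sup>2" using \<eta> by (intro divide_right_mono) auto
        also have "\<dots> = \<rho> / 3" using e by simp
        finally show ?thesis .
      qed
      define bd where "bd = 2 * exp (- e / sqrt \<delta> + B * sqrt \<delta> + 2)"
      have P3: "measure_pmf.prob ?P (W3 q) \<le> bd" if q: "q \<in> I" for q
      proof -
        have Tn: "T q \<le> 2 * n" and Tq: "2 * L + 2 \<le> T q" "\<eta> * real n \<le> real (T q - 2 * L)"
          using q by (auto simp: I_def T_def)
        \<comment> \<open>With this choice the quadratic term costs at most 2 over a window, while
          the threshold gains e / sqrt \<open>\<delta>\<close>.\<close>
        define \<theta> where "\<theta> = 1 / (sqrt \<delta> * sqrt n)"
        have \<theta>: "0 \<le> \<theta>" "\<theta> \<le> 1"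
          using elim(1) \<delta>(3) n by (auto simp: \<theta>_def divide_le_eq_1 simp flip: real_sqrt_mult)
        have "measure_pmf.prob ?P (W3 q) = measure_pmf.expectation (chain_state (down_step a) (2 * n - T q) (n, n))
            (\<lambda>t. measure_pmf.prob (chain_path (down_step a) (2 * n - 2 - (2 * n - T q)) t) Ev)"
          unfolding W3_def using Tq Tn by (intro prob_drop_chain_path) auto
        also have "2 * n - 2 - (2 * n - T q) = T q - 2" using Tn Tq by simp
        also have "measure_pmf.expectation (chain_state (down_step a) (2 * n - T q) (n, n))
            (\<lambda>t. measure_pmf.prob (chain_path (down_step a) (T q - 2) t) Ev) \<le>
            measure_pmf.expectation (chain_state (down_step a) (2 * n - T q) (n, n)) (\<lambda>_. bd)"
        proof (rule expectation_mono_finite)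
          fix t assume t: "t \<in> set_pmf (chain_state (down_step a) (2 * n - T q) (n, n))"
          have lt: "level t = T q" using down_state_level[OF t] Tn by (simp add: level_def)
          have "measure_pmf.prob (chain_path (down_step a) (T q - 2) t) Ev \<le>
             measure_pmf.prob (chain_path (down_step a) (T q - 2) t) {zs. \<exists>j\<le>2 * L. e * sqrt n < \<bar>imbalance (zs ! j) - imbalance t\<bar> \<and> (\<forall>i<j. \<bar>imbalance (zs ! i)\<bar> \<le> R * sqrt n)}"
            by (rule prob_mono_support) (auto simp: Ev_def dest!: chain_path_nth_0)
          also have "\<dots> \<le> 2 * exp (- \<theta> * (e * sqrt n) + (\<theta> * (C1 * (R * sqrt n) / (\<eta> * real n)) + \<theta>\<^sup>2) * real (2 * L))"
            by (rule window_bound[OF a dr C1]) (use lt Tq \<eta> n R \<theta> in auto)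
          also have "\<dots> \<le> bd"
          proof -
            have sq: "sqrt \<delta> > 0" "sqrt n > 0" "sqrt \<delta> * sqrt \<delta> = \<delta>" "sqrt n * sqrt n = real n" using \<delta>(3) n by auto
            have t1: "- \<theta> * (e * sqrt n) = - e / sqrt \<delta>" using sq by (simp add: \<theta>_def)
            have t2: "\<theta> * (C1 * (R * sqrt n) / (\<eta> * real n)) * real (2 * L) \<le> B * sqrt \<delta>"
            proof -
              have "\<theta> * (C1 * (R * sqrt n) / (\<eta> * real n)) * real (2 * L) \<le> \<theta> * (C1 * (R * sqrt n) / (\<eta> * real n)) * (2 * (\<delta> * real n))"
                using Lu \<theta> C1 R \<eta> by (intro mult_left_mono) auto
              also have "\<dots> = B * (\<delta> / sqrt \<delta>)" using sq n by (simp add: \<theta>_def B_def mult_ac)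
              also have "\<delta> / sqrt \<delta> = sqrt \<delta>" using \<delta>(3) by (simp add: real_div_sqrt)
              finally show ?thesis .
            qed
            have t3: "\<theta>\<^sup>2 * real (2 * L) \<le> 2"
            proof -
              have "\<theta>\<^sup>2 * real (2 * L) \<le> \<theta>\<^sup>2 * (2 * (\<delta> * real n))" using Lu by (intro mult_left_mono) auto
              also have "\<dots> = 2" using \<delta>(3) n by (simp add: \<theta>_def power_divide power_mult_distrib)
              finally show ?thesis .
            qed
            show ?thesis unfolding bd_def t1 distrib_right using t2 t3 by simp
          qed
          finally show "measure_pmf.prob (chain_path (down_step a) (T q - 2) t) Ev \<le> bd" .
        qed simp
        finally show ?thesis by simp
      qed
      have finI: "finite I" by (simp add: I_def)
      have cI: "real (card I) \<le> 4 / \<delta> + 1"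
      proof -
        have "card I \<le> card {1..Q}" unfolding I_def by (rule card_mono) auto
        then show ?thesis using Qb by simp
      qed
      have bd0: "bd \<ge> 0" by (simp add: bd_def)
      have P4: "measure_pmf.prob ?P (\<Union>q\<in>I. W3 q) \<le> \<rho> / 3"
      proof -
        have "measure_pmf.prob ?P (\<Union>q\<in>I. W3 q) \<le> (\<Sum>q\<in>I. measure_pmf.prob ?P (W3 q))"
          using finI by (rule measure_UNION_le) auto
        also have "\<dots> \<le> real (card I) * bd" using sum_bounded_above[of I "\<lambda>q. measure_pmf.prob ?P (W3 q)" bd] P3 by simp
        also have "\<dots> \<le> (4 / \<delta> + 1) * bd" using cI bd0 by (rule mult_right_mono)
        also have "\<dots> \<le> \<rho> / 3" using \<delta>(1) by (simp add: bd_def)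
        finally show ?thesis .
      qed
      have "measure_pmf.prob ?P {ys. \<exists>j k. 2 \<le> j \<and> j \<le> k \<and> k \<le> 2 * n \<and> real (k - j) \<le> \<delta> * real n \<and>
          \<epsilon> * sqrt n < \<bar>?D ys k - ?D ys j\<bar>} \<le> measure_pmf.prob ?P (W1 \<union> (W2 \<union> (\<Union>q\<in>I. W3 q)))"
      proof (rule prob_mono_support, rule ccontr)
        fix ys assume ys: "ys \<in> set_pmf ?P" and bad: "ys \<in> {ys. \<exists>j k. 2 \<le> j \<and> j \<le> k \<and> k \<le> 2 * n \<and> real (k - j) \<le> \<delta> * real n \<and>
          \<epsilon> * sqrt n < \<bar>?D ys k - ?D ys j\<bar>}" and good: "ys \<notin> W1 \<union> (W2 \<union> (\<Union>q\<in>I. W3 q))"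
        obtain j k where jk: "2 \<le> j" "j \<le> k" "k \<le> 2 * n" "real (k - j) \<le> \<delta> * real n" "\<epsilon> * sqrt n < \<bar>?D ys k - ?D ys j\<bar>"
          using bad by auto
        have len: "length ys = Suc (2 * n - 2)" using chain_path_hd_length[OF ys] by simp
        have kj: "k - j \<le> L" using jk(4) by (simp add: L_def le_nat_iff le_floor_iff)
        have bR: "\<bar>?D ys i\<bar> \<le> R * sqrt n" if "2 \<le> i" "i \<le> 2 * n" for i
        proof -
          have "(?D ys i)\<^sup>2 < R\<^sup>2 * real n" using good that by (auto simp: W1_def not_le)
          also have "\<dots> = (R * sqrt n)\<^sup>2" by (simp add: power_mult_distrib)
          finally have "\<bar>?D ys i\<bar> \<le> \<bar>R * sqrt n\<bar>" by (simp add: abs_le_square_iff)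
          then show ?thesis using R by simp
        qed
        have be: "\<bar>?D ys i\<bar> \<le> e * sqrt n" if "2 \<le> i" "i \<le> K" for i
        proof -
          have "(?D ys i)\<^sup>2 < e\<^sup>2 * real n" using good that by (auto simp: W2_def not_le)
          also have "\<dots> = (e * sqrt n)\<^sup>2" by (simp add: power_mult_distrib)
          finally have "\<bar>?D ys i\<bar> \<le> \<bar>e * sqrt n\<bar>" by (simp add: abs_le_square_iff)
          then show ?thesis using e by simp
        qed
        have ee: "\<epsilon> * sqrt n = e * sqrt n + e * sqrt n" by (simp add: e_def)
        have "\<bar>?D ys k - ?D ys j\<bar> \<le> e * sqrt n + e * sqrt n"
        proof (cases "k \<le> K")
          case True
          then show ?thesis using be[of k] be[of j] jk by linarith
        next
          case False
          then have "\<lfloor>3 * \<eta> * real n\<rfloor> < int k" unfolding K_def by linarith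
          then have kK: "3 * \<eta> * real n < real k" by (simp only: floor_less_iff of_int_of_nat_eq)
          \<comment> \<open>The least multiple of \<open>L\<close> that is at least
            \<open>k\<close>, before capping at 2n. The window of length 2 L below it contains
            \<open>k\<close> and also \<open>j\<close>, which is at most \<open>L\<close>
            lower.\<close>
          define q where "q = (k - 1) div L + 1"
          have dm: "(k - 1) div L * L \<le> k - 1" "k - 1 < ((k - 1) div L + 1) * L"
            using L1 dividend_less_div_times[of L "k - 1"] by (auto simp: div_times_less_eq_dividend)
          have qL: "q * L = (k - 1) div L * L + L" by (simp add: q_def)
          have Tk: "k \<le> T q" using dm(2) jk by (simp add: T_def q_def)
          have Tk': "T q \<le> k - 1 + L" using dm(1) qL unfolding T_def by linarith
          have Tn: "T q \<le> 2 * n" by (simp add: T_def)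
          have rT: "\<eta> * real n + real (2 * L) + 2 \<le> real k"
          proof -
            have "real (2 * L) \<le> \<eta> * real n" using Lu \<delta>(2) mult_right_mono[of \<delta> "\<eta> / 2" "real n"] by simp
            then show ?thesis using kK elim(2) by simp
          qed
          have T2: "2 * L + 2 \<le> T q"
          proof -
            have "0 \<le> \<eta> * real n" using \<eta> by simp
            then have "real (2 * L + 2) \<le> real (T q)" using rT Tk by simp
            then show ?thesis by (simp only: of_nat_le_iff)
          qed
          have qI: "q \<in> I"
          proof -
            have "(k - 1) div L \<le> 2 * n div L" using jk by (intro div_le_mono) simp
            then have "q \<in> {1..Q}" by (simp add: q_def Q_def)
            moreover have "\<eta> * real n \<le> real (T q - 2 * L)" using rT Tk T2 by (simp add: of_nat_diff)
            ultimately show ?thesis using T2 by (simp add: I_def)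
          qed
          then have nE: "drop (2 * n - T q) ys \<notin> Ev" using good by (auto simp: W3_def)
          have zn: "drop (2 * n - T q) ys ! i = ys ! (2 * n - (T q - i))" if "i \<le> T q" for i
            using that Tn len T2 by (simp add: Nat.diff_diff_right)
          have close: "\<bar>?D ys (T q - i) - ?D ys (T q)\<bar> \<le> e * sqrt n" if i: "i \<le> 2 * L" for i
          proof (rule ccontr)
            assume "\<not> ?thesis"
            moreover have "\<bar>imbalance (drop (2 * n - T q) ys ! i')\<bar> \<le> R * sqrt n" if "i' < i" for i'
              using bR[of "T q - i'"] zn[of i'] that i T2 Tn by simp
            ultimately have "drop (2 * n - T q) ys \<in> Ev"
              unfolding Ev_def using i T2 zn[of i] zn[of 0] by (auto intro!: exI[of _ i])
            with nE show False by simp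
          qed
          have "\<bar>?D ys k - ?D ys (T q)\<bar> \<le> e * sqrt n" using close[of "T q - k"] Tk Tk' jk by simp
          moreover have "\<bar>?D ys j - ?D ys (T q)\<bar> \<le> e * sqrt n" using close[of "T q - j"] Tk Tk' jk kj by simp
          ultimately show ?thesis by linarith
        qed
        with jk(5) ee show False by linarith
      qed
      also have "\<dots> \<le> measure_pmf.prob ?P W1 + measure_pmf.prob ?P (W2 \<union> (\<Union>q\<in>I. W3 q))" by (rule measure_Un_le) auto
      also have "measure_pmf.prob ?P (W2 \<union> (\<Union>q\<in>I. W3 q)) \<le> measure_pmf.prob ?P W2 + measure_pmf.prob ?P (\<Union>q\<in>I. W3 q)" by (rule measure_Un_le) auto
      finally show ?case using P1 P2 P4 by linarith
    qed
  qed
qed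

section \<open>The limiting process on the dyadic rationals\<close>

lemma indep_vars_PiM_coordinates:
  fixes N :: "nat \<Rightarrow> real measure"
  assumes N: "\<And>i. prob_space (N i)" "\<And>i. sets (N i) = sets borel" and I: "I \<noteq> {}"
  shows "prob_space.indep_vars (PiM I N) (\<lambda>_. borel) (\<lambda>i x. x i) I"
proof -
  interpret prob_space "PiM I N" by (intro prob_space_PiM N)
  have comp: "(\<lambda>x. x i) \<in> borel_measurable (PiM I N)" if "i \<in> I" for i
    using measurable_component_singleton[OF that, of N] unfolding measurable_cong_sets[OF refl N(2)] .
  have sP: "sets (PiM I (\<lambda>_. borel :: real measure)) = sets (PiM I N)"
    by (intro sets_PiM_cong refl) (simp add: N)
  have "distr (PiM I N) (PiM I (\<lambda>_. borel)) (\<lambda>x. \<lambda>i\<in>I. x i) = distr (PiM I N) (PiM I N) (\<lambda>x. x)"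
    by (rule distr_cong) (auto simp: sP space_PiM PiE_def extensional_restrict)
  also have "\<dots> = PiM I N" by (rule distr_id)
  also have "\<dots> = PiM I (\<lambda>i. distr (PiM I N) borel (\<lambda>x. x i))"
  proof (rule PiM_cong[OF refl])
    fix i assume i: "i \<in> I"
    have "distr (PiM I N) borel (\<lambda>x. x i) = distr (PiM I N) (N i) (\<lambda>x. x i)"
      by (rule distr_cong) (auto simp: N)
    also have "\<dots> = N i" by (rule distr_PiM_component[OF N(1) i])
    finally show "N i = distr (PiM I N) borel (\<lambda>x. x i)" ..
  qed
  finally show ?thesis using indep_vars_iff_distr_eq_PiM'[OF I comp] by simp
qed

lemma gauss_blocks_indep:
  assumes "a > 1" "I \<noteq> {}"
  shows "prob_space.indep_vars (gauss_blocks a m I) (\<lambda>_. borel) (\<lambda>i x. x i) I"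
  by (rule indep_vars_PiM_coordinates[OF _ _ assms(2)])
    (auto intro!: prob_space_centered_normal bvar_nonneg assms(1))

lemma prob_space_gauss_blocks: "a > 1 \<Longrightarrow> prob_space (gauss_blocks a m I)"
  by (intro prob_space_PiM prob_space_centered_normal bvar_nonneg)

lemma measurable_gauss_component:
  "i \<in> I \<Longrightarrow> (\<lambda>x. x i) \<in> borel_measurable (gauss_blocks a m I)"
  using measurable_component_singleton[of i I "\<lambda>l. centered_normal (bvar a m l)"]
  unfolding measurable_cong_sets[OF refl sets_centered_normal] .

text \<open>Independence makes the characteristic function a product of Gaussian ones, so the
  variances add.\<close>

lemma gauss_blocks_linear:
  assumes a: "a > 1" and I: "finite I" "I \<noteq> {}" and A: "A \<subseteq> I"
  shows "distr (gauss_blocks a m I) borel (\<lambda>x. \<Sum>i\<in>A. c i * x i) = centered_normal (\<Sum>i\<in>A. (c i)\<^sup>2 * bvar a m i)"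
proof -
  interpret prob_space "gauss_blocks a m I" by (rule prob_space_gauss_blocks[OF a])
  have v: "0 \<le> (\<Sum>i\<in>A. (c i)\<^sup>2 * bvar a m i)" by (intro sum_nonneg mult_nonneg_nonneg bvar_nonneg a) auto
  have fA: "finite A" using A I finite_subset by blast
  have m: "(\<lambda>x. x i) \<in> borel_measurable (gauss_blocks a m I)" if "i \<in> A" for i
    using measurable_gauss_component that A by blast
  have ms: "(\<lambda>x. \<Sum>i\<in>A. c i * x i) \<in> borel_measurable (gauss_blocks a m I)"
    by (intro borel_measurable_sum borel_measurable_times borel_measurable_const m)
  show ?thesis
  proof (rule Levy_uniqueness)
    show "real_distribution (distr (gauss_blocks a m I) borel (\<lambda>x. \<Sum>i\<in>A. c i * x i))"
      using ms by (rule real_distribution_distr)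
    show "real_distribution (centered_normal (\<Sum>i\<in>A. (c i)\<^sup>2 * bvar a m i))"
      by (rule real_distribution_centered_normal[OF v])
    show "char (distr (gauss_blocks a m I) borel (\<lambda>x. \<Sum>i\<in>A. c i * x i)) = char (centered_normal (\<Sum>i\<in>A. (c i)\<^sup>2 * bvar a m i))"
    proof
      fix t
      have "indep_vars (\<lambda>_. borel) (\<lambda>i x. c i * x i) A"
        by (rule indep_vars_compose2[OF indep_vars_subset[OF gauss_blocks_indep[OF a I(2)] A], where Y="\<lambda>i y. c i * y"]) auto
      then have "char (distr (gauss_blocks a m I) borel (\<lambda>x. \<Sum>i\<in>A. c i * x i)) t =
         (\<Prod>i\<in>A. char (distr (gauss_blocks a m I) borel (\<lambda>x. c i * x i)) t)"
        by (rule char_distr_sum)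
      also have "\<dots> = (\<Prod>i\<in>A. complex_of_real (exp (- (t\<^sup>2 * ((c i)\<^sup>2 * bvar a m i)) / 2)))"
      proof (rule prod.cong[OF refl])
        fix i assume i: "i \<in> A"
        then have iI: "i \<in> I" using A by blast
        have "distr (gauss_blocks a m I) borel (\<lambda>x. x i) = distr (gauss_blocks a m I) (centered_normal (bvar a m i)) (\<lambda>x. x i)"
          by (rule distr_cong) auto
        also have "\<dots> = centered_normal (bvar a m i)"
          by (rule distr_PiM_component[OF _ iI]) (intro prob_space_centered_normal bvar_nonneg a)
        finally have d: "distr (gauss_blocks a m I) borel (\<lambda>x. x i) = centered_normal (bvar a m i)" .
        have "char (distr (gauss_blocks a m I) borel (\<lambda>x. c i * x i)) t = char (distr (gauss_blocks a m I) borel (\<lambda>x. x i)) (t * c i)"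
          unfolding char_def using m[OF i] by (simp add: integral_distr mult.assoc)
        then show "char (distr (gauss_blocks a m I) borel (\<lambda>x. c i * x i)) t = complex_of_real (exp (- (t\<^sup>2 * ((c i)\<^sup>2 * bvar a m i)) / 2))"
          unfolding d char_centered_normal[OF bvar_nonneg[OF a]] by (simp add: power_mult_distrib mult.assoc)
      qed
      also have "\<dots> = complex_of_real (exp (\<Sum>i\<in>A. - (t\<^sup>2 * ((c i)\<^sup>2 * bvar a m i)) / 2))"
        using fA by (simp add: exp_sum flip: of_real_prod)
      also have "(\<Sum>i\<in>A. - (t\<^sup>2 * ((c i)\<^sup>2 * bvar a m i)) / 2) = - (t\<^sup>2 * (\<Sum>i\<in>A. (c i)\<^sup>2 * bvar a m i)) / 2"
        by (simp add: sum_distrib_left sum_divide_distrib sum_negf)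
      finally show "char (distr (gauss_blocks a m I) borel (\<lambda>x. \<Sum>i\<in>A. c i * x i)) t = char (centered_normal (\<Sum>i\<in>A. (c i)\<^sup>2 * bvar a m i)) t"
        by (simp only: char_centered_normal[OF v])
    qed
  qed
qed

lemma bvar_refine:
  assumes "l \<ge> 1" shows "bvar a m l = bvar a (Suc m) (2 * l) + bvar a (Suc m) (2 * l + 1)"
proof -
  have 1: "real (2 * l) / 2 ^ Suc m = real l / 2 ^ m" by simp
  have 2: "real (Suc (2 * l + 1)) / 2 ^ Suc m = real (Suc l) / 2 ^ m" by (simp add: field_simps)
  show ?thesis using assms unfolding bvar_def 1 2 by simp
qed

text \<open>Merging neighbouring blocks of the finer grid keeps independence, since the pairs are
  disjoint, and the variances telescope. This gives consistency between consecutive grids.\<close>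

lemma gauss_blocks_refine:
  assumes a: "a > 1" and m: "m \<ge> 1"
  shows "distr (gauss_blocks a (Suc m) {1..<2 ^ Suc m}) (PiM {1..<2 ^ m} (\<lambda>_. borel))
      (\<lambda>x. \<lambda>l\<in>{1..<2 ^ m}. x (2 * l) + x (2 * l + 1)) = gauss_blocks a m {1..<2 ^ m}"
proof -
  let ?I' = "{1..<2 ^ Suc m} :: nat set" and ?I = "{1..<2 ^ m} :: nat set"
  let ?Q = "gauss_blocks a (Suc m) ?I'"
  interpret prob_space ?Q by (rule prob_space_gauss_blocks[OF a])
  have "(2::nat) ^ 1 \<le> 2 ^ m" using m by (intro power_increasing) auto
  then have ne: "?I \<noteq> {}" "?I' \<noteq> {}" by (auto simp: ex_in_conv[symmetric] intro!: exI[of _ 1])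
  have sub: "{2 * l, 2 * l + 1} \<subseteq> ?I'" if "l \<in> ?I" for l using that by auto
  have ind: "indep_vars (\<lambda>_. borel) (\<lambda>i x. x i) ?I'" by (rule gauss_blocks_indep[OF a ne(2)])
  have "indep_vars (\<lambda>j. PiM {2 * j, 2 * j + 1} (\<lambda>_. borel)) (\<lambda>j x. restrict (\<lambda>i. x i) {2 * j, 2 * j + 1}) ?I"
  proof (rule indep_vars_restrict[OF ind])
    show "{2 * j, 2 * j + 1} \<subseteq> ?I'" if "j \<in> ?I" for j using sub[OF that] .
    show "disjoint_family_on (\<lambda>j. {2 * j, 2 * j + 1}) ?I"
      unfolding disjoint_family_on_def
    proof (intro ballI impI)
      fix j k :: nat assume "j \<noteq> k"
      moreover have "2 * j \<noteq> 2 * k + 1" "2 * j + 1 \<noteq> 2 * k" by presburger+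
      ultimately show "{2 * j, 2 * j + 1} \<inter> {2 * k, 2 * k + 1} = {}" by auto
    qed
  qed
  then have "indep_vars (\<lambda>_. borel) (\<lambda>j x. (\<lambda>f. f (2 * j) + f (2 * j + 1)) (restrict (\<lambda>i. x i) {2 * j, 2 * j + 1})) ?I"
    by (rule indep_vars_compose2) (auto intro!: borel_measurable_add measurable_component_singleton)
  then have iv: "indep_vars (\<lambda>_. borel) (\<lambda>j x. x (2 * j) + x (2 * j + 1) :: real) ?I" by simp
  have mm: "(\<lambda>x. x (2 * j) + x (2 * j + 1)) \<in> borel_measurable ?Q" if "j \<in> ?I" for j
    using sub[OF that] by (intro borel_measurable_add measurable_gauss_component) auto
  have "distr ?Q (PiM ?I (\<lambda>_. borel)) (\<lambda>x. \<lambda>l\<in>?I. x (2 * l) + x (2 * l + 1)) =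
      PiM ?I (\<lambda>l. distr ?Q borel (\<lambda>x. x (2 * l) + x (2 * l + 1)))"
    using indep_vars_iff_distr_eq_PiM'[OF ne(1) mm] iv by simp
  also have "\<dots> = gauss_blocks a m ?I"
  proof (rule PiM_cong[OF refl])
    fix l assume l: "l \<in> ?I"
    have "distr ?Q borel (\<lambda>x. \<Sum>i\<in>{2 * l, 2 * l + 1}. 1 * x i) = centered_normal (\<Sum>i\<in>{2 * l, 2 * l + 1}. 1\<^sup>2 * bvar a (Suc m) i)"
      by (rule gauss_blocks_linear[OF a _ ne(2) sub[OF l]]) auto
    then show "distr ?Q borel (\<lambda>x. x (2 * l) + x (2 * l + 1)) = centered_normal (bvar a m l)"
      using bvar_refine[of l a m] l by simp
  qed
  finally show ?thesis .
qed

section \<open>Dyadic grids and consistency of their laws\<close>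

definition dyadic_pts :: "nat \<Rightarrow> real set" where
  "dyadic_pts m = (\<lambda>l. real l / 2 ^ m) ` {1..2 ^ m}"

lemma finite_dyadic_pts [simp]: "finite (dyadic_pts m)"
  by (simp add: dyadic_pts_def)

lemma dyadic_pts_Suc: "dyadic_pts m \<subseteq> dyadic_pts (Suc m)"
proof
  fix t assume "t \<in> dyadic_pts m"
  then obtain l where l: "l \<in> {1..2 ^ m}" "t = real l / 2 ^ m" by (auto simp: dyadic_pts_def)
  then have "t = real (2 * l) / 2 ^ Suc m" "2 * l \<in> {1..2 ^ Suc m}" by auto
  then show "t \<in> dyadic_pts (Suc m)" unfolding dyadic_pts_def by blast
qed

lemma dyadic_pts_mono: "m \<le> m' \<Longrightarrow> dyadic_pts m \<subseteq> dyadic_pts m'"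
  by (rule lift_Suc_mono_le[of dyadic_pts]) (rule dyadic_pts_Suc)

text \<open>A Brownian motion in the clock t^(1-2a) - 1, built from t = 1 downwards; hence the
  blocks to the right of t. Time 0, where the clock is infinite, is not among the dyadic
  points.\<close>

definition grid_sum :: "nat \<Rightarrow> (nat \<Rightarrow> real) \<Rightarrow> real \<Rightarrow> real" where
  "grid_sum m x t = (\<Sum>l\<in>{nat \<lfloor>t * 2 ^ m\<rfloor>..<2 ^ m}. x l)"

lemma grid_sum_dyadic: "grid_sum m x (real l / 2 ^ m) = (\<Sum>l'\<in>{l..<2 ^ m}. x l')"
  by (simp add: grid_sum_def)

lemma sum_pairs:
  fixes x :: "nat \<Rightarrow> real"
  shows "(\<Sum>l\<in>{p..<q}. x (2 * l) + x (2 * l + 1)) = (\<Sum>l\<in>{2 * p..<2 * q}. x l)"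
proof (induction q)
  case (Suc q)
  show ?case
  proof (cases "p \<le> q")
    case True
    then have "{2 * p..<2 * Suc q} = insert (2 * q + 1) (insert (2 * q) {2 * p..<2 * q})" by auto
    then show ?thesis using Suc True by simp
  next
    case False
    then show ?thesis by simp
  qed
qed simp

lemma grid_sum_refine:
  assumes "t \<in> dyadic_pts m"
  shows "grid_sum m (\<lambda>l\<in>{1..<2 ^ m}. x (2 * l) + x (2 * l + 1)) t = grid_sum (Suc m) x t"
proof -
  obtain l where l: "l \<in> {1..2 ^ m}" "t = real l / 2 ^ m" using assms by (auto simp: dyadic_pts_def)
  have t2: "t = real (2 * l) / 2 ^ Suc m" using l by simp
  have "grid_sum m (\<lambda>l\<in>{1..<2 ^ m}. x (2 * l) + x (2 * l + 1)) t = (\<Sum>l'\<in>{l..<2 ^ m}. x (2 * l') + x (2 * l' + 1))"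
    unfolding l(2) grid_sum_dyadic using l by (intro sum.cong) auto
  also have "\<dots> = (\<Sum>l'\<in>{2 * l..<2 * 2 ^ m}. x l')" by (rule sum_pairs)
  also have "\<dots> = grid_sum (Suc m) x t" unfolding t2 grid_sum_dyadic by simp
  finally show ?thesis .
qed

definition grid_law :: "real \<Rightarrow> nat \<Rightarrow> real set \<Rightarrow> (real \<Rightarrow> real) measure" where
  "grid_law a m J = distr (gauss_blocks a m {1..<2 ^ m}) (PiM J (\<lambda>_. borel)) (\<lambda>x. \<lambda>t\<in>J. grid_sum m x t)"

lemma grid_sum_measurable:
  assumes "t \<in> dyadic_pts m"
  shows "(\<lambda>x. grid_sum m x t) \<in> borel_measurable (gauss_blocks a m {1..<2 ^ m})"
    "(\<lambda>x. grid_sum m x t) \<in> borel_measurable (PiM {1..<2 ^ m} (\<lambda>_. borel))"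
proof -
  obtain l where l: "l \<in> {1..2 ^ m}" "t = real l / 2 ^ m" using assms by (auto simp: dyadic_pts_def)
  show "(\<lambda>x. grid_sum m x t) \<in> borel_measurable (gauss_blocks a m {1..<2 ^ m})"
    unfolding l(2) grid_sum_dyadic using l by (intro borel_measurable_sum measurable_gauss_component) auto
  show "(\<lambda>x. grid_sum m x t) \<in> borel_measurable (PiM {1..<2 ^ m} (\<lambda>_. borel))"
    unfolding l(2) grid_sum_dyadic using l by (intro borel_measurable_sum measurable_component_singleton) auto
qed

lemma grid_law_Suc:
  assumes a: "a > 1" and m: "m \<ge> 1" and J: "J \<subseteq> dyadic_pts m"
  shows "grid_law a (Suc m) J = grid_law a m J"
proof -
  let ?r = "\<lambda>x. \<lambda>l\<in>{1..<2 ^ m}. x (2 * l) + x (2 * l + 1) :: real"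
  have m1: "?r \<in> measurable (gauss_blocks a (Suc m) {1..<2 ^ Suc m}) (PiM {1..<2 ^ m} (\<lambda>_. borel))"
    by (intro measurable_restrict borel_measurable_add measurable_gauss_component) auto
  have m2: "(\<lambda>x. \<lambda>t\<in>J. grid_sum m x t) \<in> measurable (PiM {1..<2 ^ m} (\<lambda>_. borel)) (PiM J (\<lambda>_. borel))"
    using J by (intro measurable_restrict grid_sum_measurable) auto
  have "grid_law a m J = distr (distr (gauss_blocks a (Suc m) {1..<2 ^ Suc m}) (PiM {1..<2 ^ m} (\<lambda>_. borel)) ?r)
      (PiM J (\<lambda>_. borel)) (\<lambda>x. \<lambda>t\<in>J. grid_sum m x t)"
    unfolding grid_law_def gauss_blocks_refine[OF a m] ..
  also have "\<dots> = distr (gauss_blocks a (Suc m) {1..<2 ^ Suc m}) (PiM J (\<lambda>_. borel)) ((\<lambda>x. \<lambda>t\<in>J. grid_sum m x t) \<circ> ?r)"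
    by (rule distr_distr[OF m2 m1])
  also have "\<dots> = grid_law a (Suc m) J"
  proof -
    have "(\<lambda>t\<in>J. grid_sum m (?r x) t) = (\<lambda>t\<in>J. grid_sum (Suc m) x t)" for x
      using J by (intro restrict_ext grid_sum_refine) auto
    then show ?thesis unfolding comp_def grid_law_def by (simp only:)
  qed
  finally show ?thesis ..
qed

lemma grid_law_le:
  assumes "a > 1" "m \<ge> 1" "J \<subseteq> dyadic_pts m" "m \<le> m'"
  shows "grid_law a m' J = grid_law a m J"
  using assms(4)
proof (induction m' rule: dec_induct)
  case (step k)
  then show ?case using grid_law_Suc[of a k J] assms dyadic_pts_mono[of m k] by auto
qed simp

text \<open>The least admissible grid merely makes the definition unambiguous; by consistency any
  finer grid gives the same law.\<close>

definition proj_law :: "real \<Rightarrow> real set \<Rightarrow> (real \<Rightarrow> real) measure" where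
  "proj_law a J = grid_law a (LEAST m. m \<ge> 1 \<and> J \<subseteq> dyadic_pts m) J"

lemma proj_law_eq:
  assumes a: "a > 1" and m: "m \<ge> 1" "J \<subseteq> dyadic_pts m"
  shows "proj_law a J = grid_law a m J"
proof -
  define k where "k = (LEAST m. m \<ge> 1 \<and> J \<subseteq> dyadic_pts m)"
  have "k \<ge> 1 \<and> J \<subseteq> dyadic_pts k" 
    unfolding k_def by (rule LeastI[of "\<lambda>m. m \<ge> 1 \<and> J \<subseteq> dyadic_pts m" m]) (use m in blast)
  moreover have "k \<le> m" 
    unfolding k_def by (rule Least_le) (use m in blast)
  ultimately have "grid_law a m J = grid_law a k J" using a by (intro grid_law_le) auto
  then show ?thesis by (simp add: proj_law_def k_def)
qed

lemma finite_subset_dyadics: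
  assumes "finite J" "J \<subseteq> (\<Union>m. dyadic_pts m)"
  obtains m where "m \<ge> 1" "J \<subseteq> dyadic_pts m"
proof -
  have "\<exists>m\<ge>1. J \<subseteq> dyadic_pts m" using assms
  proof (induction J rule: finite_induct)
    case empty then show ?case by auto
  next
    case (insert t J)
    then obtain m where m: "m \<ge> 1" "J \<subseteq> dyadic_pts m" by auto
    obtain k where k: "t \<in> dyadic_pts k" using insert by auto
    have "insert t J \<subseteq> dyadic_pts (max m k)" using m k dyadic_pts_mono[of m "max m k"] dyadic_pts_mono[of k "max m k"] by auto
    then show ?case using m by (intro exI[of _ "max m k"]) auto
  qed
  then show ?thesis using that by blast
qed

lemma prob_space_grid_law:
  assumes "a > 1" "J \<subseteq> dyadic_pts m" shows "prob_space (grid_law a m J)"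
  unfolding grid_law_def
proof (rule prob_space.prob_space_distr[OF prob_space_gauss_blocks[OF assms(1)]])
  show "(\<lambda>x. \<lambda>t\<in>J. grid_sum m x t) \<in> measurable (gauss_blocks a m {1..<2 ^ m}) (PiM J (\<lambda>_. borel))"
    using assms(2) by (intro measurable_restrict grid_sum_measurable) auto
qed

text \<open>Two finite sets of dyadic times share a grid, and on a common grid the smaller law is an
  image of the larger one by restriction.\<close>

lemma polish_projective_proj_law:
  assumes a: "a > 1"
  shows "polish_projective (\<Union>m. dyadic_pts m) (proj_law a)"
proof (unfold polish_projective_def, rule projective_family.intro)
  fix J H :: "real set" assume JH: "J \<subseteq> H" "finite H" "H \<subseteq> (\<Union>m. dyadic_pts m)"
  obtain m where m: "m \<ge> 1" "H \<subseteq> dyadic_pts m" using finite_subset_dyadics[OF JH(2,3)] by blast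
  have mJ: "J \<subseteq> dyadic_pts m" using JH m by blast
  have m1: "(\<lambda>x. \<lambda>t\<in>H. grid_sum m x t) \<in> measurable (gauss_blocks a m {1..<2 ^ m}) (PiM H (\<lambda>_. borel))"
    using m by (intro measurable_restrict grid_sum_measurable) auto
  have m2: "(\<lambda>f. restrict f J) \<in> measurable (PiM H (\<lambda>_. borel)) (PiM J (\<lambda>_. borel :: real measure))"
    by (rule measurable_restrict_subset[OF JH(1)])
  have "distr (grid_law a m H) (PiM J (\<lambda>_. borel)) (\<lambda>f. restrict f J) =
      distr (gauss_blocks a m {1..<2 ^ m}) (PiM J (\<lambda>_. borel)) ((\<lambda>f. restrict f J) \<circ> (\<lambda>x. \<lambda>t\<in>H. grid_sum m x t))"
    unfolding grid_law_def by (rule distr_distr[OF m2 m1])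
  also have "\<dots> = grid_law a m J"
    unfolding grid_law_def using JH by (intro distr_cong) (auto simp: fun_eq_iff restrict_def)
  finally show "proj_law a J = distr (proj_law a H) (PiM J (\<lambda>_. borel)) (\<lambda>f. restrict f J)"
    unfolding proj_law_eq[OF a m] proj_law_eq[OF a m(1) mJ] ..
next
  fix J :: "real set" assume J: "finite J" "J \<subseteq> (\<Union>m. dyadic_pts m)"
  obtain m where m: "m \<ge> 1" "J \<subseteq> dyadic_pts m" using finite_subset_dyadics[OF J] by blast
  show "prob_space (proj_law a J)" unfolding proj_law_eq[OF a m] by (rule prob_space_grid_law[OF a m(2)])
qed

text \<open>The value 0 at index 0 is deliberate: it is the value of the limit process and of the
  chain at time 0.\<close>

definition grid_vec :: "nat \<Rightarrow> (real \<Rightarrow> real) \<Rightarrow> nat \<Rightarrow> real" where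
  "grid_vec m f l = (if l \<in> {1..2 ^ m} then f (real l / 2 ^ m) else 0)"

lemma dyadic_process:
  assumes a: "a > 1"
  obtains M :: "(real \<Rightarrow> real) measure" where "prob_space M"
    "\<And>t. t \<in> (\<Union>m. dyadic_pts m) \<Longrightarrow> (\<lambda>w. w t) \<in> borel_measurable M"
    "\<And>m. m \<ge> 1 \<Longrightarrow> distr M borel (grid_vec m) = distr (gauss_blocks a m {1..<2 ^ m}) borel (\<lambda>x. grid_vec m (grid_sum m x))"
proof -
  interpret PP: polish_projective "\<Union>m. dyadic_pts m" "proj_law a" by (rule polish_projective_proj_law[OF a])
  let ?M = "PP.lim"
  show ?thesis
  proof
    show "prob_space ?M" by (rule PP.P.prob_space_axioms)
    show meas: "(\<lambda>w. w t) \<in> borel_measurable ?M" if "t \<in> (\<Union>m. dyadic_pts m)" for t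
      using measurable_component_singleton[OF that, of "\<lambda>_. borel :: real measure"]
      unfolding measurable_cong_sets[OF PP.sets_lim refl] .
    fix m :: nat assume m: "m \<ge> 1"
    let ?J = "dyadic_pts m"
    have J: "?J \<subseteq> (\<Union>m. dyadic_pts m)" by auto
    have m1: "(\<lambda>f. restrict f ?J) \<in> measurable ?M (PiM ?J (\<lambda>_. borel :: real measure))"
      using measurable_restrict_subset[OF J] unfolding measurable_cong_sets[OF PP.sets_lim refl] .
    have m2: "grid_vec m \<in> borel_measurable (PiM ?J (\<lambda>_. borel))"
    proof (rule measurable_coordinatewise_then_product)
      fix l show "(\<lambda>f. grid_vec m f l) \<in> borel_measurable (PiM ?J (\<lambda>_. borel))"
      proof (cases "l \<in> {1..2 ^ m}")
        case True
        then have "real l / 2 ^ m \<in> ?J" by (auto simp: dyadic_pts_def)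
        from measurable_component_singleton[OF this, of "\<lambda>_. borel :: real measure"] True show ?thesis
          by (simp add: grid_vec_def)
      next
        case False
        then have "(\<lambda>f. grid_vec m f l) = (\<lambda>_. 0)" by (auto simp: grid_vec_def)
        then show ?thesis by simp
      qed
    qed
    have m3: "(\<lambda>x. \<lambda>t\<in>?J. grid_sum m x t) \<in> measurable (gauss_blocks a m {1..<2 ^ m}) (PiM ?J (\<lambda>_. borel))"
      by (intro measurable_restrict grid_sum_measurable)
    have dl: "distr ?M (PiM ?J (\<lambda>_. borel)) (\<lambda>f. restrict f ?J) = proj_law a ?J"
    proof (rule measure_eqI)
      show "sets (distr ?M (PiM ?J (\<lambda>_. borel)) (\<lambda>f. restrict f ?J)) = sets (proj_law a ?J)"
        using PP.sets_P[of ?J] J by simp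
      fix X assume "X \<in> sets (distr ?M (PiM ?J (\<lambda>_. borel)) (\<lambda>f. restrict f ?J))"
      then have X: "X \<in> sets (PiM ?J (\<lambda>_. borel))" by simp
      have "emeasure (distr ?M (PiM ?J (\<lambda>_. borel)) (\<lambda>f. restrict f ?J)) X = emeasure ?M ((\<lambda>f. restrict f ?J) -` X \<inter> space ?M)"
        using m1 X by (rule emeasure_distr)
      also have "(\<lambda>f. restrict f ?J) -` X \<inter> space ?M = PP.emb (\<Union>m. dyadic_pts m) ?J X"
        by (simp add: prod_emb_def space_PiM)
      also have "emeasure ?M \<dots> = emeasure (proj_law a ?J) X" using J X by (intro PP.emeasure_lim_emb) auto
      finally show "emeasure (distr ?M (PiM ?J (\<lambda>_. borel)) (\<lambda>f. restrict f ?J)) X = emeasure (proj_law a ?J) X" .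
    qed
    have gr: "grid_vec m (restrict f ?J) = grid_vec m f" for f by (auto simp: grid_vec_def dyadic_pts_def)
    have "distr ?M borel (grid_vec m) = distr ?M borel (grid_vec m \<circ> (\<lambda>f. restrict f ?J))"
      by (simp add: comp_def gr)
    also have "\<dots> = distr (distr ?M (PiM ?J (\<lambda>_. borel)) (\<lambda>f. restrict f ?J)) borel (grid_vec m)"
      by (rule distr_distr[OF m2 m1, symmetric])
    also have "\<dots> = distr (grid_law a m ?J) borel (grid_vec m)" unfolding dl proj_law_eq[OF a m order_refl] ..
    also have "\<dots> = distr (gauss_blocks a m {1..<2 ^ m}) borel (grid_vec m \<circ> (\<lambda>x. \<lambda>t\<in>?J. grid_sum m x t))"
      unfolding grid_law_def by (rule distr_distr[OF m2 m3])
    also have "\<dots> = distr (gauss_blocks a m {1..<2 ^ m}) borel (\<lambda>x. grid_vec m (grid_sum m x))"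
      by (simp add: comp_def gr)
    finally show "distr ?M borel (grid_vec m) = distr (gauss_blocks a m {1..<2 ^ m}) borel (\<lambda>x. grid_vec m (grid_sum m x))" .
  qed
qed

section \<open>Transfer to the conditioned urn\<close>

lemma tendsto_coordinatewise:
  fixes X :: "nat \<Rightarrow> nat \<Rightarrow> real"
  assumes "\<And>l. (\<lambda>n. X n l) \<longlonglongrightarrow> x l"
  shows "X \<longlonglongrightarrow> x"
proof -
  have "limitin (product_topology (\<lambda>_. euclidean) UNIV) X x sequentially"
    using assms by (simp add: limitin_componentwise)
  then show ?thesis by (simp add: euclidean_product_topology)
qed

lemma continuous_on_UNIV_coordinatewise:
  fixes g :: "(nat \<Rightarrow> real) \<Rightarrow> real"
  assumes "continuous_on UNIV g" "\<And>l. (\<lambda>n. X n l) \<longlonglongrightarrow> x l"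
  shows "(\<lambda>n. g (X n)) \<longlonglongrightarrow> g x"
  using continuous_on_tendsto_compose[OF assms(1) tendsto_coordinatewise[OF assms(2)]] by simp

lemma prob_hit_balanced:
  assumes "n \<ge> 1"
  shows "measure_pmf.prob (chain_path (down_step a) (2 * n - 2) (n, n)) {xs. last xs = (1, 1)} = hit a (n, n)"
  using prob_last_eq_hit[of a "(n, n)"] by (simp add: level_def mult_2)

text \<open>Conditioning is written as a weighted expectation for the unconditioned reversed chain,
  divided by the hitting probability, so that limits and bounds can be taken without it.\<close>

lemma expectation_bingo:
  fixes F :: "(nat \<times> nat) list \<Rightarrow> real"
  assumes a: "a > 1" and n: "n \<ge> 1"
  shows "measure_pmf.expectation (cond_pmf (urn_chain a n) (bingo_nn n)) F =
    measure_pmf.expectation (chain_path (down_step a) (2 * n - 2) (n, n))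
      (\<lambda>ys. indicator {xs. last xs = (1, 1)} ys * F (rev ys)) / hit a (n, n)"
proof -
  let ?q = "chain_path (down_step a) (2 * n - 2) (n, n)" and ?L = "{xs. last xs = (1 :: nat, 1 :: nat)}"
  have "measure_pmf.prob ?q ?L > 0" using prob_hit_balanced[OF n, of a] hit_balanced_ge_half[OF a n] by linarith
  then have ne: "set_pmf ?q \<inter> ?L \<noteq> {}" by (metis less_irrefl measure_pmf_zero_iff)
  have "measure_pmf.expectation (cond_pmf (urn_chain a n) (bingo_nn n)) F = measure_pmf.expectation (cond_pmf ?q ?L) (\<lambda>ys. F (rev ys))"
    unfolding cond_urn_chain_eq_down[OF n ne] by simp
  also have "\<dots> = measure_pmf.expectation ?q (\<lambda>ys. indicator ?L ys * F (rev ys)) / measure_pmf.prob ?q ?L"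
    using ne by (intro expectation_cond_pmf_finite) auto
  finally show ?thesis unfolding prob_hit_balanced[OF n] .
qed

text \<open>The forward list starts at level 2, the reversed one at level 2n.\<close>

lemma Delta_rev:
  assumes "length ys = Suc (2 * n - 2)" "2 \<le> k" "k \<le> 2 * n"
  shows "real_of_int (Delta (rev ys) k) = imbalance (ys ! (2 * n - k))"
proof -
  have "length ys - Suc (k - 2) = 2 * n - k" using assms by simp
  then have "rev ys ! (k - 2) = ys ! (2 * n - k)" using assms by (subst rev_nth) auto
  then show ?thesis using assms by (simp add: Delta_def imbalance_def)
qed

lemma scaled_Delta_dyadic:
  "scaled_Delta n xs (real l / 2 ^ m) = real_of_int (Delta xs (gridpt n m l)) / sqrt n"
proof -
  have "\<lfloor>2 * real n * (real l / 2 ^ m)\<rfloor> = \<lfloor>real (2 * n * l) / real (2 ^ m)\<rfloor>" by simp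
  also have "\<dots> = int (gridpt n m l)" unfolding floor_divide_of_nat_eq gridpt_def by simp
  finally show ?thesis by (simp add: scaled_Delta_def)
qed

text \<open>Inverse of the constant in \<open>wscale\<close>, so that \<open>gcoef a\<close> t^a
  undoes the rescaling.\<close>

definition gcoef :: "real \<Rightarrow> real" where "gcoef a = sqrt (2 / (2 * a - 1))"

lemma imbalance_eq_wpos:
  assumes a: "a > 1" and n: "n \<ge> 1" and l: "level s \<ge> 1"
  shows "imbalance s / sqrt n = gcoef a * (real (level s) / (2 * real n)) powr a * wpos a n s"
proof -
  define x where "x = real (level s) / (2 * real n)"
  have x: "x > 0" using n l by (simp add: x_def)
  have c: "gcoef a * sqrt ((2 * a - 1) / 2) = 1"
    using a unfolding gcoef_def real_sqrt_mult[symmetric] by simp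
  have xx: "x powr a * x powr - a = 1" using x by (simp flip: powr_add)
  have "gcoef a * x powr a * wpos a n s = (gcoef a * sqrt ((2 * a - 1) / 2)) * (x powr a * x powr - a) * (imbalance s / sqrt n)"
    by (simp add: wpos_def wscale_def x_def)
  then show ?thesis unfolding c xx unfolding x_def by simp
qed

text \<open>The reversed chain starts balanced, so its position is the sum of the increments made so
  far.\<close>

lemma wpos_eq_block_sum:
  assumes ys: "ys ! 0 = (n, n)" and l: "1 \<le> l" "l \<le> 2 ^ m"
  shows "wpos a n (ys ! (2 * n - gridpt n m l)) = (\<Sum>l'\<in>{l..<2 ^ m}. block_incr a n m (2 ^ m) ys l')"
proof -
  let ?w = "\<lambda>l. wpos a n (ys ! (2 * n - gridpt n m l))"
  have "(\<Sum>l'\<in>{l..<2 ^ m}. block_incr a n m (2 ^ m) ys l') = (\<Sum>l'\<in>{l..<2 ^ m}. ?w l' - ?w (Suc l'))"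
    using l by (intro sum.cong) (auto simp: block_incr_def gridpt_top)
  also have "\<dots> = ?w l - ?w (2 ^ m)" using l(2) sum_Suc_diff'[of l "2 ^ m" "\<lambda>l. - ?w l"] by simp
  also have "?w (2 ^ m) = 0" using ys by (simp add: gridpt_top wpos_def imbalance_def)
  finally show ?thesis by simp
qed

definition level_path :: "real \<Rightarrow> (real \<Rightarrow> real) \<Rightarrow> real \<Rightarrow> real" where
  "level_path a w t = gcoef a * t powr a * w t"

text \<open>Numerator and hitting probability converge with the same factor \<open>h\<close>, which
  cancels: at positive macroscopic times the conditioning leaves no trace.\<close>

lemma fdd_limit:
  fixes g :: "(nat \<Rightarrow> real) \<Rightarrow> real"
  assumes a: "a > 1" and m: "m \<ge> 1" and g: "continuous_on UNIV g" "\<And>x. \<bar>g x\<bar> \<le> B"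
    and M: "distr M borel (grid_vec m) = distr (gauss_blocks a m {1..<2 ^ m}) borel (\<lambda>x. grid_vec m (grid_sum m x))"
    and Mm: "grid_vec m \<in> borel_measurable M"
  shows "(\<lambda>n. measure_pmf.expectation (cond_pmf (urn_chain a n) (bingo_nn n)) (\<lambda>xs. g (grid_vec m (scaled_Delta n xs))))
    \<longlonglongrightarrow> (\<integral>w. g (grid_vec m (level_path a w)) \<partial>M)"
proof -
  obtain h where h: "h \<ge> 1/2" "\<And>e. e > 0 \<Longrightarrow> \<exists>N. \<forall>i\<ge>N. \<forall>j\<ge>N. \<bar>hit a (i, j) - h\<bar> < e"
    using hit_limit[OF a] by blast
  \<comment> \<open>These coefficients turn sums of block increments back into D / sqrt n. They
    depend on n through rounding and converge to \<open>co'\<close>.\<close>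
  define co where "co n l = gcoef a * (real (gridpt n m l) / (2 * real n)) powr a" for n l
  define co' where "co' l = gcoef a * (real l / 2 ^ m) powr a" for l :: nat
  define vec where "vec c x l = (if l \<in> {1..2 ^ m} then c l * (\<Sum>l'\<in>{l..<2 ^ m}. x l') else 0)" for c x :: "nat \<Rightarrow> real" and l :: nat
  let ?L = "{xs. last xs = (1 :: nat, 1 :: nat)}"
  have co_lim: "(\<lambda>n. co n l) \<longlonglongrightarrow> co' l" if "1 \<le> l" for l
    unfolding co_def co'_def using that by (intro tendsto_intros gridpt_limit) auto
  have vec_meas: "continuous_on UNIV (vec co')"
  proof (rule continuous_on_coordinatewise_then_product)
    fix l show "continuous_on UNIV (\<lambda>x. vec co' x l)" unfolding vec_def
      by (cases "l \<in> {1..2 ^ m}") (auto intro!: continuous_intros continuous_on_product_coordinates)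
  qed
  have gv: "continuous_on UNIV (\<lambda>x. g (vec co' x))" by (rule continuous_on_compose2[OF g(1) vec_meas]) auto
  have cc: "cont_conv (\<lambda>n x. g (vec (co n) x)) (\<lambda>x. g (vec co' x))"
    unfolding cont_conv_def
  proof (intro allI impI)
    fix X :: "nat \<Rightarrow> nat \<Rightarrow> real" and x assume X: "\<forall>l. (\<lambda>n. X n l) \<longlonglongrightarrow> x l"
    show "(\<lambda>n. g (vec (co n) (X n))) \<longlonglongrightarrow> g (vec co' x)"
    proof (rule continuous_on_UNIV_coordinatewise[OF g(1)])
      fix l show "(\<lambda>n. vec (co n) (X n) l) \<longlonglongrightarrow> vec co' x l"
        unfolding vec_def using X co_lim[of l] by (cases "l \<in> {1..2 ^ m}") (auto intro!: tendsto_intros)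
    qed
  qed
  have lev: "level (n, n) = gridpt n m (2 ^ m)" for n by (simp add: level_def gridpt_top)
  have lim1: "(\<lambda>n. measure_pmf.expectation (chain_path (down_step a) (gridpt n m (2 ^ m) - 2) (n, n))
      (\<lambda>xs. indicator ?L xs * g (vec (co n) (block_incr a n m (2 ^ m) xs))))
    \<longlonglongrightarrow> h * (\<integral>x. g (vec co' (zero_ext {1..<2 ^ m} x)) \<partial>gauss_blocks a m {1..<2 ^ m})"
    by (rule fdd_blocks[OF a h(2), where s="\<lambda>n. (n, n)" and R=0 and gn="\<lambda>n x. g (vec (co n) x)" and B=B])
      (auto simp: lev imbalance_def g(2) gv cc)
  have hl: "(\<lambda>n. hit a (n, n)) \<longlonglongrightarrow> h"
    \<comment> \<open>The full level 2n is the grid level with m = 0 and l = 1.\<close>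
    by (rule hit_tendsto[OF h(2), where m=0 and l=1 and R=0]) (auto simp: level_def gridpt_def imbalance_def)
  have lim2: "(\<lambda>n. measure_pmf.expectation (chain_path (down_step a) (gridpt n m (2 ^ m) - 2) (n, n))
      (\<lambda>xs. indicator ?L xs * g (vec (co n) (block_incr a n m (2 ^ m) xs))) / hit a (n, n))
    \<longlonglongrightarrow> h * (\<integral>x. g (vec co' (zero_ext {1..<2 ^ m} x)) \<partial>gauss_blocks a m {1..<2 ^ m}) / h"
    using h(1) by (intro tendsto_divide lim1 hl) auto
  have ev: "\<forall>\<^sub>F n in sequentially. measure_pmf.expectation (chain_path (down_step a) (gridpt n m (2 ^ m) - 2) (n, n))
      (\<lambda>xs. indicator ?L xs * g (vec (co n) (block_incr a n m (2 ^ m) xs))) / hit a (n, n) =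
      measure_pmf.expectation (cond_pmf (urn_chain a n) (bingo_nn n)) (\<lambda>xs. g (grid_vec m (scaled_Delta n xs)))"
    using eventually_ge_2_power[of m] eventually_ge_at_top[of 1]
  proof eventually_elim
    case (elim n)
    have eq: "vec (co n) (block_incr a n m (2 ^ m) ys) = grid_vec m (scaled_Delta n (rev ys))"
      if ys: "ys \<in> set_pmf (chain_path (down_step a) (2 * n - 2) (n, n))" for ys
    proof
      fix l
      have len: "length ys = Suc (2 * n - 2)" using chain_path_hd_length[OF ys] by simp
      show "vec (co n) (block_incr a n m (2 ^ m) ys) l = grid_vec m (scaled_Delta n (rev ys)) l"
      proof (cases "l \<in> {1..2 ^ m}")
        case True
        let ?k = "gridpt n m l"
        have k: "2 \<le> ?k" "?k \<le> 2 * n" using gridpt_ge_2[OF _ elim(1), of l] gridpt_le[of l m n] True by auto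
        have lv: "level (ys ! (2 * n - ?k)) = ?k"
        proof -
          have "level (ys ! (2 * n - ?k)) = level (n, n) - (2 * n - ?k)"
            by (rule down_state_level[OF chain_path_nth_state[OF ys]]) (use k in \<open>auto simp: level_def\<close>)
          then show ?thesis using k by (simp add: level_def)
        qed
        have "scaled_Delta n (rev ys) (real l / 2 ^ m) = imbalance (ys ! (2 * n - ?k)) / sqrt n"
          unfolding scaled_Delta_dyadic Delta_rev[OF len k] ..
        also have "\<dots> = co n l * wpos a n (ys ! (2 * n - ?k))"
          using imbalance_eq_wpos[OF a elim(2), of "ys ! (2 * n - ?k)"] k by (simp add: lv co_def)
        also have "\<dots> = vec (co n) (block_incr a n m (2 ^ m) ys) l"
          using wpos_eq_block_sum[OF chain_path_nth_0[OF ys], of l m a] True by (simp add: vec_def)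
        finally show ?thesis using True by (simp add: grid_vec_def)
      qed (auto simp: vec_def grid_vec_def)
    qed
    show ?case unfolding expectation_bingo[OF a elim(2)] gridpt_top
      by (intro arg_cong2[where f="(/)"] refl integral_cong_AE AE_pmfI) (auto simp: eq)
  qed
  have "(\<integral>x. g (vec co' (zero_ext {1..<2 ^ m} x)) \<partial>gauss_blocks a m {1..<2 ^ m}) = (\<integral>w. g (grid_vec m (level_path a w)) \<partial>M)"
  proof -
    define g' where "g' v = g (\<lambda>l. co' l * v l)" for v
    have g'm: "g' \<in> borel_measurable borel"
    proof (rule borel_measurable_continuous_onI)
      have "continuous_on UNIV (\<lambda>v :: nat \<Rightarrow> real. (\<lambda>l. co' l * v l))"
        by (rule continuous_on_coordinatewise_then_product) (intro continuous_intros continuous_on_product_coordinates)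
      then show "continuous_on UNIV g'" unfolding g'_def by (rule continuous_on_compose2[OF g(1)]) auto
    qed
    have gsm: "(\<lambda>x. grid_vec m (grid_sum m x)) \<in> borel_measurable (gauss_blocks a m {1..<2 ^ m})"
    proof (rule measurable_coordinatewise_then_product)
      fix l show "(\<lambda>x. grid_vec m (grid_sum m x) l) \<in> borel_measurable (gauss_blocks a m {1..<2 ^ m})"
        using grid_sum_measurable(1)[of "real l / 2 ^ m" m a]
        by (cases "l \<in> {1..2 ^ m}") (auto simp: grid_vec_def dyadic_pts_def)
    qed
    have "g (vec co' (zero_ext {1..<2 ^ m} x)) = g' (grid_vec m (grid_sum m x))" for x
    proof -
      have "vec co' (zero_ext {1..<2 ^ m} x) = (\<lambda>l. co' l * grid_vec m (grid_sum m x) l)"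
        by (auto simp: vec_def grid_vec_def grid_sum_dyadic zero_ext_def fun_eq_iff intro!: sum.cong)
      then show ?thesis by (simp add: g'_def)
    qed
    then have "(\<integral>x. g (vec co' (zero_ext {1..<2 ^ m} x)) \<partial>gauss_blocks a m {1..<2 ^ m}) = (\<integral>x. g' (grid_vec m (grid_sum m x)) \<partial>gauss_blocks a m {1..<2 ^ m})"
      by simp
    also have "\<dots> = (\<integral>v. g' v \<partial>distr (gauss_blocks a m {1..<2 ^ m}) borel (\<lambda>x. grid_vec m (grid_sum m x)))"
      by (rule integral_distr[OF gsm g'm, symmetric])
    also have "\<dots> = (\<integral>v. g' v \<partial>distr M borel (grid_vec m))" unfolding M ..
    also have "\<dots> = (\<integral>w. g' (grid_vec m w) \<partial>M)" by (rule integral_distr[OF Mm g'm])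
    also have "\<dots> = (\<integral>w. g (grid_vec m (level_path a w)) \<partial>M)"
    proof -
      have "(\<lambda>l. co' l * grid_vec m w l) = grid_vec m (level_path a w)" for w
        by (auto simp: grid_vec_def level_path_def co'_def fun_eq_iff)
      then show ?thesis by (simp add: g'_def)
    qed
    finally show ?thesis .
  qed
  then show ?thesis using Lim_transform_eventually[OF lim2 ev] h(1) by simp
qed

text \<open>Conditioning at most doubles probabilities, as \<open>hit a (n, n)\<close> >= 1/2, so
  the unconditioned modulus is used with \<open>\<rho>\<close> / 2. The passage from times to levels
  costs at most one level, whence \<open>d / 3\<close>: 2 d n / 3 + 1 <= d n once d n >= 3.\<close>

lemma bingo_modulus:
  assumes a: "a > 1" and \<epsilon>: "\<epsilon> > 0" and \<rho>: "\<rho> > 0"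
  obtains \<delta> where "\<delta> > 0"
    "\<forall>\<^sub>F n in sequentially. measure_pmf.prob (cond_pmf (urn_chain a n) (bingo_nn n))
       {xs. \<exists>s t. 0 \<le> s \<and> s \<le> t \<and> t \<le> 1 \<and> t - s \<le> \<delta> \<and> \<epsilon> < \<bar>scaled_Delta n xs t - scaled_Delta n xs s\<bar>} \<le> \<rho>"
proof -
  obtain d where d: "d > 0" and ev: "\<forall>\<^sub>F n in sequentially. measure_pmf.prob (chain_path (down_step a) (2 * n - 2) (n, n))
       {ys. \<exists>j k. 2 \<le> j \<and> j \<le> k \<and> k \<le> 2 * n \<and> real (k - j) \<le> d * real n \<and>
          \<epsilon> * sqrt n < \<bar>imbalance (ys ! (2 * n - k)) - imbalance (ys ! (2 * n - j))\<bar>} \<le> \<rho> / 2"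
    by (rule down_modulus[OF a \<epsilon>, of "\<rho> / 2"]) (use \<rho> in auto)
  have "\<forall>\<^sub>F n in sequentially. 3 \<le> d * real n" using d by real_asymp
  with ev eventually_ge_at_top[of 1]
  have "\<forall>\<^sub>F n in sequentially. measure_pmf.prob (cond_pmf (urn_chain a n) (bingo_nn n))
       {xs. \<exists>s t. 0 \<le> s \<and> s \<le> t \<and> t \<le> 1 \<and> t - s \<le> d / 3 \<and> \<epsilon> < \<bar>scaled_Delta n xs t - scaled_Delta n xs s\<bar>} \<le> \<rho>"
  proof eventually_elim
    case (elim n)
    let ?q = "chain_path (down_step a) (2 * n - 2) (n, n)" and ?L = "{xs. last xs = (1 :: nat, 1 :: nat)}"
    let ?A = "{xs. \<exists>s t. 0 \<le> s \<and> s \<le> t \<and> t \<le> 1 \<and> t - s \<le> d / 3 \<and> \<epsilon> < \<bar>scaled_Delta n xs t - scaled_Delta n xs s\<bar>}"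
    let ?E = "{ys. \<exists>j k. 2 \<le> j \<and> j \<le> k \<and> k \<le> 2 * n \<and> real (k - j) \<le> d * real n \<and>
          \<epsilon> * sqrt n < \<bar>imbalance (ys ! (2 * n - k)) - imbalance (ys ! (2 * n - j))\<bar>}"
    have "measure_pmf.prob (cond_pmf (urn_chain a n) (bingo_nn n)) ?A =
        measure_pmf.expectation (cond_pmf (urn_chain a n) (bingo_nn n)) (indicator ?A)" by simp
    also have "\<dots> = measure_pmf.expectation ?q (\<lambda>ys. indicator ?L ys * indicator ?A (rev ys)) / hit a (n, n)"
      by (rule expectation_bingo[OF a elim(2)])
    also have "\<dots> \<le> measure_pmf.expectation ?q (indicator ?E) / hit a (n, n)"
    proof (intro divide_right_mono hit_bounds expectation_mono_finite)
      fix ys assume ys: "ys \<in> set_pmf ?q"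
      have len: "length ys = Suc (2 * n - 2)" using chain_path_hd_length[OF ys] by simp
      have "ys \<in> ?E" if L: "ys \<in> ?L" and A: "rev ys \<in> ?A"
      proof -
        obtain s t where st: "0 \<le> s" "s \<le> t" "t \<le> 1" "t - s \<le> d / 3" "\<epsilon> < \<bar>scaled_Delta n (rev ys) t - scaled_Delta n (rev ys) s\<bar>"
          using A by auto
        have l0: "imbalance (ys ! (2 * n - 2)) = 0"
        proof -
          have "ys \<noteq> []" using len by auto
          then have "ys ! (2 * n - 2) = last ys" using len by (simp add: last_conv_nth)
          then show ?thesis using L by (simp add: imbalance_def)
        qed
        define idx where "idx t = nat \<lfloor>2 * real n * t\<rfloor>" for t
        \<comment> \<open>Below level 2 the process is 0 by definition, as it is at level 2 on the
          conditioned event; the index may therefore be raised to 2.\<close>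
        have sd: "scaled_Delta n (rev ys) u = imbalance (ys ! (2 * n - max 2 (idx u))) / sqrt n" if "0 \<le> u" "u \<le> 1" for u
        proof (cases "idx u < 2")
          case True
          then show ?thesis using l0 by (simp add: scaled_Delta_def idx_def[symmetric] Delta_def max_def)
        next
          case False
          have "2 * real n * u \<le> 2 * real n * 1" using that by (intro mult_left_mono) auto
          then have "\<lfloor>2 * real n * u\<rfloor> \<le> int (2 * n)" by (simp add: floor_le_iff)
          then have "idx u \<le> 2 * n" unfolding idx_def by linarith
          then show ?thesis using False Delta_rev[OF len, of "idx u"] by (simp add: scaled_Delta_def idx_def[symmetric] max_def)
        qed
        define j k where "j = max 2 (idx s)" and "k = max 2 (idx t)"
        have st2: "2 * real n * s \<le> 2 * real n * t" using st by (intro mult_left_mono) auto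
        then have ij: "idx s \<le> idx t" unfolding idx_def by (intro nat_mono floor_mono)
        have "2 * real n * t \<le> 2 * real n * 1" using st by (intro mult_left_mono) auto
        then have "\<lfloor>2 * real n * t\<rfloor> \<le> int (2 * n)" by (simp add: floor_le_iff)
        then have kn: "idx t \<le> 2 * n" unfolding idx_def by linarith
        have n2: "2 \<le> 2 * n" using elim(2) by simp
        have "real (idx t) - real (idx s) \<le> 2 * real n * t - 2 * real n * s + 1"
        proof -
          have "0 \<le> 2 * real n * s" "0 \<le> 2 * real n * t" using st by auto
          then have "real (idx t) = of_int \<lfloor>2 * real n * t\<rfloor>" "real (idx s) = of_int \<lfloor>2 * real n * s\<rfloor>" by (auto simp: idx_def)
          then show ?thesis by linarith
        qed
        also have "2 * real n * t - 2 * real n * s = 2 * real n * (t - s)" by (simp add: algebra_simps)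
        also have "\<dots> \<le> 2 * real n * (d / 3)" using st by (intro mult_left_mono) auto
        also have "2 * real n * (d / 3) + 1 = 2 / 3 * (d * real n) + 1" by simp
        also have "\<dots> \<le> d * real n" using elim(3) by linarith
        finally have "real (idx t) - real (idx s) \<le> d * real n" by simp
        moreover have "k - j \<le> idx t - idx s" using ij unfolding j_def k_def by linarith
        then have "real (k - j) \<le> real (idx t) - real (idx s)" using ij by linarith
        ultimately have "real (k - j) \<le> d * real n" by linarith
        moreover have "\<epsilon> * sqrt n < \<bar>imbalance (ys ! (2 * n - k)) - imbalance (ys ! (2 * n - j))\<bar>"
        proof -
          have "\<epsilon> < \<bar>(imbalance (ys ! (2 * n - k)) - imbalance (ys ! (2 * n - j))) / sqrt n\<bar>"
            using st(5) sd[of t] sd[of s] st by (simp add: j_def k_def diff_divide_distrib)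
          then show ?thesis using elim(2) by (simp add: abs_divide less_divide_eq)
        qed
        moreover have "2 \<le> j" "j \<le> k" "k \<le> 2 * n" using ij kn n2 by (auto simp: j_def k_def)
        ultimately show ?thesis by blast
      qed
      then show "indicator ?L ys * indicator ?A (rev ys) \<le> (indicator ?E ys :: real)"
        by (auto simp: indicator_def)
    qed auto
    also have "\<dots> = measure_pmf.prob ?q ?E / hit a (n, n)" by simp
    also have "\<dots> \<le> (\<rho> / 2) / (1 / 2)"
      using elim(1) hit_balanced_ge_half[OF a elim(2)] \<rho> by (intro frac_le) auto
    finally show ?case by simp
  qed
  then show ?thesis using that[of "d / 3"] d by simp
qed

section \<open>Continuous extension\<close>

lemma dyadic_ratio:
  assumes "m \<le> k" shows "real (l * 2 ^ (k - m)) / 2 ^ k = real l / 2 ^ m"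
proof -
  have "(2::real) ^ k = 2 ^ m * 2 ^ (k - m)" using assms by (simp flip: power_add)
  then show ?thesis by simp
qed

abbreviation grid_path :: "real \<Rightarrow> nat \<Rightarrow> (real \<Rightarrow> real) \<Rightarrow> nat \<Rightarrow> real" where
  "grid_path a m w \<equiv> grid_vec m (level_path a w)"

locale dyadic_gauss =
  fixes a :: real and M :: "(real \<Rightarrow> real) measure"
  assumes a: "a > 1" and prob_M: "prob_space M"
    and coord: "\<And>t. t \<in> (\<Union>m. dyadic_pts m) \<Longrightarrow> (\<lambda>w. w t) \<in> borel_measurable M"
    and law: "\<And>m. m \<ge> 1 \<Longrightarrow> distr M borel (grid_vec m) = distr (gauss_blocks a m {1..<2 ^ m}) borel (\<lambda>x. grid_vec m (grid_sum m x))"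
begin

sublocale prob_space M by (rule prob_M)

lemma measurable_grid_vec: "grid_vec m \<in> borel_measurable M"
proof (rule measurable_coordinatewise_then_product)
  fix l show "(\<lambda>f. grid_vec m f l) \<in> borel_measurable M"
  proof (cases "l \<in> {1..2 ^ m}")
    case True
    then have "real l / 2 ^ m \<in> (\<Union>m. dyadic_pts m)" by (intro UN_I[of m]) (auto simp: dyadic_pts_def)
    from coord[OF this] True show ?thesis by (simp add: grid_vec_def)
  next
    case False
    then have "(\<lambda>f. grid_vec m f l) = (\<lambda>_. 0)" by (auto simp: grid_vec_def)
    then show ?thesis by simp
  qed
qed

lemma measurable_grid_path: "(\<lambda>w. grid_path a m w l) \<in> borel_measurable M"
proof -
  have "(\<lambda>w. grid_vec m w l) \<in> borel_measurable M"
    using measurable_product_then_coordinatewise[OF measurable_grid_vec] .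
  then have "(\<lambda>w. gcoef a * (real l / 2 ^ m) powr a * grid_vec m w l) \<in> borel_measurable M"
    by (intro borel_measurable_times borel_measurable_const)
  moreover have e: "grid_path a m w l = gcoef a * (real l / 2 ^ m) powr a * grid_vec m w l" for w
    by (simp add: grid_vec_def level_path_def)
  ultimately show ?thesis by (simp only: e)
qed

lemma measurable_grid_path_vec: "(\<lambda>w. grid_path a m w) \<in> borel_measurable M"
  by (rule measurable_coordinatewise_then_product) (rule measurable_grid_path)

definition far_pair :: "nat \<Rightarrow> real \<Rightarrow> real \<Rightarrow> (nat \<Rightarrow> real) \<Rightarrow> bool" where
  "far_pair m \<delta> \<epsilon> v \<longleftrightarrow> (\<exists>l l'. l \<le> 2 ^ m \<and> l' \<le> 2 ^ m \<and> \<bar>real l - real l'\<bar> / 2 ^ m \<le> \<delta> \<and> \<epsilon> < \<bar>v l - v l'\<bar>)"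

lemma measurable_far_pair: "Measurable.pred M (\<lambda>w. far_pair m \<delta> \<epsilon> (grid_path a m w))"
  unfolding far_pair_def
proof (intro pred_intros_countable)
  fix l l' :: nat
  have "Measurable.pred M (\<lambda>w. \<epsilon> < \<bar>grid_path a m w l - grid_path a m w l'\<bar>)"
    by (intro borel_measurable_pred_less borel_measurable_const borel_measurable_abs borel_measurable_diff measurable_grid_path)
  then show "Measurable.pred M (\<lambda>w. l \<le> 2 ^ m \<and> l' \<le> 2 ^ m \<and> \<bar>real l - real l'\<bar> / 2 ^ m \<le> \<delta> \<and> \<epsilon> < \<bar>grid_path a m w l - grid_path a m w l'\<bar>)"
    by (cases "l \<le> 2 ^ m \<and> l' \<le> 2 ^ m \<and> \<bar>real l - real l'\<bar> / 2 ^ m \<le> \<delta>") auto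
qed

text \<open>The modulus of the conditioned urn holds for every dyadic grid at once; passing to the
  limit on each grid gives the limit process a \<open>\<delta>\<close> that does not depend on
  m.\<close>

lemma grid_modulus:
  assumes \<epsilon>: "\<epsilon> > 0" and \<rho>: "\<rho> > 0"
  obtains \<delta> where "\<delta> > 0" "\<And>m. m \<ge> 1 \<Longrightarrow> prob {w \<in> space M. far_pair m \<delta> (2 * \<epsilon>) (grid_path a m w)} \<le> \<rho>"
proof -
  obtain \<delta> where \<delta>: "\<delta> > 0" and ev: "\<forall>\<^sub>F n in sequentially. measure_pmf.prob (cond_pmf (urn_chain a n) (bingo_nn n))
       {xs. \<exists>s t. 0 \<le> s \<and> s \<le> t \<and> t \<le> 1 \<and> t - s \<le> \<delta> \<and> \<epsilon> < \<bar>scaled_Delta n xs t - scaled_Delta n xs s\<bar>} \<le> \<rho>"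
    using bingo_modulus[OF a \<epsilon> \<rho>] by blast
  show ?thesis
  proof (rule that[OF \<delta>])
    fix m :: nat assume m: "m \<ge> 1"
    define I where "I = {p \<in> {..2 ^ m} \<times> {..2 ^ m}. \<bar>real (fst p) - real (snd p)\<bar> / 2 ^ m \<le> \<delta>}"
    have finI: "finite I" unfolding I_def by (rule finite_subset[of _ "{..2 ^ m} \<times> {..2 ^ m}"]) auto
    \<comment> \<open>A bounded continuous function lying between the indicators of
      \<open>far_pair\<close> at thresholds 2 \<open>\<epsilon>\<close> and
      \<open>\<epsilon>\<close>, since indicators themselves are not admissible test
      functions.\<close>
    define g where "g v = min 1 (\<Sum>p\<in>I. max 0 ((\<bar>v (fst p) - v (snd p)\<bar> - \<epsilon>) / \<epsilon>))" for v :: "nat \<Rightarrow> real"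
    have g0: "0 \<le> g v" "g v \<le> 1" for v unfolding g_def by (auto intro!: sum_nonneg)
    then have gb: "\<bar>g v\<bar> \<le> 1" for v by (simp add: abs_le_iff order_trans[of "- g v" 0])
    have gc: "continuous_on UNIV g" unfolding g_def
      using \<epsilon> by (intro continuous_intros continuous_on_product_coordinates) auto
    have gi: "indicator {v. far_pair m \<delta> (2 * \<epsilon>) v} v \<le> g v" for v
    proof (cases "far_pair m \<delta> (2 * \<epsilon>) v")
      case True
      then obtain l l' where l: "l \<le> 2 ^ m" "l' \<le> 2 ^ m" "\<bar>real l - real l'\<bar> / 2 ^ m \<le> \<delta>" "2 * \<epsilon> < \<bar>v l - v l'\<bar>"
        by (auto simp: far_pair_def)
      then have p: "(l, l') \<in> I" by (simp add: I_def)
      have "1 \<le> (\<bar>v l - v l'\<bar> - \<epsilon>) / \<epsilon>" using l(4) \<epsilon> by (simp add: le_divide_eq)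
      also have "\<dots> \<le> max 0 ((\<bar>v (fst (l, l')) - v (snd (l, l'))\<bar> - \<epsilon>) / \<epsilon>)" by simp
      also have "\<dots> \<le> (\<Sum>p\<in>I. max 0 ((\<bar>v (fst p) - v (snd p)\<bar> - \<epsilon>) / \<epsilon>))"
        by (rule member_le_sum[OF p]) (auto simp: finI)
      finally have "g v = 1" by (simp add: g_def)
      then show ?thesis by (simp add: indicator_def)
    qed (simp add: g0)
    have gz: "g v = 0" if "\<not> far_pair m \<delta> \<epsilon> v" for v
    proof -
      have "(\<Sum>p\<in>I. max 0 ((\<bar>v (fst p) - v (snd p)\<bar> - \<epsilon>) / \<epsilon>)) = 0"
      proof (intro sum.neutral ballI)
        fix p assume "p \<in> I"
        then have "\<bar>v (fst p) - v (snd p)\<bar> \<le> \<epsilon>" using that by (force simp: far_pair_def I_def)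
        then have "(\<bar>v (fst p) - v (snd p)\<bar> - \<epsilon>) / \<epsilon> \<le> 0" using \<epsilon> by (simp add: divide_le_0_iff)
        then show "max 0 ((\<bar>v (fst p) - v (snd p)\<bar> - \<epsilon>) / \<epsilon>) = 0" by (rule max_absorb1)
      qed
      then show ?thesis by (simp add: g_def)
    qed
    have lim: "(\<lambda>n. measure_pmf.expectation (cond_pmf (urn_chain a n) (bingo_nn n)) (\<lambda>xs. g (grid_vec m (scaled_Delta n xs))))
      \<longlonglongrightarrow> (\<integral>w. g (grid_path a m w) \<partial>M)"
      by (rule fdd_limit[OF a m gc gb law[OF m] measurable_grid_vec])
    have "(\<integral>w. g (grid_path a m w) \<partial>M) \<le> \<rho>"
    proof (rule tendsto_upperbound[OF lim])
      show "\<forall>\<^sub>F n in sequentially. measure_pmf.expectation (cond_pmf (urn_chain a n) (bingo_nn n)) (\<lambda>xs. g (grid_vec m (scaled_Delta n xs))) \<le> \<rho>"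
        using ev
      proof eventually_elim
        case (elim n)
        let ?A = "{xs. \<exists>s t. 0 \<le> s \<and> s \<le> t \<and> t \<le> 1 \<and> t - s \<le> \<delta> \<and> \<epsilon> < \<bar>scaled_Delta n xs t - scaled_Delta n xs s\<bar>}"
        have "g (grid_vec m (scaled_Delta n xs)) \<le> indicator ?A xs" for xs
        proof (cases "xs \<in> ?A")
          case False
          have gv: "grid_vec m (scaled_Delta n xs) l = scaled_Delta n xs (real l / 2 ^ m)" if "l \<le> 2 ^ m" for l
            using that by (cases "l = 0") (auto simp: grid_vec_def scaled_Delta_def Delta_def)
          have "\<not> far_pair m \<delta> \<epsilon> (grid_vec m (scaled_Delta n xs))"
          proof
            assume "far_pair m \<delta> \<epsilon> (grid_vec m (scaled_Delta n xs))"
            then obtain l l' where l: "l \<le> 2 ^ m" "l' \<le> 2 ^ m" "\<bar>real l - real l'\<bar> / 2 ^ m \<le> \<delta>"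
              "\<epsilon> < \<bar>scaled_Delta n xs (real l / 2 ^ m) - scaled_Delta n xs (real l' / 2 ^ m)\<bar>"
              by (auto simp: far_pair_def gv)
            define s t where "s = real (min l l') / 2 ^ m" and "t = real (max l l') / 2 ^ m"
            have le1: "real (max l l') \<le> 2 ^ m" using l by (simp add: max_def)
            have "0 \<le> s \<and> s \<le> t \<and> t \<le> 1 \<and> t - s \<le> \<delta> \<and> \<epsilon> < \<bar>scaled_Delta n xs t - scaled_Delta n xs s\<bar>"
              using l le1 by (auto simp: s_def t_def divide_right_mono min_def max_def diff_divide_distrib[symmetric] abs_if split: if_splits)
            then show False using False by blast
          qed
          then show ?thesis by (simp add: gz)
        qed (simp add: g0)
        then have "measure_pmf.expectation (cond_pmf (urn_chain a n) (bingo_nn n)) (\<lambda>xs. g (grid_vec m (scaled_Delta n xs)))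
          \<le> measure_pmf.expectation (cond_pmf (urn_chain a n) (bingo_nn n)) (indicator ?A)"
          by (intro integral_mono measure_pmf.integrable_const_bound[where B=1]) (auto simp: gb)
        then show ?case using elim by simp
      qed
    qed simp
    moreover have "prob {w \<in> space M. far_pair m \<delta> (2 * \<epsilon>) (grid_path a m w)} \<le> (\<integral>w. g (grid_path a m w) \<partial>M)"
    proof -
      have "prob {w \<in> space M. far_pair m \<delta> (2 * \<epsilon>) (grid_path a m w)} = (\<integral>w. indicator {w \<in> space M. far_pair m \<delta> (2 * \<epsilon>) (grid_path a m w)} w \<partial>M)"
        by (simp, rule arg_cong[where f=prob], auto)
      also have "\<dots> \<le> (\<integral>w. g (grid_path a m w) \<partial>M)"
      proof (intro integral_mono integrable_const_bound[where B=1])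
        show "(\<lambda>w. g (grid_path a m w)) \<in> borel_measurable M"
          using measurable_compose[OF measurable_grid_path_vec borel_measurable_continuous_onI[OF gc]] .
        show "indicator {w \<in> space M. far_pair m \<delta> (2 * \<epsilon>) (grid_path a m w)} w \<le> g (grid_path a m w)" for w
          using gi[of "grid_path a m w"] g0[of "grid_path a m w"] by (auto simp: indicator_def split: if_splits)
      qed (auto simp: gb intro!: borel_measurable_indicator predE[OF measurable_far_pair])
      finally show ?thesis .
    qed
    ultimately show "prob {w \<in> space M. far_pair m \<delta> (2 * \<epsilon>) (grid_path a m w)} \<le> \<rho>" by linarith
  qed
qed

section \<open>Paths with a modulus on all dyadic grids\<close>

definition regular :: "nat \<Rightarrow> nat \<Rightarrow> (real \<Rightarrow> real) \<Rightarrow> bool" where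
  "regular p q w \<longleftrightarrow> (\<forall>m. \<not> far_pair (Suc m) (1 / real (Suc q)) (1 / real (Suc p)) (grid_path a (Suc m) w))"

text \<open>Uniform continuity on the dyadic points, with countable quantifiers only, so that it is
  a measurable event.\<close>

definition good :: "(real \<Rightarrow> real) \<Rightarrow> bool" where
  "good w \<longleftrightarrow> (\<forall>p. \<exists>q. regular p q w)"

lemma measurable_regular: "Measurable.pred M (regular p q)"
  unfolding regular_def by (intro pred_intros_countable pred_intros_logic measurable_far_pair)

lemma measurable_good: "Measurable.pred M good"
  unfolding good_def by (intro pred_intros_countable measurable_regular)

lemma grid_vec_refine:
  assumes "l \<le> 2 ^ m" "m \<le> k"
  shows "grid_vec k f (l * 2 ^ (k - m)) = grid_vec m f l"
proof -
  have "(2::nat) ^ k = 2 ^ m * 2 ^ (k - m)" using assms(2) by (simp flip: power_add)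
  then have "l * 2 ^ (k - m) \<in> {1..2 ^ k} \<longleftrightarrow> l \<in> {1..2 ^ m}" by auto
  then show ?thesis unfolding grid_vec_def dyadic_ratio[OF assms(2)] by simp
qed

lemma far_pair_Suc:
  assumes "far_pair m \<delta> \<epsilon> (grid_vec m f)" shows "far_pair (Suc m) \<delta> \<epsilon> (grid_vec (Suc m) f)"
proof -
  obtain l l' where l: "l \<le> 2 ^ m" "l' \<le> 2 ^ m" "\<bar>real l - real l'\<bar> / 2 ^ m \<le> \<delta>" "\<epsilon> < \<bar>grid_vec m f l - grid_vec m f l'\<bar>"
    using assms by (auto simp: far_pair_def)
  have "grid_vec (Suc m) f (l * 2) = grid_vec m f l" "grid_vec (Suc m) f (l' * 2) = grid_vec m f l'"
    using grid_vec_refine[of l m "Suc m" f] grid_vec_refine[of l' m "Suc m" f] l by auto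
  moreover have "\<bar>real (l * 2) - real (l' * 2)\<bar> / 2 ^ Suc m = \<bar>real l - real l'\<bar> / 2 ^ m"
  proof -
    have "real (l * 2) - real (l' * 2) = 2 * (real l - real l')" by simp
    then show ?thesis by (simp only: abs_mult) simp
  qed
  ultimately show ?thesis unfolding far_pair_def using l
    by (intro exI[of _ "l * 2"] exI[of _ "l' * 2"]) auto
qed

lemma far_pair_mono:
  assumes "\<delta> \<le> \<delta>'" "far_pair m \<delta> \<epsilon> v" shows "far_pair m \<delta>' \<epsilon> v"
proof -
  obtain l l' where "l \<le> 2 ^ m" "l' \<le> 2 ^ m" "\<bar>real l - real l'\<bar> / 2 ^ m \<le> \<delta>" "\<epsilon> < \<bar>v l - v l'\<bar>"
    using assms(2) by (auto simp: far_pair_def)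
  then show ?thesis unfolding far_pair_def using assms(1)
    by (intro exI[of _ l] exI[of _ l'] conjI) auto
qed

text \<open>Grids are nested, so violations on grid m increase with m. A probability bound uniform
  in m therefore holds for their union, and it can be made arbitrarily small.\<close>

lemma AE_good: "AE w in M. good w"
  unfolding good_def
proof (subst AE_all_countable, rule allI)
  fix p :: nat
  define \<epsilon> where "\<epsilon> = 1 / real (Suc p) / 2"
  have \<epsilon>: "\<epsilon> > 0" by (simp add: \<epsilon>_def)
  have \<epsilon>2: "2 * \<epsilon> = 1 / real (Suc p)" unfolding \<epsilon>_def by (rule nonzero_mult_div_cancel_left[of 2 "1 / real (Suc p)", unfolded times_divide_eq_right[symmetric]]) simp
  let ?N = "{w \<in> space M. \<not> (\<exists>q. regular p q w)}"
  have sN: "?N \<in> sets M"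
    by (intro predE pred_intros_countable pred_intros_logic measurable_regular)
  have bd: "prob ?N \<le> \<rho>" if \<rho>: "\<rho> > 0" for \<rho>
  proof -
    obtain \<delta> where \<delta>: "\<delta> > 0" "\<And>m. m \<ge> 1 \<Longrightarrow> prob {w \<in> space M. far_pair m \<delta> (2 * \<epsilon>) (grid_path a m w)} \<le> \<rho>"
      using grid_modulus[OF \<epsilon> \<rho>] by blast
    obtain q where q: "1 / real (Suc q) < \<delta>" using nat_approx_posE[OF \<delta>(1)] by blast
    let ?B = "\<lambda>m. {w \<in> space M. far_pair (Suc m) (1 / real (Suc q)) (1 / real (Suc p)) (grid_path a (Suc m) w)}"
    have inc: "incseq ?B" by (rule incseq_SucI) (auto intro: far_pair_Suc)
    have sB: "?B m \<in> sets M" for m by (rule predE[OF measurable_far_pair])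
    have "prob ?N \<le> prob (\<Union>m. ?B m)"
    proof (rule finite_measure_mono)
      show "?N \<subseteq> (\<Union>m. ?B m)" by (auto simp: regular_def)
      show "(\<Union>m. ?B m) \<in> sets M" using sB by (intro sets.countable_UN) blast
    qed
    also have "\<dots> \<le> \<rho>"
    proof (rule LIMSEQ_le_const2)
      show "(\<lambda>m. prob (?B m)) \<longlonglongrightarrow> prob (\<Union>m. ?B m)"
        by (rule finite_Lim_measure_incseq[OF _ inc]) (use sB in blast)
      have "prob (?B m) \<le> \<rho>" for m
      proof -
        have "prob (?B m) \<le> prob {w \<in> space M. far_pair (Suc m) \<delta> (2 * \<epsilon>) (grid_path a (Suc m) w)}"
        proof (rule finite_measure_mono)
          show "?B m \<subseteq> {w \<in> space M. far_pair (Suc m) \<delta> (2 * \<epsilon>) (grid_path a (Suc m) w)}"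
            unfolding \<epsilon>2 using far_pair_mono[OF less_imp_le[OF q]] by auto
        qed (rule predE[OF measurable_far_pair])
        also have "\<dots> \<le> \<rho>" by (rule \<delta>(2)) simp
        finally show ?thesis .
      qed
      then show "\<exists>N. \<forall>m\<ge>N. prob (?B m) \<le> \<rho>" by blast
    qed
    finally show ?thesis .
  qed
  have "prob ?N \<le> 0"
  proof (rule field_le_epsilon)
    fix e :: real assume "e > 0"
    from bd[OF this] show "prob ?N \<le> 0 + e" by (simp only: add_0)
  qed
  then have "prob ?N = 0" by (simp only: measure_le_0_iff)
  then show "AE w in M. \<exists>q. regular p q w"
    using sN by (intro AE_I[of _ _ ?N]) (auto simp: emeasure_eq_measure)
qed

definition dy_idx :: "nat \<Rightarrow> real \<Rightarrow> nat" where
  "dy_idx k t = nat \<lfloor>max 0 (min 1 t) * 2 ^ k\<rfloor>"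

text \<open>Limit along dyadic points rounded down from t. The zero path outside \<open>good\<close>
  makes every path continuous, as the process is required to be continuous for each sample
  point.\<close>

definition G :: "(real \<Rightarrow> real) \<Rightarrow> real \<Rightarrow> real" where
  "G w t = (if good w then lim (\<lambda>k. grid_path a (Suc k) w (dy_idx (Suc k) t)) else 0)"

lemma measurable_G: "(\<lambda>w. G w t) \<in> borel_measurable M"
proof -
  have "(\<lambda>w. lim (\<lambda>k. grid_path a (Suc k) w (dy_idx (Suc k) t))) \<in> borel_measurable M"
    by (rule borel_measurable_lim_metric) (rule measurable_grid_path)
  then show ?thesis unfolding G_def
    by (rule measurable_If) (auto intro: predE[OF measurable_good])
qed

lemma dy_idx_le: "dy_idx k t \<le> 2 ^ k"
proof -
  have "max 0 (min 1 t) * 2 ^ k \<le> 1 * 2 ^ k" by (intro mult_right_mono) auto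
  also have "\<dots> = real (2 ^ k)" by simp
  finally have "\<lfloor>max 0 (min 1 t) * 2 ^ k\<rfloor> \<le> int (2 ^ k)" by (metis floor_mono floor_of_nat)
  then show ?thesis unfolding dy_idx_def nat_le_iff .
qed

lemma dy_idx_bounds:
  assumes "0 \<le> t" "t \<le> 1"
  shows "real (dy_idx k t) / 2 ^ k \<le> t" "t - 1 / 2 ^ k \<le> real (dy_idx k t) / 2 ^ k"
proof -
  have c: "max 0 (min 1 t) = t" using assms by auto
  have r: "real (dy_idx k t) = of_int \<lfloor>t * 2 ^ k\<rfloor>" using assms by (simp add: dy_idx_def c)
  have "of_int \<lfloor>t * 2 ^ k\<rfloor> \<le> t * 2 ^ k" "t * 2 ^ k - 1 \<le> of_int \<lfloor>t * 2 ^ k\<rfloor>" by linarith+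
  note b = this
  show "real (dy_idx k t) / 2 ^ k \<le> t" unfolding r using b(1) by (simp add: divide_le_eq)
  have "t - 1 / 2 ^ k = (t * 2 ^ k - 1) / 2 ^ k" by (simp add: diff_divide_distrib)
  also have "\<dots> \<le> real (dy_idx k t) / 2 ^ k" unfolding r using b(2) by (intro divide_right_mono) auto
  finally show "t - 1 / 2 ^ k \<le> real (dy_idx k t) / 2 ^ k" .
qed

text \<open>The coarse point also lies on the finer grid, where regularity applies. Both roundings
  are downwards, so the distance exceeds |s - t| by at most the larger mesh.\<close>

lemma regular_close:
  assumes reg: "regular p q w" and st: "0 \<le> s" "s \<le> 1" "0 \<le> t" "t \<le> 1" and jk: "1 \<le> j" "j \<le> k"
    and d: "\<bar>s - t\<bar> + 1 / 2 ^ j \<le> 1 / real (Suc q)"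
  shows "\<bar>grid_path a j w (dy_idx j s) - grid_path a k w (dy_idx k t)\<bar> \<le> 1 / real (Suc p)"
proof -
  obtain k' where k': "k = Suc k'" using jk by (cases k) auto
  let ?l = "dy_idx j s * 2 ^ (k - j)"
  have e: "grid_path a j w (dy_idx j s) = grid_path a k w ?l"
    using grid_vec_refine[OF dy_idx_le jk(2)] by simp
  have "?l \<le> 2 ^ j * 2 ^ (k - j)" using dy_idx_le by (intro mult_right_mono) auto
  then have l: "?l \<le> 2 ^ k" using jk by (simp flip: power_add)
  have r: "real ?l / 2 ^ k = real (dy_idx j s) / 2 ^ j" by (rule dyadic_ratio[OF jk(2)])
  have p: "(1::real) / 2 ^ k \<le> 1 / 2 ^ j" using jk by (intro divide_left_mono power_increasing) auto
  have "\<bar>real ?l - real (dy_idx k t)\<bar> / 2 ^ k = \<bar>real ?l / 2 ^ k - real (dy_idx k t) / 2 ^ k\<bar>"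
    by (simp add: abs_divide flip: diff_divide_distrib)
  also have "\<dots> \<le> \<bar>s - t\<bar> + 1 / 2 ^ j"
    unfolding r using dy_idx_bounds[OF st(1,2), of j] dy_idx_bounds[OF st(3,4), of k] p by linarith
  also note d
  finally have "\<bar>real ?l - real (dy_idx k t)\<bar> / 2 ^ k \<le> 1 / real (Suc q)" .
  then have "\<not> 1 / real (Suc p) < \<bar>grid_path a k w ?l - grid_path a k w (dy_idx k t)\<bar>"
    using reg[unfolded regular_def, rule_format, of k'] l dy_idx_le[of k t]
    unfolding k'[symmetric] far_pair_def by blast
  then show ?thesis unfolding e by simp
qed

lemma ex_half_power_le: obtains j where "j \<ge> 1" "(1::real) / 2 ^ j \<le> 1 / (2 * real (Suc q))"
proof -
  obtain n where n: "(1 / 2 :: real) ^ n < 1 / (2 * real (Suc q))"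
    using real_arch_pow_inv[of "1 / (2 * real (Suc q))" "1 / 2"] by auto
  have "(1 / 2 :: real) ^ Suc n \<le> (1 / 2) ^ n" by (intro power_decreasing) auto
  then show ?thesis using n by (intro that[of "Suc n"]) (auto simp: power_one_over)
qed

lemma grid_path_tendsto_G:
  assumes w: "good w" and t: "0 \<le> t" "t \<le> 1"
  shows "(\<lambda>k. grid_path a (Suc k) w (dy_idx (Suc k) t)) \<longlonglongrightarrow> G w t"
proof -
  let ?X = "\<lambda>k. grid_path a (Suc k) w (dy_idx (Suc k) t)"
  have "Cauchy ?X"
    unfolding Cauchy_altdef
  proof (intro allI impI)
    fix e :: real assume "e > 0"
    then obtain p where p: "1 / real (Suc p) < e" using nat_approx_posE by blast
    obtain q where q: "regular p q w" using w by (auto simp: good_def)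
    obtain j where j: "j \<ge> 1" "(1::real) / 2 ^ j \<le> 1 / (2 * real (Suc q))" by (rule ex_half_power_le)
    have "dist (?X m) (?X n) < e" if "m \<ge> j" "n > m" for m n
    proof -
      have "(1::real) / 2 ^ Suc m \<le> 1 / 2 ^ j" using that by (intro divide_left_mono power_increasing) auto
      also have "\<dots> \<le> 1 / real (Suc q)" using j(2) by (rule order_trans) (intro divide_left_mono; simp)
      finally have "\<bar>?X m - ?X n\<bar> \<le> 1 / real (Suc p)"
        using that t by (intro regular_close[OF q]) auto
      then show ?thesis using p by (simp add: dist_real_def)
    qed
    then show "\<exists>M. \<forall>m\<ge>M. \<forall>n>m. dist (?X m) (?X n) < e" by blast
  qed
  then have "convergent ?X" by (simp add: Cauchy_convergent_iff)
  then show ?thesis using w by (simp add: G_def convergent_LIMSEQ_iff)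
qed

lemma G_close:
  assumes w: "good w" and reg: "regular p q w" and st: "0 \<le> s" "s \<le> 1" "0 \<le> t" "t \<le> 1"
    and d: "\<bar>s - t\<bar> \<le> 1 / (2 * real (Suc q))"
  shows "\<bar>G w s - G w t\<bar> \<le> 1 / real (Suc p)"
proof -
  obtain j where j: "j \<ge> 1" "(1::real) / 2 ^ j \<le> 1 / (2 * real (Suc q))" by (rule ex_half_power_le)
  let ?X = "\<lambda>t k. grid_path a (Suc k) w (dy_idx (Suc k) t)"
  have "(\<lambda>k. \<bar>?X s k - ?X t k\<bar>) \<longlonglongrightarrow> \<bar>G w s - G w t\<bar>"
    by (intro tendsto_intros grid_path_tendsto_G w st)
  then show ?thesis
  proof (rule LIMSEQ_le_const2, intro exI[of _ j] allI impI)
    fix k assume k: "j \<le> k"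
    have "(1::real) / 2 ^ Suc k \<le> 1 / 2 ^ j" using k by (intro divide_left_mono power_increasing) auto
    also note j(2)
    finally have "\<bar>s - t\<bar> + 1 / 2 ^ Suc k \<le> 1 / (2 * real (Suc q)) + 1 / (2 * real (Suc q))" using d by linarith
    also have "\<dots> = 1 / real (Suc q)" by (simp add: field_simps)
    finally show "\<bar>?X s k - ?X t k\<bar> \<le> 1 / real (Suc p)" by (intro regular_close[OF reg st]) auto
  qed
qed

lemma continuous_G: "continuous_on {0..1} (G w)"
proof (cases "good w")
  case True
  show ?thesis unfolding continuous_on_iff
  proof (intro ballI allI impI)
    fix s e :: real assume s: "s \<in> {0..1}" and "e > 0"
    then obtain p where p: "1 / real (Suc p) < e" using nat_approx_posE by blast
    obtain q where q: "regular p q w" using True by (auto simp: good_def)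
    show "\<exists>d>0. \<forall>t\<in>{0..1}. dist t s < d \<longrightarrow> dist (G w t) (G w s) < e"
    proof (intro exI[of _ "1 / (2 * real (Suc q))"] conjI ballI impI)
      fix t :: real assume t: "t \<in> {0..1}" "dist t s < 1 / (2 * real (Suc q))"
      then have "\<bar>G w t - G w s\<bar> \<le> 1 / real (Suc p)" using s
        by (intro G_close[OF True q]) (auto simp: dist_real_def)
      then show "dist (G w t) (G w s) < e" using p by (simp add: dist_real_def)
    qed simp
  qed
next
  case False
  then have "G w = (\<lambda>_. 0)" by (auto simp: G_def)
  then show ?thesis by simp
qed

lemma G_dyadic:
  assumes w: "good w" and m: "m \<ge> 1" "l \<le> 2 ^ m"
  shows "G w (real l / 2 ^ m) = grid_path a m w l"
proof -
  have le: "real l / 2 ^ m \<le> 1" using m by (simp add: divide_le_eq_1)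
  have lim: "(\<lambda>k. grid_path a (Suc k) w (dy_idx (Suc k) (real l / 2 ^ m))) \<longlonglongrightarrow> G w (real l / 2 ^ m)"
    using le by (intro grid_path_tendsto_G[OF w]) auto
  have "\<forall>\<^sub>F k in sequentially. grid_path a (Suc k) w (dy_idx (Suc k) (real l / 2 ^ m)) = grid_path a m w l"
    using eventually_ge_at_top[of m]
  proof eventually_elim
    case (elim k)
    have "max 0 (min 1 (real l / 2 ^ m)) = real l / 2 ^ m" using le by simp
    moreover have "real l / 2 ^ m * 2 ^ Suc k = real (l * 2 ^ (Suc k - m))"
      using dyadic_ratio[of m "Suc k" l] elim by (auto simp: field_simps)
    ultimately have "dy_idx (Suc k) (real l / 2 ^ m) = l * 2 ^ (Suc k - m)"
      unfolding dy_idx_def by (simp only: floor_of_nat nat_int)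
    then show ?case using grid_vec_refine[OF m(2), of "Suc k"] elim by simp
  qed
  then have "(\<lambda>k. grid_path a (Suc k) w (dy_idx (Suc k) (real l / 2 ^ m))) \<longlonglongrightarrow> grid_path a m w l"
    by (rule tendsto_eventually)
  then show ?thesis using lim LIMSEQ_unique by blast
qed

end

section \<open>The law of the extension\<close>

lemma sum_bvar:
  assumes "1 \<le> p" "p \<le> 2 ^ m"
  shows "(\<Sum>l\<in>{p..<2 ^ m}. bvar a m l) = (real p / 2 ^ m) powr (1 - 2 * a) - 1"
proof -
  let ?f = "\<lambda>l :: nat. - ((real l / 2 ^ m) powr (1 - 2 * a))"
  have "(\<Sum>l\<in>{p..<2 ^ m}. bvar a m l) = (\<Sum>l\<in>{p..<2 ^ m}. ?f (Suc l) - ?f l)"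
    using assms by (intro sum.cong) (auto simp: bvar_def)
  also have "\<dots> = ?f (2 ^ m) - ?f p" using assms(2) by (rule sum_Suc_diff')
  finally show ?thesis by simp
qed

text \<open>The product of the two deterministic factors and the Brownian covariance: the smaller
  clock value belongs to the larger time.\<close>

lemma G_cov_eq:
  assumes a: "a > 1" and st: "s > 0" "t > 0"
  shows "G_cov a s t = (gcoef a * s powr a) * (gcoef a * t powr a) * ((max s t) powr (1 - 2 * a) - 1)"
proof -
  have g: "gcoef a * gcoef a = 2 / (2 * a - 1)" using a by (simp add: gcoef_def)
  have mm: "s powr a * t powr a = (min s t) powr a * (max s t) powr a" by (simp add: min_def max_def)
  have mx: "max s t > 0" using st by simp
  have "(max s t) powr a * ((max s t) powr (1 - 2 * a) - 1) = (max s t) powr (1 - a) - (max s t) powr a"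
    using mx by (simp add: right_diff_distrib flip: powr_add)
  then have "(gcoef a * gcoef a) * (min s t) powr a * ((max s t) powr a * ((max s t) powr (1 - 2 * a) - 1)) = G_cov a s t"
    unfolding g G_cov_def by simp
  moreover have "(gcoef a * s powr a) * (gcoef a * t powr a) * ((max s t) powr (1 - 2 * a) - 1) =
     (gcoef a * gcoef a) * (s powr a * t powr a) * ((max s t) powr (1 - 2 * a) - 1)" by (simp add: mult_ac)
  ultimately show ?thesis unfolding mm by (simp add: mult_ac)
qed

lemma G_cov_zero: "a > 1 \<Longrightarrow> 0 \<le> t \<Longrightarrow> G_cov a 0 t = 0" "a > 1 \<Longrightarrow> 0 \<le> t \<Longrightarrow> G_cov a t 0 = 0"
  by (auto simp: G_cov_def min_def)

context dyadic_gauss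
begin

text \<open>Summation by parts writes a combination of grid values as a combination of independent
  block variables. In its variance, the blocks common to two points are those to the right of the
  later one, and their variances telescope to the clock.\<close>

lemma grid_linear_law:
  fixes cs :: "nat \<Rightarrow> real" and ls :: "nat \<Rightarrow> nat"
  assumes m: "m \<ge> 1" and ls: "\<And>i. i < N \<Longrightarrow> ls i \<le> 2 ^ m"
  defines "v \<equiv> (\<Sum>i<N. \<Sum>j<N. cs i * cs j * G_cov a (real (ls i) / 2 ^ m) (real (ls j) / 2 ^ m))"
  shows "distr M borel (\<lambda>w. \<Sum>i<N. cs i * grid_path a m w (ls i)) = centered_normal v" "v \<ge> 0"
proof -
  let ?I = "{1..<2 ^ m} :: nat set" and ?Q = "gauss_blocks a m {1..<2 ^ m}"
  define b where "b i = cs i * (gcoef a * (real (ls i) / 2 ^ m) powr a)" for i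
  define \<phi> where "\<phi> u = (\<Sum>i<N. b i * u (ls i))" for u :: "nat \<Rightarrow> real"
  \<comment> \<open>Block \<open>l\<close> contributes to exactly the grid points at or to the left
    of its left end; index 0 carries the value 0 and is left out.\<close>
  define e where "e l = (\<Sum>i<N. if 1 \<le> ls i \<and> ls i \<le> l then b i else 0)" for l
  have \<phi>m: "\<phi> \<in> borel_measurable borel"
    unfolding \<phi>_def by (rule borel_measurable_continuous_onI) (intro continuous_intros continuous_on_product_coordinates)
  have gsm: "(\<lambda>x. grid_vec m (grid_sum m x)) \<in> borel_measurable ?Q"
  proof (rule measurable_coordinatewise_then_product)
    fix l show "(\<lambda>x. grid_vec m (grid_sum m x) l) \<in> borel_measurable ?Q"
      using grid_sum_measurable(1)[of "real l / 2 ^ m" m a]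
      by (cases "l \<in> {1..2 ^ m}") (auto simp: grid_vec_def dyadic_pts_def)
  qed
  have "(2::nat) ^ 1 \<le> 2 ^ m" using m by (intro power_increasing) auto
  then have ne: "?I \<noteq> {}" by (auto simp: ex_in_conv[symmetric] intro!: exI[of _ 1])
  have gp: "(\<Sum>i<N. cs i * grid_path a m w (ls i)) = \<phi> (grid_vec m w)" for w
    unfolding \<phi>_def b_def by (intro sum.cong refl) (simp add: grid_vec_def level_path_def)
  have lin: "\<phi> (grid_vec m (grid_sum m x)) = (\<Sum>l\<in>?I. e l * x l)" for x
  proof -
    have "\<phi> (grid_vec m (grid_sum m x)) = (\<Sum>i<N. \<Sum>l\<in>?I. (if 1 \<le> ls i \<and> ls i \<le> l then b i else 0) * x l)"
      unfolding \<phi>_def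
    proof (intro sum.cong refl)
      fix i assume "i \<in> {..<N}"
      then have li: "ls i \<le> 2 ^ m" using ls by simp
      show "b i * grid_vec m (grid_sum m x) (ls i) = (\<Sum>l\<in>?I. (if 1 \<le> ls i \<and> ls i \<le> l then b i else 0) * x l)"
      proof (cases "1 \<le> ls i")
        case True
        have "(\<Sum>l\<in>?I. (if 1 \<le> ls i \<and> ls i \<le> l then b i else 0) * x l) = (\<Sum>l\<in>?I. if l \<in> {ls i..<2 ^ m} then b i * x l else 0)"
          using True by (intro sum.cong) auto
        also have "\<dots> = (\<Sum>l\<in>?I \<inter> {ls i..<2 ^ m}. b i * x l)" by (rule sum.inter_restrict[symmetric]) simp
        also have "?I \<inter> {ls i..<2 ^ m} = {ls i..<2 ^ m}" using True by auto
        finally show ?thesis using True li by (simp add: grid_vec_def grid_sum_dyadic sum_distrib_left)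
      next
        case False
        then have "ls i = 0" by simp
        then show ?thesis by (simp add: grid_vec_def)
      qed
    qed
    also have "\<dots> = (\<Sum>l\<in>?I. e l * x l)"
      unfolding e_def sum_distrib_right by (rule sum.swap)
    finally show ?thesis .
  qed
  have var: "(\<Sum>l\<in>?I. (e l)\<^sup>2 * bvar a m l) = v"
  proof -
    have "(e l)\<^sup>2 = (\<Sum>i<N. \<Sum>j<N. (if 1 \<le> ls i \<and> ls i \<le> l then b i else 0) * (if 1 \<le> ls j \<and> ls j \<le> l then b j else 0))" for l
      unfolding e_def power2_eq_square by (rule sum_product)
    then have "(\<Sum>l\<in>?I. (e l)\<^sup>2 * bvar a m l) =
      (\<Sum>l\<in>?I. \<Sum>i<N. \<Sum>j<N. (if 1 \<le> ls i \<and> ls i \<le> l then b i else 0) * (if 1 \<le> ls j \<and> ls j \<le> l then b j else 0) * bvar a m l)"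
      by (simp only: sum_distrib_right)
    also have "\<dots> = (\<Sum>i<N. \<Sum>l\<in>?I. \<Sum>j<N. (if 1 \<le> ls i \<and> ls i \<le> l then b i else 0) * (if 1 \<le> ls j \<and> ls j \<le> l then b j else 0) * bvar a m l)"
      by (rule sum.swap)
    also have "\<dots> = (\<Sum>i<N. \<Sum>j<N. \<Sum>l\<in>?I. (if 1 \<le> ls i \<and> ls i \<le> l then b i else 0) * (if 1 \<le> ls j \<and> ls j \<le> l then b j else 0) * bvar a m l)"
      by (intro sum.cong refl sum.swap)
    also have "\<dots> = v" unfolding v_def
    proof (intro sum.cong refl)
      fix i j assume "i \<in> {..<N}" "j \<in> {..<N}"
      then have lij: "ls i \<le> 2 ^ m" "ls j \<le> 2 ^ m" using ls by auto
      let ?s = "real (ls i) / 2 ^ m" and ?t = "real (ls j) / 2 ^ m"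
      show "(\<Sum>l\<in>?I. (if 1 \<le> ls i \<and> ls i \<le> l then b i else 0) * (if 1 \<le> ls j \<and> ls j \<le> l then b j else 0) * bvar a m l) =
        cs i * cs j * G_cov a ?s ?t"
      proof (cases "1 \<le> ls i \<and> 1 \<le> ls j")
        case True
        define p where "p = max (ls i) (ls j)"
        have p: "1 \<le> p" "p \<le> 2 ^ m" using True lij by (auto simp: p_def)
        have "(\<Sum>l\<in>?I. (if 1 \<le> ls i \<and> ls i \<le> l then b i else 0) * (if 1 \<le> ls j \<and> ls j \<le> l then b j else 0) * bvar a m l) =
          (\<Sum>l\<in>?I. if l \<in> {p..<2 ^ m} then b i * b j * bvar a m l else 0)"
          using True by (intro sum.cong) (auto simp: p_def)
        also have "\<dots> = (\<Sum>l\<in>?I \<inter> {p..<2 ^ m}. b i * b j * bvar a m l)" by (rule sum.inter_restrict[symmetric]) simp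
        also have "?I \<inter> {p..<2 ^ m} = {p..<2 ^ m}" using p by auto
        also have "(\<Sum>l\<in>{p..<2 ^ m}. b i * b j * bvar a m l) = b i * b j * ((real p / 2 ^ m) powr (1 - 2 * a) - 1)"
          unfolding sum_bvar[OF p, symmetric] sum_distrib_left ..
        also have "real p / 2 ^ m = max ?s ?t"
        proof (cases "ls i \<le> ls j")
          case True
          then have "?s \<le> ?t" by (intro divide_right_mono) auto
          then show ?thesis using True by (simp add: p_def max_def)
        next
          case False
          then have "?t \<le> ?s" by (intro divide_right_mono) auto
          then show ?thesis using False by (simp add: p_def max_absorb1)
        qed
        also have "b i * b j * ((max ?s ?t) powr (1 - 2 * a) - 1) = cs i * cs j * G_cov a ?s ?t"
        proof -
          have "?s > 0" "?t > 0" using True by auto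
          from G_cov_eq[OF a this] show ?thesis unfolding b_def by (simp add: mult_ac)
        qed
        finally show ?thesis .
      next
        case False
        then have z: "ls i = 0 \<or> ls j = 0" by auto
        then have "(\<Sum>l\<in>?I. (if 1 \<le> ls i \<and> ls i \<le> l then b i else 0) * (if 1 \<le> ls j \<and> ls j \<le> l then b j else 0) * bvar a m l) = 0"
          by (intro sum.neutral) auto
        moreover have "G_cov a ?s ?t = 0" using z G_cov_zero[OF a] by auto
        ultimately show ?thesis by simp
      qed
    qed
    finally show ?thesis .
  qed
  have "distr M borel (\<lambda>w. \<Sum>i<N. cs i * grid_path a m w (ls i)) = distr M borel (\<phi> \<circ> grid_vec m)"
    by (simp add: gp comp_def)
  also have "\<dots> = distr (distr M borel (grid_vec m)) borel \<phi>" by (rule distr_distr[OF \<phi>m measurable_grid_vec, symmetric])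
  also have "\<dots> = distr (distr ?Q borel (\<lambda>x. grid_vec m (grid_sum m x))) borel \<phi>" unfolding law[OF m] ..
  also have "\<dots> = distr ?Q borel (\<phi> \<circ> (\<lambda>x. grid_vec m (grid_sum m x)))" by (rule distr_distr[OF \<phi>m gsm])
  also have "\<dots> = distr ?Q borel (\<lambda>x. \<Sum>l\<in>?I. e l * x l)" by (simp add: comp_def lin)
  also have "\<dots> = centered_normal (\<Sum>l\<in>?I. (e l)\<^sup>2 * bvar a m l)"
    by (rule gauss_blocks_linear[OF a _ ne]) auto
  finally show "distr M borel (\<lambda>w. \<Sum>i<N. cs i * grid_path a m w (ls i)) = centered_normal v" unfolding var .
  show "v \<ge> 0" unfolding var[symmetric] by (intro sum_nonneg mult_nonneg_nonneg bvar_nonneg a) auto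
qed

lemma dy_idx_limit:
  assumes "0 \<le> t" "t \<le> 1"
  shows "(\<lambda>k. real (dy_idx (Suc k) t) / 2 ^ Suc k) \<longlonglongrightarrow> t"
proof (rule tendsto_sandwich)
  show "\<forall>\<^sub>F k in sequentially. t - 1 / 2 ^ Suc k \<le> real (dy_idx (Suc k) t) / 2 ^ Suc k"
    using dy_idx_bounds(2)[OF assms] by (intro always_eventually allI)
  show "\<forall>\<^sub>F k in sequentially. real (dy_idx (Suc k) t) / 2 ^ Suc k \<le> t"
    using dy_idx_bounds(1)[OF assms] by (intro always_eventually allI)
  have "(\<lambda>k. 1 / 2 ^ Suc k :: real) \<longlonglongrightarrow> 0" by real_asymp
  from tendsto_diff[OF tendsto_const this] show "(\<lambda>k. t - 1 / 2 ^ Suc k) \<longlonglongrightarrow> t" by simp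
qed simp

lemma G_cov_limit:
  assumes s: "0 \<le> s" "s \<le> 1" and t: "0 \<le> t" "t \<le> 1"
  shows "(\<lambda>k. G_cov a (real (dy_idx (Suc k) s) / 2 ^ Suc k) (real (dy_idx (Suc k) t) / 2 ^ Suc k)) \<longlonglongrightarrow> G_cov a s t"
proof (cases "s = 0 \<or> t = 0")
  case True
  \<comment> \<open>The power 1 - a is singular at 0, but rounding fixes 0 and the covariance
    vanishes there.\<close>
  have "dy_idx k 0 = 0" for k by (simp add: dy_idx_def)
  then have "G_cov a (real (dy_idx (Suc k) s) / 2 ^ Suc k) (real (dy_idx (Suc k) t) / 2 ^ Suc k) = 0" for k
    using True G_cov_zero[OF a] by auto
  moreover have "G_cov a s t = 0" using True G_cov_zero[OF a] s t by auto
  ultimately show ?thesis by simp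
next
  case False
  then have "min s t \<noteq> 0" "max s t \<noteq> 0" using s t by auto
  then show ?thesis unfolding G_cov_def
    by (intro tendsto_intros tendsto_min tendsto_max dy_idx_limit s t) auto
qed

text \<open>Grid approximations converge almost surely and their variances converge, so both sides
  have the same characteristic function.\<close>

lemma G_linear_law:
  assumes len: "length cs = length ts" and ts: "set ts \<subseteq> {0..1}"
  shows "distr M borel (\<lambda>w. \<Sum>i<length ts. cs ! i * G w (ts ! i)) =
    centered_normal (\<Sum>i<length ts. \<Sum>j<length ts. cs ! i * cs ! j * G_cov a (ts ! i) (ts ! j))"
proof -
  let ?N = "length ts"
  have t: "0 \<le> ts ! i" "ts ! i \<le> 1" if "i < ?N" for i using ts nth_mem[OF that] by auto
  define Y where "Y k w = (\<Sum>i<?N. cs ! i * grid_path a (Suc k) w (dy_idx (Suc k) (ts ! i)))" for k w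
  define Z where "Z w = (\<Sum>i<?N. cs ! i * G w (ts ! i))" for w
  define v where "v k = (\<Sum>i<?N. \<Sum>j<?N. cs ! i * cs ! j * G_cov a (real (dy_idx (Suc k) (ts ! i)) / 2 ^ Suc k) (real (dy_idx (Suc k) (ts ! j)) / 2 ^ Suc k))" for k
  define u where "u = (\<Sum>i<?N. \<Sum>j<?N. cs ! i * cs ! j * G_cov a (ts ! i) (ts ! j))"
  have Ym: "Y k \<in> borel_measurable M" for k
    unfolding Y_def by (intro borel_measurable_sum borel_measurable_times borel_measurable_const measurable_grid_path)
  have Zm: "Z \<in> borel_measurable M"
    unfolding Z_def by (intro borel_measurable_sum borel_measurable_times borel_measurable_const measurable_G)
  have Yl: "distr M borel (Y k) = centered_normal (v k)" "v k \<ge> 0" for k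
    unfolding Y_def v_def by (rule grid_linear_law; (rule dy_idx_le)?; simp)+
  have vl: "v \<longlonglongrightarrow> u"
    unfolding v_def u_def by (intro tendsto_sum tendsto_mult tendsto_const G_cov_limit t) auto
  have u0: "u \<ge> 0" using vl by (rule LIMSEQ_le_const) (use Yl(2) in blast)
  have YZ: "(\<lambda>k. Y k w) \<longlonglongrightarrow> Z w" if "good w" for w
    unfolding Y_def Z_def by (intro tendsto_sum tendsto_mult tendsto_const grid_path_tendsto_G that t) auto
  have "distr M borel Z = centered_normal u"
  proof (rule Levy_uniqueness)
    show "real_distribution (distr M borel Z)" using Zm by (rule real_distribution_distr)
    show "real_distribution (centered_normal u)" by (rule real_distribution_centered_normal[OF u0])
    show "char (distr M borel Z) = char (centered_normal u)"
    proof
      fix \<theta> :: real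
      have chY: "char (distr M borel (Y k)) \<theta> = (CLINT w|M. iexp (\<theta> * Y k w))" for k
        unfolding char_def by (rule integral_distr[OF Ym]) simp
      have chZ: "char (distr M borel Z) \<theta> = (CLINT w|M. iexp (\<theta> * Z w))"
        unfolding char_def by (rule integral_distr[OF Zm]) simp
      have "(\<lambda>k. CLINT w|M. iexp (\<theta> * Y k w)) \<longlonglongrightarrow> (CLINT w|M. iexp (\<theta> * Z w))"
      proof (rule integral_dominated_convergence[where w="\<lambda>_. 1"])
        show "(\<lambda>w. iexp (\<theta> * Z w)) \<in> borel_measurable M"
          by (rule measurable_compose[OF Zm]) simp
        show "(\<lambda>w. iexp (\<theta> * Y k w)) \<in> borel_measurable M" for k
          by (rule measurable_compose[OF Ym]) simp
        show "AE w in M. (\<lambda>k. iexp (\<theta> * Y k w)) \<longlonglongrightarrow> iexp (\<theta> * Z w)"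
          using AE_good by eventually_elim (intro tendsto_intros YZ)
      qed auto
      then have "(\<lambda>k. char (distr M borel (Y k)) \<theta>) \<longlonglongrightarrow> char (distr M borel Z) \<theta>" unfolding chY chZ .
      moreover have "(\<lambda>k. char (distr M borel (Y k)) \<theta>) \<longlonglongrightarrow> char (centered_normal u) \<theta>"
        unfolding Yl(1) char_centered_normal[OF Yl(2)] char_centered_normal[OF u0]
        by (intro tendsto_intros vl) auto
      ultimately show "char (distr M borel Z) \<theta> = char (centered_normal u) \<theta>" by (rule LIMSEQ_unique)
    qed
  qed
  then show ?thesis unfolding u_def by (simp add: Z_def[abs_def])
qed

lemma cont_gaussian_G: "cont_gaussian_process M G (G_cov a)"
  unfolding cont_gaussian_process_def using prob_M measurable_G continuous_G G_linear_law by blast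

end

section \<open>Skorohod continuous functionals\<close>

lemma cadlag_floor_step:
  fixes \<phi> :: "int \<Rightarrow> real"
  assumes c: "c > 0"
  shows "cadlag (\<lambda>t. \<phi> \<lfloor>c * t\<rfloor>)"
  unfolding cadlag_def
proof (intro conjI ballI)
  fix t :: real
  define b where "b = (of_int \<lfloor>c * t\<rfloor> + 1) / c"
  have b: "t < b" unfolding b_def using c by (simp add: less_divide_eq mult.commute)
  have fl: "\<lfloor>c * s\<rfloor> = \<lfloor>c * t\<rfloor>" if "t < s" "s < b" for s
  proof (rule floor_unique)
    have "c * t \<le> c * s" using that c by simp
    then show "of_int \<lfloor>c * t\<rfloor> \<le> c * s" by linarith
    show "c * s < of_int \<lfloor>c * t\<rfloor> + 1" using that(2) c by (simp add: b_def less_divide_eq mult.commute)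
  qed
  have "\<forall>\<^sub>F s in at_right t. \<phi> \<lfloor>c * s\<rfloor> = \<phi> \<lfloor>c * t\<rfloor>"
    unfolding eventually_at_right[OF b] by (intro exI[of _ b] conjI allI impI b) (simp only: fl)
  then show "((\<lambda>t. \<phi> \<lfloor>c * t\<rfloor>) \<longlongrightarrow> \<phi> \<lfloor>c * t\<rfloor>) (at_right t)" by (rule tendsto_eventually)
next
  fix t :: real
  \<comment> \<open>The ceiling is used because at a jump time the left limit is the value of the
    step before it.\<close>
  define b where "b = (of_int \<lceil>c * t\<rceil> - 1) / c"
  have b: "b < t" unfolding b_def using c by (simp add: divide_less_eq mult.commute) linarith
  have fl: "\<lfloor>c * s\<rfloor> = \<lceil>c * t\<rceil> - 1" if "b < s" "s < t" for s
  proof (rule floor_unique)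
    show "of_int (\<lceil>c * t\<rceil> - 1) \<le> c * s" using that(1) c by (simp add: b_def divide_less_eq mult.commute)
    have "c * s < c * t" using that c by simp
    then show "c * s < of_int (\<lceil>c * t\<rceil> - 1) + 1" by simp linarith
  qed
  have "\<forall>\<^sub>F s in at_left t. \<phi> \<lfloor>c * s\<rfloor> = \<phi> (\<lceil>c * t\<rceil> - 1)"
    unfolding eventually_at_left[OF b] by (intro exI[of _ b] conjI allI impI b) (simp only: fl)
  then show "\<exists>l. ((\<lambda>t. \<phi> \<lfloor>c * t\<rfloor>) \<longlongrightarrow> l) (at_left t)" by (intro exI) (rule tendsto_eventually)
qed

lemma cadlag_scaled_Delta: "n \<ge> 1 \<Longrightarrow> cadlag (scaled_Delta n xs)"
  using cadlag_floor_step[of "2 * real n" "\<lambda>z. real_of_int (Delta xs (nat z)) / sqrt (real n)"]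
  by (simp add: scaled_Delta_def[abs_def])

definition step_path :: "nat \<Rightarrow> (nat \<Rightarrow> real) \<Rightarrow> real \<Rightarrow> real" where
  "step_path m v t = v (nat \<lfloor>2 ^ m * t\<rfloor>)"

lemma cadlag_step_path: "cadlag (step_path m v)"
  using cadlag_floor_step[of "2 ^ m" "\<lambda>z. v (nat z)"] by (simp add: step_path_def[abs_def])

lemma cadlag_continuous:
  assumes "continuous_on {0..1} x" shows "cadlag x"
  unfolding cadlag_def
proof (intro conjI ballI)
  fix t :: real assume t: "t \<in> {0..<1}"
  then have "(x \<longlongrightarrow> x t) (at t within {0..1})" using assms by (auto simp: continuous_on_def)
  then have "(x \<longlongrightarrow> x t) (at t within {t..1})" by (rule tendsto_within_subset) (use t in auto)
  then show "(x \<longlongrightarrow> x t) (at_right t)" using t by (simp add: at_within_Icc_at_right)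
next
  fix t :: real assume t: "t \<in> {0<..1}"
  then have "(x \<longlongrightarrow> x t) (at t within {0..1})" using assms by (auto simp: continuous_on_def)
  then have "(x \<longlongrightarrow> x t) (at t within {0..t})" by (rule tendsto_within_subset) (use t in auto)
  then show "\<exists>l. (x \<longlongrightarrow> l) (at_left t)" using t by (auto simp: at_within_Icc_at_left)
qed

definition unif_close :: "real \<Rightarrow> (real \<Rightarrow> real) \<Rightarrow> (real \<Rightarrow> real) \<Rightarrow> bool" where
  "unif_close r x y \<longleftrightarrow> (\<forall>t\<in>{0..1}. \<bar>x t - y t\<bar> \<le> r)"

lemma unif_close_nonneg: "unif_close r x y \<Longrightarrow> 0 \<le> r"
  unfolding unif_close_def by (rule order_trans[of _ "\<bar>x 0 - y 0\<bar>"]) auto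

text \<open>The identity is an admissible time change. For the infimum to be a lower bound the set
  must be bounded below; a time change maps [0, 1] into itself, so its first supremum is finite and
  nonnegative, whatever the second one is.\<close>

lemma skorohod_dist_le:
  assumes "unif_close r x y" shows "skorohod_dist x y \<le> r"
  unfolding skorohod_dist_def
proof (rule order_trans[OF cINF_lower])
  let ?D = "\<lambda>l. max (SUP t\<in>{0..1}. \<bar>l t - t\<bar>) (SUP t\<in>{0..1}. \<bar>x t - y (l t)\<bar>)"
  show "(\<lambda>t. t) \<in> skorohod_time_changes"
    by (auto simp: skorohod_time_changes_def strict_mono_on_def)
  show "?D (\<lambda>t. t) \<le> r"
    using assms unif_close_nonneg[OF assms] by (auto simp: unif_close_def intro!: cSUP_least)
  have "0 \<le> ?D l" if l: "l \<in> skorohod_time_changes" for l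
  proof -
    have b: "\<bar>l t - t\<bar> \<le> 1" if t: "t \<in> {0..1}" for t
    proof -
      have mono: "strict_mono_on {0..1} l" "l 0 = 0" "l 1 = 1" using l by (auto simp: skorohod_time_changes_def)
      have "l 0 \<le> l t" "l t \<le> l 1"
        using strict_mono_on_imp_mono_on[OF mono(1)] t by (auto simp: mono_on_def)
      then show ?thesis using t mono by auto
    qed
    have "\<bar>l 0 - 0\<bar> \<le> (SUP t\<in>{0..1}. \<bar>l t - t\<bar>)"
      by (rule cSUP_upper2[where x=0]) (auto intro!: bdd_aboveI2[where M=1] b)
    then show ?thesis by linarith
  qed
  then show "bdd_below (?D ` skorohod_time_changes)" by (intro bdd_belowI2[where m=0])
qed

text \<open>The inf-convolution replaces a Skorohod continuous functional by functionals that are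
  Lipschitz for the uniform distance and increase to it; taking the infimum over admissible radii
  \<^term>\<open>r\<close> avoids suprema of possibly unbounded functions.\<close>

definition inf_conv :: "((real \<Rightarrow> real) \<Rightarrow> real) \<Rightarrow> real \<Rightarrow> (real \<Rightarrow> real) \<Rightarrow> real" where
  "inf_conv f k x = Inf {f y + k * r | y r. cadlag y \<and> unif_close r x y}"

context
  fixes f :: "(real \<Rightarrow> real) \<Rightarrow> real" and B :: real
  assumes fB: "\<And>x. cadlag x \<Longrightarrow> \<bar>f x\<bar> \<le> B"
begin

lemma inf_conv_le:
  assumes "k \<ge> 0" "cadlag y" "unif_close r x y"
  shows "inf_conv f k x \<le> f y + k * r"
  unfolding inf_conv_def
proof (rule cInf_lower)
  show "bdd_below {f y + k * r | y r. cadlag y \<and> unif_close r x y}"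
  proof (rule bdd_belowI[of _ "- B"], clarify)
    fix y r assume "cadlag y" "unif_close r x y"
    then show "- B \<le> f y + k * r"
      using fB[of y] mult_nonneg_nonneg[OF assms(1) unif_close_nonneg[of r x y]] by linarith
  qed
qed (use assms in blast)

lemma inf_conv_ge:
  assumes "cadlag x" "\<And>y r. cadlag y \<Longrightarrow> unif_close r x y \<Longrightarrow> c \<le> f y + k * r"
  shows "c \<le> inf_conv f k x"
  unfolding inf_conv_def
proof (rule cInf_greatest)
  have "unif_close 0 x x" by (simp add: unif_close_def)
  then show "{f y + k * r | y r. cadlag y \<and> unif_close r x y} \<noteq> {}" using assms(1) by blast
qed (use assms(2) in blast)

lemma inf_conv_le_self: "k \<ge> 0 \<Longrightarrow> cadlag x \<Longrightarrow> inf_conv f k x \<le> f x"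
  using inf_conv_le[of k x 0 x] by (simp add: unif_close_def)

lemma inf_conv_bound:
  assumes "k \<ge> 0" "cadlag x" shows "\<bar>inf_conv f k x\<bar> \<le> B"
proof -
  have "- B \<le> inf_conv f k x"
  proof (rule inf_conv_ge[OF assms(2)])
    fix y r assume "cadlag y" "unif_close r x y"
    then show "- B \<le> f y + k * r"
      using fB[of y] mult_nonneg_nonneg[OF assms(1) unif_close_nonneg[of r x y]] by linarith
  qed
  moreover have "inf_conv f k x \<le> B" using inf_conv_le_self[OF assms] fB[OF assms(2)] by linarith
  ultimately show ?thesis by linarith
qed

text \<open>A competitor at radius r from x' is a competitor at radius d + r from x.\<close>

lemma inf_conv_lipschitz_le:
  assumes k: "k \<ge> 0" and x: "cadlag x'" "unif_close d x x'"
  shows "inf_conv f k x \<le> inf_conv f k x' + k * d"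
proof -
  have "inf_conv f k x - k * d \<le> inf_conv f k x'"
  proof (rule inf_conv_ge[OF x(1)])
    fix y r assume y: "cadlag y" "unif_close r x' y"
    have "unif_close (d + r) x y" unfolding unif_close_def
    proof
      fix t :: real assume "t \<in> {0..1}"
      then have "\<bar>x t - x' t\<bar> \<le> d" "\<bar>x' t - y t\<bar> \<le> r" using x y by (auto simp: unif_close_def)
      then show "\<bar>x t - y t\<bar> \<le> d + r" by linarith
    qed
    from inf_conv_le[OF k y(1) this] show "inf_conv f k x - k * d \<le> f y + k * r" by (simp add: distrib_left)
  qed
  then show ?thesis by linarith
qed

lemma inf_conv_lipschitz:
  assumes k: "k \<ge> 0" and x: "cadlag x" "cadlag x'" "unif_close d x x'"
  shows "\<bar>inf_conv f k x - inf_conv f k x'\<bar> \<le> k * d"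
proof -
  have "unif_close d x' x" using x(3) by (simp add: unif_close_def abs_minus_commute)
  from inf_conv_lipschitz_le[OF k x(1) this] inf_conv_lipschitz_le[OF k x(2,3)] show ?thesis by linarith
qed

lemma inf_conv_tendsto:
  assumes cont: "\<And>x e. cadlag x \<Longrightarrow> e > 0 \<Longrightarrow> \<exists>d>0. \<forall>y. cadlag y \<longrightarrow> skorohod_dist x y < d \<longrightarrow> \<bar>f y - f x\<bar> < e"
    and x: "cadlag x"
  shows "(\<lambda>k. inf_conv f (real k) x) \<longlonglongrightarrow> f x"
proof (rule LIMSEQ_I)
  fix e :: real assume e: "e > 0"
  obtain d where d: "d > 0" "\<And>y. cadlag y \<Longrightarrow> skorohod_dist x y < d \<Longrightarrow> \<bar>f y - f x\<bar> < e / 2"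
    using cont[OF x, of "e / 2"] e by auto
  \<comment> \<open>For such slopes a competitor at radius at least \<open>d\<close> pays 2 B, more
    than the values of \<open>f\<close> can differ; only nearby competitors matter, where continuity
    applies.\<close>
  obtain K :: nat where K: "2 * B / d \<le> real K" using real_arch_simple by blast
  have "norm (inf_conv f (real k) x - f x) < e" if k: "k \<ge> K" for k
  proof -
    have "f x - e / 2 \<le> inf_conv f (real k) x"
    proof (rule inf_conv_ge[OF x])
      fix y r assume y: "cadlag y" "unif_close r x y"
      have r: "0 \<le> r" using unif_close_nonneg[OF y(2)] .
      show "f x - e / 2 \<le> f y + real k * r"
      proof (cases "r < d")
        case True
        then have "skorohod_dist x y < d" using skorohod_dist_le[OF y(2)] by linarith
        from d(2)[OF y(1) this] mult_nonneg_nonneg[OF of_nat_0_le_iff[of k] r] show ?thesis by linarith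
      next
        case False
        have "2 * B \<le> real K * d" using K d(1) by (simp add: divide_le_eq)
        also have "\<dots> \<le> real k * r" using k False d r by (intro mult_mono) auto
        finally show ?thesis using fB[OF x] fB[OF y(1)] e by linarith
      qed
    qed
    moreover have "inf_conv f (real k) x \<le> f x" by (rule inf_conv_le_self[OF _ x]) simp
    ultimately show ?thesis using e by simp
  qed
  then show "\<exists>no. \<forall>k\<ge>no. norm (inf_conv f (real k) x - f x) < e" by blast
qed

end

section \<open>Convergence for Lipschitz functionals, then for Skorohod continuous ones\<close>

context dyadic_gauss
begin

lemma cadlag_G: "cadlag (G w)"
  by (rule cadlag_continuous[OF continuous_G])

lemma dy_idx_eq: "0 \<le> t \<Longrightarrow> t \<le> 1 \<Longrightarrow> nat \<lfloor>2 ^ m * t\<rfloor> = dy_idx m t"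
  by (simp add: dy_idx_def mult.commute max_def min_def)

context
  fixes F :: "(real \<Rightarrow> real) \<Rightarrow> real" and L B :: real
  assumes FB: "\<And>x. cadlag x \<Longrightarrow> \<bar>F x\<bar> \<le> B" and L: "L \<ge> 0"
    and FL: "\<And>x y r. cadlag x \<Longrightarrow> cadlag y \<Longrightarrow> unif_close r x y \<Longrightarrow> \<bar>F x - F y\<bar> \<le> L * r"
begin

text \<open>On [0, 1] a step path reads only the coordinates up to 2^m, so its uniform distance to
  another one is at most a finite sum of coordinate distances.\<close>

lemma continuous_step_functional: "continuous_on UNIV (\<lambda>v. F (step_path m v))"
  unfolding continuous_on_def
proof
  fix v :: "nat \<Rightarrow> real"
  have close: "\<bar>F (step_path m u) - F (step_path m v)\<bar> \<le> L * (\<Sum>l\<le>2 ^ m. \<bar>u l - v l\<bar>)" for u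
  proof (rule FL[OF cadlag_step_path cadlag_step_path])
    show "unif_close (\<Sum>l\<le>2 ^ m. \<bar>u l - v l\<bar>) (step_path m u) (step_path m v)"
      unfolding unif_close_def
    proof
      fix t :: real assume t: "t \<in> {0..1}"
      then have e: "nat \<lfloor>2 ^ m * t\<rfloor> = dy_idx m t" by (intro dy_idx_eq) auto
      show "\<bar>step_path m u t - step_path m v t\<bar> \<le> (\<Sum>l\<le>2 ^ m. \<bar>u l - v l\<bar>)"
        unfolding step_path_def e using dy_idx_le[of m t]
        by (intro member_le_sum[where f="\<lambda>l. \<bar>u l - v l\<bar>"]) auto
    qed
  qed
  have coord: "((\<lambda>u. u l) \<longlongrightarrow> v l) (at v within UNIV)" for l
    using continuous_on_product_coordinates[of l] by (auto simp: continuous_on_def)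
  have "((\<lambda>u. L * (\<Sum>l\<le>2 ^ m. \<bar>u l - v l\<bar>)) \<longlongrightarrow> L * (\<Sum>l\<le>2 ^ m. \<bar>v l - v l\<bar>)) (at v within UNIV)"
    by (intro tendsto_intros coord)
  then have "((\<lambda>u. L * (\<Sum>l\<le>2 ^ m. \<bar>u l - v l\<bar>)) \<longlongrightarrow> 0) (at v within UNIV)" by simp
  then have "((\<lambda>u. F (step_path m u) - F (step_path m v)) \<longlongrightarrow> 0) (at v within UNIV)"
    by (rule Lim_null_comparison[rotated]) (auto intro!: always_eventually simp: close)
  then show "((\<lambda>v. F (step_path m v)) \<longlongrightarrow> F (step_path m v)) (at v within UNIV)"
    by (simp add: LIM_zero_iff)
qed

lemma step_functional_tendsto:
  assumes w: "good w"
  shows "(\<lambda>m. F (step_path (Suc m) (grid_path a (Suc m) w))) \<longlonglongrightarrow> F (G w)"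
proof (rule LIMSEQ_I)
  fix e :: real assume e: "e > 0"
  have "e / (L + 1) > 0" using e L by simp
  then obtain p where p: "1 / real (Suc p) < e / (L + 1)" using nat_approx_posE by blast
  obtain q where q: "regular p q w" using w by (auto simp: good_def)
  obtain j where j: "j \<ge> 1" "(1::real) / 2 ^ j \<le> 1 / (2 * real (Suc q))" by (rule ex_half_power_le)
  have "norm (F (step_path (Suc m) (grid_path a (Suc m) w)) - F (G w)) < e" if m: "m \<ge> j" for m
  proof -
    have "unif_close (1 / real (Suc p)) (step_path (Suc m) (grid_path a (Suc m) w)) (G w)"
      unfolding unif_close_def
    proof
      fix t :: real assume t: "t \<in> {0..1}"
      then have t': "0 \<le> t" "t \<le> 1" by auto
      let ?l = "dy_idx (Suc m) t"
      have "step_path (Suc m) (grid_path a (Suc m) w) t = G w (real ?l / 2 ^ Suc m)"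
        unfolding step_path_def dy_idx_eq[OF t'] using G_dyadic[OF w _ dy_idx_le, of "Suc m" t] by simp
      moreover have "\<bar>G w (real ?l / 2 ^ Suc m) - G w t\<bar> \<le> 1 / real (Suc p)"
      proof (rule G_close[OF w q _ _ t'])
        show "0 \<le> real ?l / 2 ^ Suc m" by simp
        show "real ?l / 2 ^ Suc m \<le> 1" using dy_idx_bounds(1)[OF t', of "Suc m"] t' by linarith
        have "(1::real) / 2 ^ Suc m \<le> 1 / 2 ^ j" using m by (intro divide_left_mono power_increasing) auto
        then show "\<bar>real ?l / 2 ^ Suc m - t\<bar> \<le> 1 / (2 * real (Suc q))"
          using dy_idx_bounds[OF t', of "Suc m"] j(2) by linarith
      qed
      ultimately show "\<bar>step_path (Suc m) (grid_path a (Suc m) w) t - G w t\<bar> \<le> 1 / real (Suc p)" by simp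
    qed
    from FL[OF cadlag_step_path cadlag_G this]
    have "\<bar>F (step_path (Suc m) (grid_path a (Suc m) w)) - F (G w)\<bar> \<le> L * (1 / real (Suc p))" .
    also have "\<dots> \<le> (L + 1) * (1 / real (Suc p))" by (intro mult_right_mono) auto
    also have "\<dots> < (L + 1) * (e / (L + 1))" using p L by (intro mult_strict_left_mono) auto
    also have "\<dots> = e" using L by simp
    finally show ?thesis by simp
  qed
  then show "\<exists>no. \<forall>m\<ge>no. norm (F (step_path (Suc m) (grid_path a (Suc m) w)) - F (G w)) < e" by blast
qed

lemma measurable_step_functional: "(\<lambda>w. F (step_path m (grid_path a m w))) \<in> borel_measurable M"
  using measurable_compose[OF measurable_grid_path_vec borel_measurable_continuous_onI[OF continuous_step_functional]] .

text \<open>No measurability of \<open>F\<close> is assumed. It follows because on good paths the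
  value is the limit of continuous functions of finitely many coordinates, and elsewhere
  \<open>G\<close> is the zero path.\<close>

lemma measurable_functional_G: "(\<lambda>w. F (G w)) \<in> borel_measurable M"
proof -
  have G0: "G w = (\<lambda>_. 0)" if "\<not> good w" for w using that by (auto simp: G_def)
  have "(\<lambda>w. if good w then lim (\<lambda>m. F (step_path (Suc m) (grid_path a (Suc m) w))) else F (\<lambda>_. 0)) \<in> borel_measurable M"
  proof (rule measurable_If)
    show "(\<lambda>w. lim (\<lambda>m. F (step_path (Suc m) (grid_path a (Suc m) w)))) \<in> borel_measurable M"
      by (rule borel_measurable_lim_metric) (rule measurable_step_functional)
    show "{x \<in> space M. good x} \<in> sets M" by (rule predE[OF measurable_good])
  qed simp
  moreover have "(if good w then lim (\<lambda>m. F (step_path (Suc m) (grid_path a (Suc m) w))) else F (\<lambda>_. 0)) = F (G w)" for w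
    using limI[OF step_functional_tendsto[of w]] G0[of w] by simp
  ultimately show ?thesis by (simp only:)
qed

text \<open>Three comparisons: the urn with its step approximation, by the modulus; the step
  approximations of urn and limit, by finite-dimensional convergence; the step approximation of the
  limit with the limit itself. The grid is fixed before n tends to infinity.\<close>

lemma lipschitz_functional_limit:
  "(\<lambda>n. measure_pmf.expectation (cond_pmf (urn_chain a n) (bingo_nn n)) (\<lambda>xs. F (scaled_Delta n xs))) \<longlonglongrightarrow> (\<integral>w. F (G w) \<partial>M)"
proof (rule LIMSEQ_I)
  fix e :: real assume e: "e > 0"
  have B0: "B \<ge> 0" using FB[OF cadlag_G[of undefined]] by linarith
  \<comment> \<open>Both constants contribute a quarter of \<open>e\<close>: through the Lipschitz
    bound on paths with a small modulus, and through 2 B on the exceptional event.\<close>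
  define \<epsilon> where "\<epsilon> = e / (4 * (L + 1))"
  define \<rho> where "\<rho> = e / (8 * (B + 1))"
  have \<epsilon>: "\<epsilon> > 0" and \<rho>: "\<rho> > 0" using e L B0 by (auto simp: \<epsilon>_def \<rho>_def)
  obtain \<delta> where \<delta>: "\<delta> > 0" and ev: "\<forall>\<^sub>F n in sequentially. measure_pmf.prob (cond_pmf (urn_chain a n) (bingo_nn n))
       {xs. \<exists>s t. 0 \<le> s \<and> s \<le> t \<and> t \<le> 1 \<and> t - s \<le> \<delta> \<and> \<epsilon> < \<bar>scaled_Delta n xs t - scaled_Delta n xs s\<bar>} \<le> \<rho>"
    using bingo_modulus[OF a \<epsilon> \<rho>] by blast
  have "(\<lambda>m. \<integral>w. F (step_path (Suc m) (grid_path a (Suc m) w)) \<partial>M) \<longlonglongrightarrow> (\<integral>w. F (G w) \<partial>M)"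
  proof (rule integral_dominated_convergence[where w="\<lambda>_. B"])
    show "AE w in M. (\<lambda>m. F (step_path (Suc m) (grid_path a (Suc m) w))) \<longlonglongrightarrow> F (G w)"
      using AE_good by eventually_elim (rule step_functional_tendsto)
    show "AE w in M. norm (F (step_path (Suc m) (grid_path a (Suc m) w))) \<le> B" for m
      using FB[OF cadlag_step_path] by simp
  qed (auto intro: measurable_functional_G measurable_step_functional)
  then have "\<forall>\<^sub>F m in sequentially. \<bar>(\<integral>w. F (step_path (Suc m) (grid_path a (Suc m) w)) \<partial>M) - (\<integral>w. F (G w) \<partial>M)\<bar> < e / 4"
    using e by (auto dest!: tendstoD[where e="e / 4"] simp: dist_real_def)
  moreover have "\<forall>\<^sub>F m in sequentially. (1::real) / 2 ^ Suc m \<le> \<delta>" using \<delta> by real_asymp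
  ultimately have "\<forall>\<^sub>F m in sequentially. \<bar>(\<integral>w. F (step_path (Suc m) (grid_path a (Suc m) w)) \<partial>M) - (\<integral>w. F (G w) \<partial>M)\<bar> < e / 4 \<and> (1::real) / 2 ^ Suc m \<le> \<delta>"
    by eventually_elim auto
  then obtain m0 where m0: "\<bar>(\<integral>w. F (step_path (Suc m0) (grid_path a (Suc m0) w)) \<partial>M) - (\<integral>w. F (G w) \<partial>M)\<bar> < e / 4" "(1::real) / 2 ^ Suc m0 \<le> \<delta>"
    by (auto simp: eventually_sequentially)
  define m where "m = Suc m0"
  have m1: "m \<ge> 1" by (simp add: m_def)
  have "(\<lambda>n. measure_pmf.expectation (cond_pmf (urn_chain a n) (bingo_nn n)) (\<lambda>xs. F (step_path m (grid_vec m (scaled_Delta n xs)))))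
      \<longlonglongrightarrow> (\<integral>w. F (step_path m (grid_path a m w)) \<partial>M)"
    by (rule fdd_limit[OF a m1 continuous_step_functional FB[OF cadlag_step_path] law[OF m1] measurable_grid_vec])
  then have "\<forall>\<^sub>F n in sequentially. \<bar>measure_pmf.expectation (cond_pmf (urn_chain a n) (bingo_nn n)) (\<lambda>xs. F (step_path m (grid_vec m (scaled_Delta n xs)))) -
       (\<integral>w. F (step_path m (grid_path a m w)) \<partial>M)\<bar> < e / 4"
    using e by (auto dest!: tendstoD[where e="e / 4"] simp: dist_real_def)
  with ev eventually_ge_at_top[of 1]
  have "\<forall>\<^sub>F n in sequentially. \<bar>measure_pmf.expectation (cond_pmf (urn_chain a n) (bingo_nn n)) (\<lambda>xs. F (scaled_Delta n xs)) - (\<integral>w. F (G w) \<partial>M)\<bar> < e"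
  proof eventually_elim
    case (elim n)
    let ?P = "cond_pmf (urn_chain a n) (bingo_nn n)"
    let ?A = "{xs. \<exists>s t. 0 \<le> s \<and> s \<le> t \<and> t \<le> 1 \<and> t - s \<le> \<delta> \<and> \<epsilon> < \<bar>scaled_Delta n xs t - scaled_Delta n xs s\<bar>}"
    let ?S = "\<lambda>xs. scaled_Delta n xs" and ?T = "\<lambda>xs. step_path m (grid_vec m (scaled_Delta n xs))"
    have cS: "cadlag (?S xs)" for xs by (rule cadlag_scaled_Delta[OF elim(2)])
    have pt: "\<bar>F (?S xs) - F (?T xs)\<bar> \<le> L * \<epsilon> + 2 * B * indicator ?A xs" for xs
    proof (cases "xs \<in> ?A")
      case True
      have "\<bar>F (?S xs) - F (?T xs)\<bar> \<le> 2 * B" using FB[OF cS[of xs]] FB[OF cadlag_step_path[of m "grid_vec m (scaled_Delta n xs)"]] by linarith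
      then show ?thesis using True L \<epsilon> by (simp add: add_increasing)
    next
      case False
      have "unif_close \<epsilon> (?S xs) (?T xs)" unfolding unif_close_def
      proof
        fix t :: real assume t: "t \<in> {0..1}"
        then have t': "0 \<le> t" "t \<le> 1" by auto
        let ?u = "real (dy_idx m t) / 2 ^ m"
        have "?T xs t = scaled_Delta n xs ?u"
          unfolding step_path_def dy_idx_eq[OF t'] using dy_idx_le[of m t]
          by (cases "dy_idx m t = 0") (auto simp: grid_vec_def scaled_Delta_def Delta_def)
        moreover have "\<not> \<epsilon> < \<bar>scaled_Delta n xs t - scaled_Delta n xs ?u\<bar>"
        proof
          assume lt: "\<epsilon> < \<bar>scaled_Delta n xs t - scaled_Delta n xs ?u\<bar>"
          have "0 \<le> ?u" "?u \<le> t" "t - ?u \<le> \<delta>"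
            using dy_idx_bounds[OF t', of m] m0(2) by (auto simp: m_def[symmetric])
          with lt t' have "xs \<in> ?A" by (intro CollectI exI[of _ ?u] exI[of _ t] conjI)
          with False show False by (rule notE)
        qed
        ultimately show "\<bar>?S xs t - ?T xs t\<bar> \<le> \<epsilon>" by simp
      qed
      from FL[OF cS cadlag_step_path this] show ?thesis using False by simp
    qed
    have int: "integrable (measure_pmf ?P) (\<lambda>xs. F (?S xs))" "integrable (measure_pmf ?P) (\<lambda>xs. F (?T xs))"
      using FB[OF cS] FB[OF cadlag_step_path] by (auto intro!: measure_pmf.integrable_const_bound[where B=B])
    have "\<bar>measure_pmf.expectation ?P (\<lambda>xs. F (?S xs)) - measure_pmf.expectation ?P (\<lambda>xs. F (?T xs))\<bar> =
        \<bar>measure_pmf.expectation ?P (\<lambda>xs. F (?S xs) - F (?T xs))\<bar>" using int by simp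
    also have "\<dots> \<le> measure_pmf.expectation ?P (\<lambda>xs. \<bar>F (?S xs) - F (?T xs)\<bar>)" by (rule integral_abs_bound)
    also have "\<dots> \<le> measure_pmf.expectation ?P (\<lambda>xs. L * \<epsilon> + 2 * B * indicator ?A xs)"
    proof (rule integral_mono[OF _ _ pt])
      show "integrable (measure_pmf ?P) (\<lambda>xs. \<bar>F (?S xs) - F (?T xs)\<bar>)" using int by auto
      show "integrable (measure_pmf ?P) (\<lambda>xs. L * \<epsilon> + 2 * B * indicator ?A xs)"
        by (intro measure_pmf.integrable_const_bound[where B="L * \<epsilon> + 2 * B"]) (use L \<epsilon> B0 in \<open>auto simp: indicator_def\<close>)
    qed
    also have "\<dots> = L * \<epsilon> + 2 * B * measure_pmf.prob ?P ?A"
    proof -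
      have "integrable (measure_pmf ?P) (\<lambda>xs. 2 * B * indicator ?A xs :: real)"
        by (intro measure_pmf.integrable_const_bound[where B="2 * B"]) (use B0 in \<open>auto simp: indicator_def\<close>)
      then show ?thesis by (subst Bochner_Integration.integral_add) auto
    qed
    also have "\<dots> \<le> (L + 1) * \<epsilon> + 2 * (B + 1) * \<rho>"
      using elim(1) \<epsilon> \<rho> B0 L by (intro add_mono mult_mono) auto
    also have "\<dots> = e / 4 + e / 4"
    proof -
      have "(L + 1) * \<epsilon> = e / 4" using L by (simp add: \<epsilon>_def field_simps)
      moreover have "2 * (B + 1) * \<rho> = e / 4" using B0 by (simp add: \<rho>_def field_simps)
      ultimately show ?thesis by simp
    qed
    finally show ?case using elim(3) m0(1) unfolding m_def[symmetric] by linarith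
  qed
  then show "\<exists>no. \<forall>n\<ge>no. norm (measure_pmf.expectation (cond_pmf (urn_chain a n) (bingo_nn n)) (\<lambda>xs. F (scaled_Delta n xs)) - (\<integral>w. F (G w) \<partial>M)) < e"
    by (simp add: eventually_sequentially)
qed

end

text \<open>The inf-convolutions are Lipschitz minorants converging pointwise to \<open>f\<close>.
  Some minorant has almost the full integral along \<open>G\<close>, and the Lipschitz limit theorem
  applies to it. Measurability of \<open>f\<close> along \<open>G\<close> comes from the same
  approximation.\<close>

lemma bcont_functional_lower:
  assumes f: "skorohod_bcont f"
  shows "integrable M (\<lambda>w. f (G w))"
    "e > 0 \<Longrightarrow> \<forall>\<^sub>F n in sequentially. (\<integral>w. f (G w) \<partial>M) - e <
      measure_pmf.expectation (cond_pmf (urn_chain a n) (bingo_nn n)) (\<lambda>xs. f (scaled_Delta n xs))"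
proof -
  obtain B where fB: "\<And>x. cadlag x \<Longrightarrow> \<bar>f x\<bar> \<le> B" using f by (auto simp: skorohod_bcont_def)
  have cont: "\<exists>d>0. \<forall>y. cadlag y \<longrightarrow> skorohod_dist x y < d \<longrightarrow> \<bar>f y - f x\<bar> < e" if "cadlag x" "e > 0" for x e
    using f that unfolding skorohod_bcont_def by blast
  let ?F = "\<lambda>k :: nat. inf_conv f (real k)"
  have FB: "\<bar>?F k x\<bar> \<le> B" if "cadlag x" for k x using inf_conv_bound[of f B "real k" x, OF fB _ that] by simp
  have FL: "\<bar>?F k x - ?F k y\<bar> \<le> real k * r" if "cadlag x" "cadlag y" "unif_close r x y" for k x y r
    using inf_conv_lipschitz[of f B "real k" x y r, OF fB _ that] by simp
  have Fm: "(\<lambda>w. ?F k (G w)) \<in> borel_measurable M" for k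
    by (rule measurable_functional_G[where F="?F k" and B=B and L="real k"]) (auto intro: FB FL)
  have Flim: "(\<lambda>k. ?F k x) \<longlonglongrightarrow> f x" if "cadlag x" for x
    by (rule inf_conv_tendsto[of f B, OF fB cont that]) auto
  have fm: "(\<lambda>w. f (G w)) \<in> borel_measurable M"
    by (rule borel_measurable_LIMSEQ_real[OF _ Fm]) (rule Flim[OF cadlag_G])
  show "integrable M (\<lambda>w. f (G w))"
    by (rule integrable_const_bound[where B=B]) (auto intro: fm simp: fB[OF cadlag_G])
  assume e: "e > 0"
  have "(\<lambda>k. \<integral>w. ?F k (G w) \<partial>M) \<longlonglongrightarrow> (\<integral>w. f (G w) \<partial>M)"
    by (rule integral_dominated_convergence[where w="\<lambda>_. B"]) (auto intro: fm Fm Flim cadlag_G simp: FB[OF cadlag_G])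
  then have "\<forall>\<^sub>F k in sequentially. (\<integral>w. f (G w) \<partial>M) - e / 2 < (\<integral>w. ?F k (G w) \<partial>M)"
    using e by (intro order_tendstoD(1)) auto
  then obtain k where k: "(\<integral>w. f (G w) \<partial>M) - e / 2 < (\<integral>w. ?F k (G w) \<partial>M)" by (auto simp: eventually_sequentially)
  have "(\<lambda>n. measure_pmf.expectation (cond_pmf (urn_chain a n) (bingo_nn n)) (\<lambda>xs. ?F k (scaled_Delta n xs))) \<longlonglongrightarrow> (\<integral>w. ?F k (G w) \<partial>M)"
    by (rule lipschitz_functional_limit[where F="?F k" and B=B and L="real k"]) (auto intro: FB FL)
  then have "\<forall>\<^sub>F n in sequentially. (\<integral>w. ?F k (G w) \<partial>M) - e / 2 <
      measure_pmf.expectation (cond_pmf (urn_chain a n) (bingo_nn n)) (\<lambda>xs. ?F k (scaled_Delta n xs))"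
    using e by (intro order_tendstoD(1)) auto
  then show "\<forall>\<^sub>F n in sequentially. (\<integral>w. f (G w) \<partial>M) - e <
      measure_pmf.expectation (cond_pmf (urn_chain a n) (bingo_nn n)) (\<lambda>xs. f (scaled_Delta n xs))"
    using eventually_ge_at_top[of 1]
  proof eventually_elim
    case (elim n)
    have c: "cadlag (scaled_Delta n xs)" for xs by (rule cadlag_scaled_Delta[OF elim(2)])
    have "measure_pmf.expectation (cond_pmf (urn_chain a n) (bingo_nn n)) (\<lambda>xs. ?F k (scaled_Delta n xs)) \<le>
       measure_pmf.expectation (cond_pmf (urn_chain a n) (bingo_nn n)) (\<lambda>xs. f (scaled_Delta n xs))"
    proof (rule integral_mono)
      show "?F k (scaled_Delta n xs) \<le> f (scaled_Delta n xs)" for xs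
        using inf_conv_le_self[of f B "real k" "scaled_Delta n xs", OF fB _ c] by simp
    qed (auto intro!: measure_pmf.integrable_const_bound[where B=B] simp: FB[OF c] fB[OF c])
    then show ?case using elim(1) k by linarith
  qed
qed

text \<open>The lower bound is applied to \<open>f\<close> and to its negative, which is again
  bounded and continuous.\<close>

lemma bcont_functional_limit:
  assumes f: "skorohod_bcont f"
  shows "(\<lambda>n. measure_pmf.expectation (cond_pmf (urn_chain a n) (bingo_nn n)) (\<lambda>xs. f (scaled_Delta n xs))) \<longlonglongrightarrow> (\<integral>w. f (G w) \<partial>M)"
proof (rule order_tendstoI)
  fix y assume "y < (\<integral>w. f (G w) \<partial>M)"
  then have "\<forall>\<^sub>F n in sequentially. (\<integral>w. f (G w) \<partial>M) - ((\<integral>w. f (G w) \<partial>M) - y) <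
      measure_pmf.expectation (cond_pmf (urn_chain a n) (bingo_nn n)) (\<lambda>xs. f (scaled_Delta n xs))"
    by (intro bcont_functional_lower(2)[OF f]) simp
  then show "\<forall>\<^sub>F n in sequentially. y < measure_pmf.expectation (cond_pmf (urn_chain a n) (bingo_nn n)) (\<lambda>xs. f (scaled_Delta n xs))" by simp
next
  fix y assume y: "(\<integral>w. f (G w) \<partial>M) < y"
  have f': "skorohod_bcont (\<lambda>x. - f x)"
    using f unfolding skorohod_bcont_def by (simp add: abs_minus_commute)
  have "\<forall>\<^sub>F n in sequentially. (\<integral>w. - f (G w) \<partial>M) - (y - (\<integral>w. f (G w) \<partial>M)) <
      measure_pmf.expectation (cond_pmf (urn_chain a n) (bingo_nn n)) (\<lambda>xs. - f (scaled_Delta n xs))"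
    using y by (intro bcont_functional_lower(2)[OF f']) simp
  then show "\<forall>\<^sub>F n in sequentially. measure_pmf.expectation (cond_pmf (urn_chain a n) (bingo_nn n)) (\<lambda>xs. f (scaled_Delta n xs)) < y"
    by eventually_elim simp
qed

end

theorem theorem1p2:
  fixes a :: real
  assumes "a > 1"
  shows "\<exists>(M :: (real \<Rightarrow> real) measure) (G :: (real \<Rightarrow> real) \<Rightarrow> real \<Rightarrow> real).
           cont_gaussian_process M G (G_cov a) \<and>
           (\<forall>f. skorohod_bcont f \<longrightarrow>
              integrable M (\<lambda>w. f (G w)) \<and>
              (\<lambda>n. measure_pmf.expectation (cond_pmf (urn_chain a n) (bingo_nn n))
                      (\<lambda>xs. f (scaled_Delta n xs)))
                \<longlonglongrightarrow> (\<integral>w. f (G w) \<partial>M))"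
proof -
  obtain M :: "(real \<Rightarrow> real) measure" where M: "prob_space M"
    "\<And>t. t \<in> (\<Union>m. dyadic_pts m) \<Longrightarrow> (\<lambda>w. w t) \<in> borel_measurable M"
    "\<And>m. m \<ge> 1 \<Longrightarrow> distr M borel (grid_vec m) = distr (gauss_blocks a m {1..<2 ^ m}) borel (\<lambda>x. grid_vec m (grid_sum m x))"
    by (rule dyadic_process[OF assms]) (rule that, assumption+)
  interpret dyadic_gauss a M by (rule dyadic_gauss.intro[OF assms M])
  show ?thesis
    using cont_gaussian_G bcont_functional_lower(1) bcont_functional_limit by blast
qed

end
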